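(* The cointeraction property $$(\mathrm{Id}\otimes\Delta^+_0)\,\Delta^-=m^{1,3}\,(\Delta^-_{\mathrm{non\text{-}root}}\otimes\Delta^-)\,\Delta^+_0$$ holds on $\mathfrak{T}$, where $m^{1,3}(a\otimes b\otimes c\otimes e)=ac\otimes b\otimes e$.
   Context: All vector spaces are over $\mathbb{R}$. Fix $d\ge1$ and write $\mathbb{N}=\{0,1,2,\dots\}$. For multi-indices in $\mathbb{N}^d$, factorials and binomials are products over components, and $\binom{n}{\ell_1,\dots,\ell_k}=\frac{n!}{\ell_1!\cdots\ell_k!\,(n-\ell_1-\cdots-\ell_k)!}$ (equal to $0$ if $n-\sum\ell_j\notin\mathbb{N}^d$). **Trees.** Fix a finite set $\mathcal{I}$ of kernels and a finite set $\Xi=\{X^1,\dots,X^n\}$ of noises and let $\mathcal{D}=(\mathcal{I}\cup\Xi)\times\mathbb{N}^d$. $\mathfrak{T}$ is the vector space with basis the planar rooted trees (finite, edges directed away from the root, outgoing edges of each vertex ordered left to right) with vertices decorated by $\mathbb{N}^d$ and edges decorated by $\mathcal{D}$, such that each vertex has at most one outgoing noise edge (edge with decoration in $\Xi\times\mathbb{N}^d$) and a vertex with an incoming noise edge (a noise vertex) has no outgoing edges. The regularity $|\tau|$ is the sum of: the sum of components of each vertex decoration; minus the sum of components of the $\mathbb{N}^d$-part of each edge decoration; $\alpha_i-1$ for each edge of type $X^i$ ($\alpha_i$ the regularity of $X^i$); the regularity of $G$ for each edge of type $G\in\mathcal{I}$. $N_\tau$ is the set of non-noise vertices of $\tau$,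 $\widetilde N_\tau$ the set of vertices not adjacent to any noise edge, $n_v$ the decoration of $v$. $\mathfrak{T}^-$ is the span of trees of negative regularity; $\mathfrak{T}^0\subset\mathfrak{T}$ the span of trees with no noise edge at the root. **The action $\ast_+:\mathfrak{T}^0\otimes\mathfrak{T}\to\mathfrak{T}$.** Let $x\in\mathfrak{T}^0$ be a tree with root decoration $m$, whose root has outgoing edges, from left to right, decorated $(G_j,a_j)$ and leading to subtrees $\sigma_j$, $j=1,\dots,k$. For a tree $y$, $x\ast_+y$ is the sum, over maps $f:\{1,\dots,k\}\to N_y$ (the root of $y$ is allowed), over $\ell_1,\dots,\ell_k\in\mathbb{N}^d$ and over $(\delta_u)_{u\in N_y}\in(\mathbb{N}^d)^{N_y}$ with $\sum_u\delta_u=m$, of $$\binom{m}{(\delta_u)_u}\prod_{u\in N_y}\binom{n_u}{(\ell_j)_{f(j)=u}}$$ times the tree obtained from $y$ by attaching each $\sigma_j$ to $f(j)$ by an edge decorated $(G_j,a_j-\ell_j)$, edges attached to the same $u$ being placed to the left of the existing outgoing edges of $u$ in increasing order of $j$, and replacing each decoration $n_u$ by $n_u-\sum_{f(j)=u}\ell_j+\delta_u$. Terms with $a_j-\ell_j\notin\mathbb{N}^d$ are zero. **Deformed insertion $\widehat\diamond$.** For trees $\tau\in\mathfrak{T}^-$, $\sigma\in\mathfrak{T}$ and $v\in\widetilde N_\sigma$, let $P_v(\sigma)$ be the subtree of $\sigma$ with root $v$ (all descendants of $v$, keeping the decoration of $v$). Then $\tau\,\widehat\diamond_v\,\sigma$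 is obtained from $\sigma$ by replacing the subtree $P_v(\sigma)$ by $P_v(\sigma)\ast_+\tau$ (the root of each term of $P_v(\sigma)\ast_+\tau$ takes the place of $v$, keeping its incoming edge and planar position), extended linearly. Put $\tau\,\widehat\diamond\,\sigma=\sum_{v\in\widetilde N_\sigma}\tau\,\widehat\diamond_v\,\sigma$. For $\tau_1,\dots,\tau_n\in\mathfrak{T}^-$ the action of the symmetric algebra $S(\mathfrak{T}^-)$ on $\mathfrak{T}$ is determined by $1\,\widehat\diamond\,\sigma=\sigma$ and $(\tau\omega)\,\widehat\diamond\,\sigma=\tau\,\widehat\diamond\,(\omega\,\widehat\diamond\,\sigma)-(\tau\,\widehat\diamond\,\omega)\,\widehat\diamond\,\sigma$, where $\tau\,\widehat\diamond\,\cdot$ acts on $S(\mathfrak{T}^-)$ as a derivation; equivalently $\tau_1\cdots\tau_n\,\widehat\diamond\,\sigma$ is the sum over injective maps $i\mapsto v_i\in\widetilde N_\sigma$ of the simultaneous deformed insertions of $\tau_i$ into $v_i$. Let $\widehat\diamond^{\,\mathrm{nr}}$ be the same action on $\mathfrak{T}^0$ but with insertions only into non-root vertices of $\sigma$. **Coactions.** Duals are taken with respect to the basis of trees (trees orthonormal), and on $S(\mathfrak{T}^-)$ with respect to $\langle\tau_1\cdots\tau_n,\sigma_1\cdots\sigma_m\rangle=\delta_{nm}\sum_{\pi\in S_n}\prod_i\langle\tau_i,\sigma_{\pi(i)}\rangle$. Thus: - $\Delta^-:\mathfrak{T}\to S(\mathfrak{T}^-)\otimes\mathfrak{T}$ is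 dual to $\widehat\diamond$: for a monomial of trees $a$ and a tree $\sigma$, the coefficient of $a\otimes\sigma$ in $\Delta^-(\omega)$ is $\langle a,a\rangle^{-1}$ times the coefficient of $\omega$ in $a\,\widehat\diamond\,\sigma$. It is the renormalisation coaction, which contracts families of disjoint negative subtrees. - $\Delta^-_{\mathrm{non\text{-}root}}$ is the dual, in the same sense, of $\widehat\diamond^{\,\mathrm{nr}}$: it contracts only families of subtrees not containing the root. - $\Delta^+_0:\mathfrak{T}\to\mathfrak{T}\,\overline\otimes\,\mathfrak{T}$ (with left factor in $\mathfrak{T}^0$) is the dual of $\ast_+$, with no positivity projection in the left factor: the coefficient of $x\otimes y$ in $\Delta_0^+(\omega)$ is the coefficient of $\omega$ in $x\ast_+y$. Here $\overline\otimes$ is the completed tensor product, i.e. formal infinite linear combinations of pairs of trees are allowed. The identity is one between formal linear combinations of $a\otimes x\otimes y$ (each coefficient on either side is a finite sum). *)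

theory Defs
  imports
    "HOL-Analysis.Finite_Cartesian_Product"
    "HOL-Combinatorics.Permutations"
    "HOL-Library.FuncSet"
    "HOL-Library.List_Lexorder"
    "HOL-Library.Multiset"
    "HOL-Library.Poly_Mapping"
begin

section \<open>Multi-indices\<close>

text \<open>A multi-index in \<open>\<nat>\<^sup>d\<close> is an element of \<^typ>\<open>nat ^ 'd\<close> with \<open>'d\<close> a finite index type, so
  \<open>d = CARD('d) \<ge> 1\<close>; order, sum and (truncated) difference are componentwise.\<close>

definition mi_fact :: "nat ^ 'd \<Rightarrow> real" where
  "mi_fact n = (\<Prod>i\<in>UNIV. fact (n $ i))"

definition mi_size :: "nat ^ 'd \<Rightarrow> nat" where
  "mi_size n = (\<Sum>i\<in>UNIV. n $ i)"

definition mi_multinomial :: "nat ^ 'd \<Rightarrow> 'j set \<Rightarrow> ('j \<Rightarrow> nat ^ 'd) \<Rightarrow> real" where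
  "mi_multinomial n J l =
    (if (\<Sum>j\<in>J. l j) \<le> n
     then mi_fact n / ((\<Prod>j\<in>J. mi_fact (l j)) * mi_fact (n - (\<Sum>j\<in>J. l j)))
     else 0)"


section \<open>Formal linear combinations\<close>

text \<open>The vector space with basis \<open>'b\<close> is \<^typ>\<open>'b \<Rightarrow>\<^sub>0 real\<close>, and \<open>lin f\<close> is the linear extension of a
  map \<open>f\<close> given on the basis.\<close>

definition lin :: "('b \<Rightarrow> 'c \<Rightarrow>\<^sub>0 real) \<Rightarrow> ('b \<Rightarrow>\<^sub>0 real) \<Rightarrow> ('c \<Rightarrow>\<^sub>0 real)" where
  "lin f v = (\<Sum>b\<in>Poly_Mapping.keys v.
     Poly_Mapping.map ((*) (Poly_Mapping.lookup v b)) (f b))"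

text \<open>Possibly infinite formal linear combinations of elements of \<open>'b\<close> are all functions
  \<^typ>\<open>'b \<Rightarrow> real\<close>. A linear map into such a space is given by its values
  \<open>\<phi> b\<close> on the basis, and \<open>formal_lin \<phi>\<close> is its extension to formal combinations. It is meaningful
  when the coefficients of the result are finite sums (\<^const>\<open>Sum_any\<close> being zero otherwise);
  the lemmas at the end of this theory show that this holds in all cases used.\<close>

definition formal_lin :: "('b \<Rightarrow> 'c \<Rightarrow> real) \<Rightarrow> ('b \<Rightarrow> real) \<Rightarrow> 'c \<Rightarrow> real" where
  "formal_lin \<phi> u = (\<lambda>c. \<Sum>b. u b * \<phi> b c)"

definition basis :: "'b \<Rightarrow> 'b \<Rightarrow> real" where
  "basis b = (\<lambda>c. of_bool (b = c))"

definition tensor_map ::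
  "('b \<Rightarrow> 'c \<Rightarrow> real) \<Rightarrow> ('b' \<Rightarrow> 'c' \<Rightarrow> real) \<Rightarrow> 'b \<times> 'b' \<Rightarrow> 'c \<times> 'c' \<Rightarrow> real"
  (infixr \<open>\<otimes>\<^sub>m\<close> 70) where
  "(\<phi> \<otimes>\<^sub>m \<psi>) = (\<lambda>(b, b') (c, c'). \<phi> b c * \<psi> b' c')"


section \<open>Trees\<close>

datatype ('k, 'x) edge_type = Kernel 'k | Noise 'x

datatype ('k, 'x, 'd) tree =
  Node (root_dec: "nat ^ ('d::finite)")
    (edges: "((('k, 'x) edge_type \<times> (nat ^ 'd)) \<times> ('k, 'x, 'd) tree) list")

type_synonym ('k, 'x, 'd) edge = "(('k, 'x) edge_type \<times> (nat ^ 'd)) \<times> ('k, 'x, 'd) tree"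

definition noise_edge :: "('k, 'x, 'd::finite) edge \<Rightarrow> bool" where
  "noise_edge e \<longleftrightarrow> (\<exists>X. fst (fst e) = Noise X)"

lemma size_edge: "e \<in> set es \<Longrightarrow> size (snd e) < size (Node n es)"
  by (induction es) auto

lemma size_nth_edge:
  "i < length es \<Longrightarrow> size (snd (es ! i)) < size (Node n es)"
  by (rule size_edge) simp

text \<open>The basis of \<open>\<TT>\<close> for kernels \<open>\<I>\<close> and noises \<open>\<Xi>\<close>.\<close>

fun admissible :: "'k set \<Rightarrow> 'x set \<Rightarrow> ('k, 'x, 'd::finite) tree \<Rightarrow> bool" where
  "admissible \<I> \<Xi> (Node n es) \<longleftrightarrow>
     length (filter noise_edge es) \<le> 1 \<and>
     (\<forall>e\<in>set es. admissible \<I> \<Xi> (snd e) \<and>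
        (case fst (fst e) of Kernel G \<Rightarrow> G \<in> \<I> | Noise X \<Rightarrow> X \<in> \<Xi> \<and> edges (snd e) = []))"

definition trees :: "'k set \<Rightarrow> 'x set \<Rightarrow> ('k, 'x, 'd::finite) tree set" where
  "trees \<I> \<Xi> = {\<tau>. admissible \<I> \<Xi> \<tau>}"

definition trees0 :: "'k set \<Rightarrow> 'x set \<Rightarrow> ('k, 'x, 'd::finite) tree set" where
  "trees0 \<I> \<Xi> = {\<tau> \<in> trees \<I> \<Xi>. \<forall>e\<in>set (edges \<tau>). \<not> noise_edge e}"

text \<open>\<open>rK G\<close> is the regularity of the kernel \<open>G\<close>, \<open>rX X\<close> that of the noise \<open>X\<close>.\<close>

fun regularity :: "('k \<Rightarrow> real) \<Rightarrow> ('x \<Rightarrow> real) \<Rightarrow> ('k, 'x, 'd::finite) tree \<Rightarrow> real" where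
  "regularity rK rX (Node n es) =
     real (mi_size n) +
     (\<Sum>e\<leftarrow>es. (case fst (fst e) of Kernel G \<Rightarrow> rK G | Noise X \<Rightarrow> rX X - 1)
               - real (mi_size (snd (fst e))) + regularity rK rX (snd e))"

definition trees_neg ::
  "'k set \<Rightarrow> 'x set \<Rightarrow> ('k \<Rightarrow> real) \<Rightarrow> ('x \<Rightarrow> real) \<Rightarrow> ('k, 'x, 'd::finite) tree set" where
  "trees_neg \<I> \<Xi> rK rX = {\<tau> \<in> trees \<I> \<Xi>. regularity rK rX \<tau> < 0}"


subsection \<open>Vertices\<close>

text \<open>A vertex is the list of child positions leading to it from the root \<open>[]\<close>.\<close>

type_synonym vertex = "nat list"

primrec is_vertex :: "('k, 'x, 'd::finite) tree \<Rightarrow> vertex \<Rightarrow> bool" where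
  "is_vertex \<tau> [] \<longleftrightarrow> True"
| "is_vertex \<tau> (i # p) \<longleftrightarrow> i < length (edges \<tau>) \<and> is_vertex (snd (edges \<tau> ! i)) p"

primrec subtree_at :: "('k, 'x, 'd::finite) tree \<Rightarrow> vertex \<Rightarrow> ('k, 'x, 'd) tree" where
  "subtree_at \<tau> [] = \<tau>"
| "subtree_at \<tau> (i # p) = subtree_at (snd (edges \<tau> ! i)) p"

primrec replace_at ::
  "('k, 'x, 'd::finite) tree \<Rightarrow> vertex \<Rightarrow> ('k, 'x, 'd) tree \<Rightarrow> ('k, 'x, 'd) tree" where
  "replace_at \<tau> [] \<rho> = \<rho>"
| "replace_at \<tau> (i # p) \<rho> =
     Node (root_dec \<tau>)
       ((edges \<tau>)[i := (fst (edges \<tau> ! i), replace_at (snd (edges \<tau> ! i)) p \<rho>)])"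

definition noise_vertex :: "('k, 'x, 'd::finite) tree \<Rightarrow> vertex \<Rightarrow> bool" where
  "noise_vertex \<tau> p \<longleftrightarrow>
     p \<noteq> [] \<and> noise_edge (edges (subtree_at \<tau> (butlast p)) ! last p)"

text \<open>\<open>verts \<tau>\<close> is \<open>N\<^sub>\<tau>\<close> (non-noise vertices). As these have no incoming noise edge, \<open>free_verts \<tau>\<close>
  is the set of vertices not adjacent to any noise edge.\<close>

definition verts :: "('k, 'x, 'd::finite) tree \<Rightarrow> vertex set" where
  "verts \<tau> = {p. is_vertex \<tau> p \<and> \<not> noise_vertex \<tau> p}"

definition free_verts :: "('k, 'x, 'd::finite) tree \<Rightarrow> vertex set" where
  "free_verts \<tau> = {p \<in> verts \<tau>. \<forall>e\<in>set (edges (subtree_at \<tau> p)). \<not> noise_edge e}"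

definition dec :: "('k, 'x, 'd::finite) tree \<Rightarrow> vertex \<Rightarrow> nat ^ 'd" where
  "dec \<tau> p = root_dec (subtree_at \<tau> p)"


section \<open>The action \<open>\<star>\<^sub>+\<close>\<close>

text \<open>\<open>amend g h \<tau>\<close> applies \<open>g p\<close> to the decoration of every vertex \<open>p\<close> of \<open>\<tau>\<close> and adds the list of
  edges \<open>h p\<close> to the left of its outgoing edges.\<close>

function amend ::
  "(vertex \<Rightarrow> nat ^ 'd \<Rightarrow> nat ^ 'd) \<Rightarrow> (vertex \<Rightarrow> ('k, 'x, 'd) edge list) \<Rightarrow>
   ('k, 'x, 'd::finite) tree \<Rightarrow> ('k, 'x, 'd) tree" where
  "amend g h (Node n es) =
     Node (g [] n)
       (h [] @ map (\<lambda>i. (fst (es ! i), amend (\<lambda>p. g (i # p)) (\<lambda>p. h (i # p)) (snd (es ! i))))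
                   [0..<length es])"
  by pat_completeness auto
termination
  by (relation "measure (\<lambda>(g, h, \<tau>). size \<tau>)") (auto simp del: tree.size intro: size_nth_edge)

text \<open>The term of \<open>x \<star>\<^sub>+ y\<close> belonging to \<open>f\<close>, \<open>l\<close> and \<open>\<delta>\<close>; the root edges of \<open>x\<close> are numbered
  \<open>0, \<dots>, k - 1\<close> from left to right. The differences do not truncate where the coefficient is
  nonzero.\<close>

definition graft_tree ::
  "('k, 'x, 'd::finite) tree \<Rightarrow> ('k, 'x, 'd) tree \<Rightarrow> (nat \<Rightarrow> vertex) \<Rightarrow> (nat \<Rightarrow> nat ^ 'd) \<Rightarrow>
   (vertex \<Rightarrow> nat ^ 'd) \<Rightarrow> ('k, 'x, 'd) tree" where
  "graft_tree x y f l \<delta> =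
     (let js = (\<lambda>u. filter (\<lambda>j. f j = u) [0..<length (edges x)]) in
      amend (\<lambda>u n. n - (\<Sum>j\<leftarrow>js u. l j) + \<delta> u)
            (\<lambda>u. map (\<lambda>j. case edges x ! j of ((G, a), \<sigma>) \<Rightarrow> ((G, a - l j), \<sigma>)) (js u)) y)"

definition graft_coeff ::
  "('k, 'x, 'd::finite) tree \<Rightarrow> ('k, 'x, 'd) tree \<Rightarrow> (nat \<Rightarrow> vertex) \<Rightarrow> (nat \<Rightarrow> nat ^ 'd) \<Rightarrow>
   (vertex \<Rightarrow> nat ^ 'd) \<Rightarrow> real" where
  "graft_coeff x y f l \<delta> =
     mi_multinomial (root_dec x) (verts y) \<delta> *
     (\<Prod>u\<in>verts y. mi_multinomial (dec y u) {j. j < length (edges x) \<and> f j = u} l)"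

text \<open>The terms with some \<open>l j\<close> not below the decoration \<open>a j\<close> of the \<open>j\<close>-th root edge of \<open>x\<close> vanish by
  convention, so \<open>l j\<close> runs over multi-indices below \<open>a j\<close>.\<close>

definition star_plus ::
  "('k, 'x, 'd::finite) tree \<Rightarrow> ('k, 'x, 'd) tree \<Rightarrow> (('k, 'x, 'd) tree \<Rightarrow>\<^sub>0 real)"
  (infixr \<open>\<star>\<^sub>+\<close> 70) where
  "x \<star>\<^sub>+ y =
     (\<Sum>f \<in> {..<length (edges x)} \<rightarrow>\<^sub>E verts y.
      \<Sum>l \<in> (\<Pi>\<^sub>E j\<in>{..<length (edges x)}. {l. l \<le> snd (fst (edges x ! j))}).
      \<Sum>\<delta> \<in> {\<delta>. (\<forall>u. u \<notin> verts y \<longrightarrow> \<delta> u = 0) \<and> (\<Sum>u\<in>verts y. \<delta> u) = root_dec x}.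
        Poly_Mapping.single (graft_tree x y f l \<delta>) (graft_coeff x y f l \<delta>))"


section \<open>Deformed insertion\<close>

definition insert_at ::
  "('k, 'x, 'd::finite) tree \<Rightarrow> vertex \<Rightarrow> ('k, 'x, 'd) tree \<Rightarrow> (('k, 'x, 'd) tree \<Rightarrow>\<^sub>0 real)" where
  "insert_at \<tau> v \<sigma> =
     lin (\<lambda>\<rho>. Poly_Mapping.single (replace_at \<sigma> v \<rho>) 1) (subtree_at \<sigma> v \<star>\<^sub>+ \<tau>)"

text \<open>Simultaneous insertion of the \<open>i\<close>-th tree of \<open>ts\<close> into the vertex \<open>v i\<close> of \<open>\<sigma>\<close>, for \<open>v\<close> injective.
  An insertion at a vertex only changes the subtree at that vertex, so the insertions can be
  performed one after the other provided that descendants precede ancestors. In the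
  lexicographic order on vertices an ancestor is smaller than its descendants, and
  \<^const>\<open>foldr\<close> treats the largest vertex first.\<close>

definition insert_all ::
  "('k, 'x, 'd::finite) tree list \<Rightarrow> (nat \<Rightarrow> vertex) \<Rightarrow> ('k, 'x, 'd) tree \<Rightarrow>
   (('k, 'x, 'd) tree \<Rightarrow>\<^sub>0 real)" where
  "insert_all ts v \<sigma> =
     foldr (\<lambda>i. lin (insert_at (ts ! i) (v i))) (sort_key v [0..<length ts])
       (Poly_Mapping.single \<sigma> 1)"

definition insertions ::
  "vertex set \<Rightarrow> ('k, 'x, 'd::finite) tree list \<Rightarrow> ('k, 'x, 'd) tree \<Rightarrow>
   (('k, 'x, 'd) tree \<Rightarrow>\<^sub>0 real)" where
  "insertions V ts \<sigma> =
     (\<Sum>v \<in> {v \<in> {..<length ts} \<rightarrow>\<^sub>E V. inj_on v {..<length ts}}. insert_all ts v \<sigma>)"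

text \<open>The monomial \<open>\<tau>\<^sub>1 \<cdots> \<tau>\<^sub>n\<close> of the symmetric algebra is the multiset of its factors, so the product of
  monomials is the sum of multisets. \<open>factors a\<close> is some enumeration of the factors, on which
  the sum over all injective maps does not depend.\<close>

definition factors :: "'a multiset \<Rightarrow> 'a list" where
  "factors a = (SOME ts. mset ts = a)"

definition ins_act ::
  "('k, 'x, 'd::finite) tree multiset \<Rightarrow> ('k, 'x, 'd) tree \<Rightarrow> (('k, 'x, 'd) tree \<Rightarrow>\<^sub>0 real)" where
  "ins_act a \<sigma> = insertions (free_verts \<sigma>) (factors a) \<sigma>"

definition ins_act_nr ::
  "('k, 'x, 'd::finite) tree multiset \<Rightarrow> ('k, 'x, 'd) tree \<Rightarrow> (('k, 'x, 'd) tree \<Rightarrow>\<^sub>0 real)" where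
  "ins_act_nr a \<sigma> = insertions (free_verts \<sigma> - {[]}) (factors a) \<sigma>"


section \<open>Coactions\<close>

definition pairing :: "'a list \<Rightarrow> 'a list \<Rightarrow> real" where
  "pairing ts ss =
     (if length ts = length ss
      then \<Sum>\<pi> | \<pi> permutes {..<length ts}. \<Prod>i<length ts. of_bool (ts ! i = ss ! \<pi> i)
      else 0)"

definition monomials_neg ::
  "'k set \<Rightarrow> 'x set \<Rightarrow> ('k \<Rightarrow> real) \<Rightarrow> ('x \<Rightarrow> real) \<Rightarrow> ('k, 'x, 'd::finite) tree multiset set" where
  "monomials_neg \<I> \<Xi> rK rX = {a. set_mset a \<subseteq> trees_neg \<I> \<Xi> rK rX}"

definition delta_minus ::
  "'k set \<Rightarrow> 'x set \<Rightarrow> ('k \<Rightarrow> real) \<Rightarrow> ('x \<Rightarrow> real) \<Rightarrow>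
   ('k, 'x, 'd::finite) tree \<Rightarrow> ('k, 'x, 'd) tree multiset \<times> ('k, 'x, 'd) tree \<Rightarrow> real" where
  "delta_minus \<I> \<Xi> rK rX \<omega> = (\<lambda>(a, \<sigma>).
     if a \<in> monomials_neg \<I> \<Xi> rK rX \<and> \<sigma> \<in> trees \<I> \<Xi>
     then Poly_Mapping.lookup (ins_act a \<sigma>) \<omega> / pairing (factors a) (factors a) else 0)"

definition delta_minus_nr ::
  "'k set \<Rightarrow> 'x set \<Rightarrow> ('k \<Rightarrow> real) \<Rightarrow> ('x \<Rightarrow> real) \<Rightarrow>
   ('k, 'x, 'd::finite) tree \<Rightarrow> ('k, 'x, 'd) tree multiset \<times> ('k, 'x, 'd) tree \<Rightarrow> real" where
  "delta_minus_nr \<I> \<Xi> rK rX \<omega> = (\<lambda>(a, \<sigma>).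
     if a \<in> monomials_neg \<I> \<Xi> rK rX \<and> \<sigma> \<in> trees0 \<I> \<Xi>
     then Poly_Mapping.lookup (ins_act_nr a \<sigma>) \<omega> / pairing (factors a) (factors a) else 0)"

definition delta_plus ::
  "'k set \<Rightarrow> 'x set \<Rightarrow>
   ('k, 'x, 'd::finite) tree \<Rightarrow> ('k, 'x, 'd) tree \<times> ('k, 'x, 'd) tree \<Rightarrow> real" where
  "delta_plus \<I> \<Xi> \<omega> = (\<lambda>(x, y).
     if x \<in> trees0 \<I> \<Xi> \<and> y \<in> trees \<I> \<Xi> then Poly_Mapping.lookup (x \<star>\<^sub>+ y) \<omega> else 0)"

definition m13 ::
  "('a multiset \<times> 'b) \<times> ('a multiset \<times> 'c) \<Rightarrow> 'a multiset \<times> 'b \<times> 'c \<Rightarrow> real" where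
  "m13 = (\<lambda>((a, b), (c, e)). basis (a + c, b, e))"


section \<open>All sums are finite\<close>

lemma finite_is_vertex: "finite {p. is_vertex \<tau> p}"
proof (induction \<tau> rule: measure_induct_rule[of size])
  case (less \<tau>)
  obtain n es where \<tau>: "\<tau> = Node n es" by (cases \<tau>)
  have "{p. is_vertex \<tau> p} \<subseteq>
      insert [] (\<Union>i\<in>{..<length es}. (#) i ` {p. is_vertex (snd (es ! i)) p})"
  proof
    fix p assume "p \<in> {p. is_vertex \<tau> p}"
    then show "p \<in> insert [] (\<Union>i\<in>{..<length es}. (#) i ` {p. is_vertex (snd (es ! i)) p})"
      by (cases p) (auto simp: \<tau>)
  qed
  moreover have "finite {p. is_vertex (snd (es ! i)) p}" if "i < length es" for i
    using less[of "snd (es ! i)"] size_nth_edge[OF that] by (simp add: \<tau>)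
  ultimately show ?case
    by (meson finite_UN_I finite_imageI finite_insert finite_lessThan finite_subset lessThan_iff)
qed

lemma finite_verts: "finite (verts \<tau>)"
  unfolding verts_def by (rule finite_subset[OF _ finite_is_vertex[of \<tau>]]) auto

lemma finite_mi_le: "finite {l :: nat ^ 'd. l \<le> a}"
proof -
  have "vec_nth ` {l. l \<le> a} \<subseteq> (\<Pi>\<^sub>E i\<in>UNIV. {..a $ i})"
    by (auto simp: less_eq_vec_def)
  then have "finite (vec_nth ` {l. l \<le> a})"
    by (rule finite_subset) (simp add: finite_PiE)
  then show ?thesis
    by (rule finite_imageD) (simp add: inj_on_def vec_nth_inject)
qed

lemma finite_star_plus_sets:
  "finite ({..<length (edges x)} \<rightarrow>\<^sub>E verts y)"
  "finite (\<Pi>\<^sub>E j\<in>{..<length (edges x)}. {l. l \<le> snd (fst (edges x ! j))})"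
  "finite {\<delta>. (\<forall>u. u \<notin> verts y \<longrightarrow> \<delta> u = 0) \<and> (\<Sum>u\<in>verts y. \<delta> u) = (m :: nat ^ 'd)}"
proof -
  show "finite ({..<length (edges x)} \<rightarrow>\<^sub>E verts y)"
    by (simp add: finite_PiE finite_verts)
  show "finite (\<Pi>\<^sub>E j\<in>{..<length (edges x)}. {l. l \<le> snd (fst (edges x ! j))})"
    by (simp add: finite_PiE finite_mi_le)
  have le: "\<delta> u \<le> m" if "(\<Sum>u\<in>verts y. \<delta> u) = m" "u \<in> verts y"
    for \<delta> :: "vertex \<Rightarrow> nat ^ 'd" and u
  proof -
    have "m = \<delta> u + (\<Sum>w\<in>verts y - {u}. \<delta> w)"
      using that sum.remove[OF finite_verts, of u y \<delta>] by simp
    then show ?thesis by (simp add: less_eq_vec_def)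
  qed
  have "{\<delta>. (\<forall>u. u \<notin> verts y \<longrightarrow> \<delta> u = 0) \<and> (\<Sum>u\<in>verts y. \<delta> u) = m} \<subseteq>
      {\<delta>. \<forall>u. (u \<in> verts y \<longrightarrow> \<delta> u \<in> {l. l \<le> m}) \<and> (u \<notin> verts y \<longrightarrow> \<delta> u = 0)}"
    using le by auto
  then show "finite {\<delta>. (\<forall>u. u \<notin> verts y \<longrightarrow> \<delta> u = 0) \<and> (\<Sum>u\<in>verts y. \<delta> u) = m}"
    by (rule finite_subset) (rule finite_set_of_finite_funs[OF finite_verts finite_mi_le])
qed

lemma finite_insertions_set:
  assumes "V \<subseteq> verts \<sigma>"
  shows "finite {v \<in> {..<length ts} \<rightarrow>\<^sub>E V. inj_on v {..<length ts}}"
proof -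
  have "finite V"
    using assms finite_verts finite_subset by blast
  then show ?thesis
    by (simp add: finite_PiE)
qed

lemma factors_mset: "mset (factors a) = a"
  unfolding factors_def by (rule someI_ex) (rule ex_mset)

text \<open>For each of the four maps extended by \<^const>\<open>formal_lin\<close> in the cointeraction identity, the
  coefficients of the image are finite sums. The first lemma covers the extension of \<open>\<Delta>\<^sup>-\<close> and
  \<open>\<Delta>\<^sub>0\<^sup>+\<close> to \<open>\<TT>\<close>.\<close>

lemma finite_lookup_terms: "finite {b. Poly_Mapping.lookup (w :: 'b \<Rightarrow>\<^sub>0 real) b * \<phi> b c \<noteq> 0}"
  by (rule finite_subset[of _ "Poly_Mapping.keys w"]) (auto simp: in_keys_iff)

lemma finite_Id_delta_plus_terms:
  "finite {b. u b * (basis \<otimes>\<^sub>m delta_plus \<I> \<Xi>) b c \<noteq> 0}"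
proof -
  obtain a x y where c: "c = (a, x, y)" by (cases c) auto
  show ?thesis
    by (rule finite_subset[of _ "{a} \<times> Poly_Mapping.keys (x \<star>\<^sub>+ y)"])
      (auto simp: c tensor_map_def basis_def delta_plus_def in_keys_iff split: if_splits)
qed

lemma finite_delta_minus_nr_delta_minus_terms:
  "finite {b. u b * (delta_minus_nr \<I> \<Xi> rK rX \<otimes>\<^sub>m delta_minus \<I> \<Xi> rK rX) b c \<noteq> 0}"
proof -
  obtain a x a' y where c: "c = ((a, x), (a', y))" by (cases c) auto
  show ?thesis
    by (rule finite_subset[of _ "Poly_Mapping.keys (ins_act_nr a x) \<times> Poly_Mapping.keys (ins_act a' y)"])
      (auto simp: c tensor_map_def delta_minus_def delta_minus_nr_def in_keys_iff split: if_splits)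
qed

lemma finite_m13_terms: "finite {b. u b * m13 b c \<noteq> 0}"
proof -
  obtain a x y where c: "c = (a, x, y)" by (cases c) auto
  have "finite {a'. a' \<subseteq># a}"
  proof (rule finite_subset)
    show "{a'. a' \<subseteq># a} \<subseteq> mset ` {ts. set ts \<subseteq> set_mset a \<and> length ts \<le> size a}"
    proof
      fix a' assume "a' \<in> {a'. a' \<subseteq># a}"
      then have "set (factors a') \<subseteq> set_mset a" "length (factors a') \<le> size a"
        using set_mset_mono[of a' a] size_mset_mono[of a' a]
        by (simp_all flip: set_mset_mset size_mset add: factors_mset)
      then show "a' \<in> mset ` {ts. set ts \<subseteq> set_mset a \<and> length ts \<le> size a}"
        by (metis (mono_tags, lifting) factors_mset image_eqI mem_Collect_eq)
    qed
    show "finite (mset ` {ts. set ts \<subseteq> set_mset a \<and> length ts \<le> size a})"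
      by (simp add: finite_lists_length_le)
  qed
  then have "finite (({a'. a' \<subseteq># a} \<times> {x}) \<times> ({a'. a' \<subseteq># a} \<times> {y}))"
    by simp
  then show ?thesis
    by (rule rev_finite_subset) (auto simp: c m13_def basis_def split: if_splits)
qed

end

theory Submission
  imports Defs
begin

text \<open>
  Dually to the claim, an insertion into a term of \<open>x \<star>\<^sub>+ y\<close> hits either a non-root vertex of \<open>x\<close> or
  a vertex of \<open>y\<close>, and one has to see that both kinds of insertion can be carried out before the
  product. The action is recursive in \<open>y\<close>: the root of \<open>x\<close> (its decoration and its edges) is split by a
  cocommutative coproduct between the root of \<open>y\<close> and its subtrees. By Vandermonde's identity
  \<open>\<star>\<^sub>+\<close> is multiplicative for this coproduct, whence \<open>(x \<star>\<^sub>+ y) \<star>\<^sub>+ z = x \<star>\<^sub>+ (y \<star>\<^sub>+ z)\<close>. Insertions obey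
  the same recursion, an insertion at the root of \<open>y\<close> being the action of \<open>y\<close> on the inserted tree, so
  that the identity follows by induction on \<open>y\<close>, with associativity at the root. Finally, a splitting
  \<open>a = b + c\<close> of a monomial arises from \<open>\<langle>a, a\<rangle> / (\<langle>b, b\<rangle> \<langle>c, c\<rangle>)\<close> splittings of the list of its factors.
\<close>

section \<open>Testing formal sums\<close>

text \<open>The root of \<open>x\<close> is no target for insertions because it does not survive in
  \<open>x \<star>\<^sub>+ y\<close>: its decoration and edges are scattered over \<open>y\<close>,
  and only the subtrees above them persist. That \<open>x\<close> lies in T^0 keeps the other
  targets right: the product grafts kernel edges only, so a vertex of \<open>y\<close> is adjacent
  to a noise edge afterwards exactly if it was before. An insertion at \<open>v\<close> regrafts all
  branches above \<open>v\<close>, including what has already been inserted there. Simultaneous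
  insertions are therefore ordered, and the root comes last, so it can be separated from the
  recursion. Binomials act twice on the same edge: attached first to the root of \<open>y\<close>
  and then, with that root, to a vertex of \<open>z\<close>, it is lowered by \<open>l\<close> and
  then by \<open>m\<close>; attached directly to the merged vertex it is lowered once, by
  \<open>l + m\<close>. This is where Vandermonde's identity is used. Finally, the coactions set
  coefficients outside the basis to zero, so the trees occurring in between must be shown to be
  admissible. For fixed \<open>(a, x, y)\<close> all sums are finite, and no question of convergence
  arises.\<close>

text \<open>Formal sums are compared by testing them against functions on the basis: linear extension
  then becomes nesting, and nested sums commute.\<close>

definition ev :: "('b \<Rightarrow>\<^sub>0 real) \<Rightarrow> ('b \<Rightarrow> real) \<Rightarrow> real" where
  "ev v \<phi> = (\<Sum>b\<in>Poly_Mapping.keys v. Poly_Mapping.lookup v b * \<phi> b)"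

abbreviation ev2 :: "('b \<times> 'c \<Rightarrow>\<^sub>0 real) \<Rightarrow> ('b \<Rightarrow> 'c \<Rightarrow> real) \<Rightarrow> real" where
  "ev2 v F \<equiv> ev v (\<lambda>p. F (fst p) (snd p))"

lemma ev_superset:
  assumes "finite A" "Poly_Mapping.keys v \<subseteq> A"
  shows "ev v \<phi> = (\<Sum>b\<in>A. Poly_Mapping.lookup v b * \<phi> b)"
  unfolding ev_def using assms
  by (intro sum.mono_neutral_left) (auto simp: in_keys_iff)

lemma ev_zero [simp]: "ev 0 \<phi> = 0"
  by (simp add: ev_def)

lemma ev_single [simp]: "ev (Poly_Mapping.single b c) \<phi> = c * \<phi> b"
  by (subst ev_superset[of "{b}"]) auto

lemma ev_add [simp]: "ev (v + w) \<phi> = ev v \<phi> + ev w \<phi>"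
proof -
  let ?A = "Poly_Mapping.keys v \<union> Poly_Mapping.keys w"
  have "ev u \<phi> = (\<Sum>b\<in>?A. Poly_Mapping.lookup u b * \<phi> b)" if "Poly_Mapping.keys u \<subseteq> ?A" for u
    using that by (intro ev_superset) auto
  then show ?thesis
    using Poly_Mapping.keys_add[of v w]
    by (simp add: lookup_add distrib_right sum.distrib)
qed

lemma ev_sum [simp]: "ev (\<Sum>i\<in>A. v i) \<phi> = (\<Sum>i\<in>A. ev (v i) \<phi>)"
  by (induction A rule: infinite_finite_induct) auto

lemma ev_scale [simp]: "ev (Poly_Mapping.map ((*) c) v) \<phi> = c * ev v \<phi>"
proof -
  have *: "Poly_Mapping.lookup (Poly_Mapping.map ((*) c) v) b = c * Poly_Mapping.lookup v b" for b
    by (simp add: map.rep_eq when_def)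
  have "ev (Poly_Mapping.map ((*) c) v) \<phi> =
      (\<Sum>b\<in>Poly_Mapping.keys v. Poly_Mapping.lookup (Poly_Mapping.map ((*) c) v) b * \<phi> b)"
    by (intro ev_superset) (auto simp: in_keys_iff *)
  also have "\<dots> = c * ev v \<phi>"
    by (simp add: * ev_def sum_distrib_left mult.assoc)
  finally show ?thesis .
qed

lemma ev_lin [simp]: "ev (lin f v) \<phi> = ev v (\<lambda>b. ev (f b) \<phi>)"
  by (simp add: lin_def) (simp add: ev_def)

lemma ev_swap: "ev v (\<lambda>a. ev w (\<lambda>b. F a b)) = ev w (\<lambda>b. ev v (\<lambda>a. F a b))"
  unfolding ev_def by (simp add: sum_distrib_left mult.left_commute sum.swap[of _ "Poly_Mapping.keys
      w"])

lemma ev_fun_sum: "ev v (\<lambda>b. \<Sum>i\<in>A. \<phi> i b) = (\<Sum>i\<in>A. ev v (\<phi> i))"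
  unfolding ev_def by (simp add: sum_distrib_left sum.swap[of _ A])

lemma ev_fun_add: "ev v (\<lambda>b. \<phi> b + \<psi> b) = ev v \<phi> + ev v \<psi>"
  unfolding ev_def by (simp add: distrib_left sum.distrib)

lemma ev_fun_mult: "ev v (\<lambda>b. c * \<phi> b) = c * ev v \<phi>"
  unfolding ev_def by (simp add: sum_distrib_left mult.left_commute)

lemma ev_fun_zero [simp]: "ev v (\<lambda>b. 0) = 0"
  unfolding ev_def by simp

lemma ev_cong: "(\<And>b. b \<in> Poly_Mapping.keys v \<Longrightarrow> \<phi> b = \<psi> b) \<Longrightarrow> ev v \<phi> = ev v \<psi>"
  unfolding ev_def by simp

lemma ev_eq_0: "(\<And>b. b \<in> Poly_Mapping.keys v \<Longrightarrow> \<phi> b = 0) \<Longrightarrow> ev v \<phi> = 0"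
  unfolding ev_def by simp

lemma ev_indicator: "ev v (\<lambda>b. of_bool (b = c)) = Poly_Mapping.lookup v c"
  unfolding ev_def by (simp add: of_bool_def if_distrib sum.delta in_keys_iff cong: if_cong)

text \<open>Trees are orthonormal, so the pairing is symmetric. This turns a coaction applied to
  \<open>\<omega>\<close> into the dual action tested against the coefficients of
  \<open>\<omega>\<close>.\<close>

lemma ev_lookup_commute: "ev v (Poly_Mapping.lookup w) = ev w (Poly_Mapping.lookup v)"
proof -
  let ?A = "Poly_Mapping.keys v \<union> Poly_Mapping.keys w"
  have "ev u f = (\<Sum>b\<in>?A. Poly_Mapping.lookup u b * f b)" if "Poly_Mapping.keys u \<subseteq> ?A" for u f
    using that by (intro ev_superset) auto
  then show ?thesis by (simp add: mult.commute)
qed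

text \<open>An element of the support outside \<open>B\<close> would be detected by its indicator
  function. Supports can thus be bounded from recursion equations for \<open>ev\<close>
  alone.\<close>

lemma keys_subsetI:
  assumes "\<And>\<phi>. (\<And>b. b \<in> B \<Longrightarrow> \<phi> b = 0) \<Longrightarrow> ev v \<phi> = 0"
  shows "Poly_Mapping.keys v \<subseteq> B"
proof
  fix b assume b: "b \<in> Poly_Mapping.keys v"
  show "b \<in> B"
  proof (rule ccontr)
    assume "b \<notin> B"
    then have "ev v (\<lambda>c. of_bool (c = b)) = 0"
      by (intro assms) auto
    with b show False by (simp add: ev_indicator in_keys_iff)
  qed
qed

section \<open>Arithmetic of multi-indices\<close>

lemma mi_fact_pos: "mi_fact n > 0"
  unfolding mi_fact_def by (intro prod_pos) auto

lemma mi_fact_nonzero [simp]: "mi_fact n \<noteq> 0"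
  using mi_fact_pos[of n] by simp

lemma mi_fact_0 [simp]: "mi_fact 0 = 1"
  by (simp add: mi_fact_def)

lemma mi_le_add [simp]: "(p :: nat ^ 'd) \<le> p + q" "q \<le> p + q"
  by (simp_all add: less_eq_vec_def)

lemma mi_add_diff [simp]: "(p :: nat ^ 'd) + q - p = q" "p + q - q = p"
  by (simp_all add: vec_eq_iff)

lemma mi_le_diff: "(p :: nat ^ 'd) \<le> n \<Longrightarrow> p + (n - p) = n" "p \<le> n \<Longrightarrow> n - p + p = n"
  by (simp_all add: vec_eq_iff less_eq_vec_def)

lemma mi_diff_le [simp]: "(n :: nat ^ 'd) - p \<le> n"
  by (simp add: less_eq_vec_def)

lemma mi_diff_diff: "(n :: nat ^ 'd) - p - q = n - (p + q)"
  by (simp add: vec_eq_iff)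

lemma mi_diff_diff_cancel: "(p :: nat ^ 'd) \<le> n \<Longrightarrow> n - (n - p) = p"
  by (simp add: vec_eq_iff less_eq_vec_def)

section \<open>Coproducts\<close>

text \<open>The coproduct of the monomial \<open>X^n\<close> for which each variable is primitive.
  It splits a root decoration among several vertices, and also a vertex decoration into the part
  that lowers an edge and the rest.\<close>

definition mi_coprod :: "nat ^ 'd \<Rightarrow> (nat ^ 'd) \<times> (nat ^ 'd) \<Rightarrow>\<^sub>0 real" where
  "mi_coprod n = (\<Sum>p\<in>{p. p \<le> n}. Poly_Mapping.single (p, n - p) (mi_fact n / (mi_fact p * mi_fact
      (n - p))))"

lemma ev_mi_coprod:
  "ev (mi_coprod n) F = (\<Sum>p\<in>{p. p \<le> n}. mi_fact n / (mi_fact p * mi_fact (n - p)) * F (p, n - p))"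
  by (simp add: mi_coprod_def)

lemma mi_coprod_commute: "ev2 (mi_coprod n) (\<lambda>p q. F q p) = ev2 (mi_coprod n) F"
  unfolding ev_mi_coprod
  by (rule sum.reindex_bij_witness[of _ "\<lambda>p. n - p" "\<lambda>p. n - p"])
    (auto simp: mi_diff_diff_cancel field_simps)

text \<open>Both iterated sums carry the trinomial coefficient of three parts of
  \<open>n\<close>.\<close>

lemma mi_coprod_assoc:
  "ev2 (mi_coprod n) (\<lambda>p q. ev2 (mi_coprod q) (\<lambda>r s. F p r s)) =
   ev2 (mi_coprod n) (\<lambda>p q. ev2 (mi_coprod p) (\<lambda>r s. F r s q))" (is "?L = ?R")
proof -
  have L: "?L = (\<Sum>(p, r)\<in>Sigma {p. p \<le> n} (\<lambda>p. {r. r \<le> n - p}).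
      mi_fact n / (mi_fact p * mi_fact r * mi_fact (n - p - r)) * F p r (n - p - r))"
    by (simp add: ev_mi_coprod sum_distrib_left sum.Sigma[symmetric] finite_mi_le mult.assoc)
  have R: "?R = (\<Sum>(p, r)\<in>Sigma {p. p \<le> n} (\<lambda>p. {r. r \<le> p}).
      mi_fact n / (mi_fact r * mi_fact (p - r) * mi_fact (n - p)) * F r (p - r) (n - p))"
    by (simp add: ev_mi_coprod sum_distrib_left sum.Sigma[symmetric] finite_mi_le ac_simps)
  show ?thesis
    unfolding L R
  \<comment> \<open>The pair is (first part, second part) on the left, and (first plus second part,
    first part) on the right.\<close>
  proof (rule sum.reindex_bij_witness[of _ "\<lambda>(p, r). (r, p - r)" "\<lambda>(p, r). (p + r, p)"])
    fix z assume "z \<in> Sigma {p. p \<le> n} (\<lambda>p. {r. r \<le> p})"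
    then obtain p r where z: "z = (p, r)" "p \<le> n" "r \<le> p" by auto
    then have "r \<le> n" "p - r \<le> n - r"
      by (auto simp: less_eq_vec_def intro: order_trans diff_le_mono)
    with z show "(case z of (p, r) \<Rightarrow> (r, p - r)) \<in> Sigma {p. p \<le> n} (\<lambda>p. {r. r \<le> n - p})"
      by simp
  qed (auto simp: mi_le_diff mi_diff_diff less_eq_vec_def Nat.le_diff_conv2 add.commute)
qed

lemma mi_coprod_unit: "ev2 (mi_coprod n) (\<lambda>p q. if p = 0 then F q else 0) = F n"
proof -
  have "ev2 (mi_coprod n) (\<lambda>p q. if p = 0 then F q else 0) =
      (\<Sum>p\<in>{0}. mi_fact n / (mi_fact p * mi_fact (n - p)) * (if p = 0 then F (n - p) else 0))"
    unfolding ev_mi_coprod fst_conv snd_conv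
    by (rule sum.mono_neutral_right[OF finite_mi_le]) (auto simp: less_eq_vec_def)
  then show ?thesis by simp
qed

lemma mi_sum_prod:
  "(\<Sum>l\<in>{l :: nat ^ 'd. l \<le> n}. \<Prod>i\<in>UNIV. g i (l $ i)) = (\<Prod>i\<in>UNIV. \<Sum>k\<le>n $ i. g i k :: real)"
proof -
  have "(\<Prod>i\<in>UNIV. \<Sum>k\<le>n $ i. g i k) = (\<Sum>f\<in>(\<Pi>\<^sub>E i\<in>UNIV. {..n $ i}). \<Prod>i\<in>UNIV. g i (f i))"
    by (rule prod_sum_PiE) auto
  also have "\<dots> = (\<Sum>l\<in>{l :: nat ^ 'd. l \<le> n}. \<Prod>i\<in>UNIV. g i (l $ i))"
    by (rule sum.reindex_bij_witness[of _ vec_nth vec_lambda]) (auto simp: less_eq_vec_def PiE_def)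
  finally show ?thesis by simp
qed

text \<open>In contrast to the quotient of factorials it vanishes for \<open>p\<close> not below
  \<open>n\<close>, so that Vandermonde's sum can run over all \<open>a \<le> p\<close>.\<close>

definition mi_choose :: "nat ^ 'd \<Rightarrow> nat ^ 'd \<Rightarrow> real" where
  "mi_choose n p = (\<Prod>i\<in>UNIV. real (n $ i choose p $ i))"

lemma mi_choose_fact: "p \<le> n \<Longrightarrow> mi_fact n / (mi_fact p * mi_fact (n - p)) = mi_choose n p"
  by (simp add: mi_fact_def mi_choose_def less_eq_vec_def binomial_fact flip: prod_dividef
    prod.distrib)

lemma mi_choose_eq_0: "\<not> p \<le> n \<Longrightarrow> mi_choose n p = 0"
  by (auto simp: mi_choose_def less_eq_vec_def not_le intro!: bexI)

lemma ev_mi_coprod_choose: "ev (mi_coprod n) F = (\<Sum>p\<in>{p. p \<le> n}. mi_choose n p * F (p, n - p))"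
  by (simp add: ev_mi_coprod mi_choose_fact)

lemma mi_vandermonde: "(\<Sum>a\<in>{a. a \<le> p}. mi_choose m a * mi_choose n (p - a)) = mi_choose (m + n) p"
proof -
  have "(\<Sum>a\<in>{a. a \<le> p}. mi_choose m a * mi_choose n (p - a)) =
      (\<Sum>a\<in>{a. a \<le> p}. \<Prod>i\<in>UNIV. real ((m $ i choose a $ i) * (n $ i choose (p $ i - a $ i))))"
    by (simp add: mi_choose_def flip: prod.distrib)
  also have "\<dots> = mi_choose (m + n) p"
    unfolding mi_choose_def by (subst mi_sum_prod) (simp add: flip: vandermonde)
  finally show ?thesis .
qed

text \<open>The binomial coproduct is compatible with the product \<open>X^m X^n = X^(m+n)\<close>;
  comparison of coefficients is Vandermonde's identity.\<close>

lemma mi_coprod_add: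
  "ev2 (mi_coprod (m + n)) F =
   ev2 (mi_coprod m) (\<lambda>a b. ev2 (mi_coprod n) (\<lambda>c d. F (a + c) (b + d)))" (is "?L = ?R")
proof -
  have "?L = (\<Sum>p\<in>{p. p \<le> m + n}. \<Sum>a\<in>{a. a \<le> p}.
      mi_choose m a * mi_choose n (p - a) * F p (m + n - p))"
    by (simp add: ev_mi_coprod_choose sum_distrib_right flip: mi_vandermonde)
  also have "\<dots> = (\<Sum>(p, a)\<in>Sigma {p. p \<le> m + n} (\<lambda>p. {a. a \<le> p}).
      mi_choose m a * mi_choose n (p - a) * F p (m + n - p))"
    by (simp add: sum.Sigma finite_mi_le)
  \<comment> \<open>Where \<open>a \<le> m\<close> or \<open>p - a \<le> n\<close> fails, one of the
    two binomials is zero.\<close>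
  also have "\<dots> = (\<Sum>(p, a)\<in>{(p, a). a \<le> p \<and> a \<le> m \<and> p - a \<le> n}.
      mi_choose m a * mi_choose n (p - a) * F p (m + n - p))"
  proof (rule sum.mono_neutral_right)
    show "finite (Sigma {p. p \<le> m + n} (\<lambda>p. {a. a \<le> p}))"
      by (intro finite_SigmaI finite_mi_le)
    show "{(p, a). a \<le> p \<and> a \<le> m \<and> p - a \<le> n} \<subseteq> Sigma {p. p \<le> m + n} (\<lambda>p. {a. a \<le> p})"
    proof clarsimp
      fix p a assume "a \<le> p" "a \<le> m" "p - a \<le> n"
      then have "a + (p - a) \<le> m + n"
        unfolding less_eq_vec_def vector_add_component by (blast intro: add_mono)
      then show "p \<le> m + n" using \<open>a \<le> p\<close> by (simp add: mi_le_diff)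
    qed
  qed (use mi_choose_eq_0 in fastforce)
  also have "\<dots> = (\<Sum>(a, c)\<in>{a. a \<le> m} \<times> {c. c \<le> n}.
      mi_choose m a * mi_choose n c * F (a + c) ((m - a) + (n - c)))"
  proof (rule sum.reindex_bij_witness[of _ "\<lambda>(a, c). (a + c, a)" "\<lambda>(p, a). (a, p - a)"])
    fix z assume "z \<in> {(p, a). a \<le> p \<and> a \<le> m \<and> p - a \<le> n}"
    then obtain p a where z: "z = (p, a)" "a \<le> p" "a \<le> m" "p - a \<le> n" by auto
    then have "m - a + (n - (p - a)) = m + n - p"
      by (auto simp: vec_eq_iff less_eq_vec_def) (smt (verit) Nat.add_diff_assoc add.commute
        diff_diff_left diff_diff_right le_add_diff_inverse le_add_diff_inverse2 le_diff_conv)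
    with z show "(case case z of (p, a) \<Rightarrow> (a, p - a) of
          (a, c) \<Rightarrow> mi_choose m a * mi_choose n c * F (a + c) (m - a + (n - c))) =
        (case z of (p, a) \<Rightarrow> mi_choose m a * mi_choose n (p - a) * F p (m + n - p))"
      by (simp add: mi_le_diff)
  qed (auto simp: mi_le_diff)
  also have "\<dots> = ?R"
    by (simp add: ev_mi_coprod_choose sum_distrib_left mult.assoc flip: sum.cartesian_product)
  finally show ?thesis .
qed

text \<open>The coproduct of words with primitive letters. It serves both for the outgoing edges of
  a root and for the list of trees to be inserted.\<close>

primrec unshuffle :: "'a list \<Rightarrow> ('a list \<times> 'a list) \<Rightarrow>\<^sub>0 real" where
  "unshuffle [] = Poly_Mapping.single ([], []) 1"
| "unshuffle (x # xs) =
     lin (\<lambda>p. Poly_Mapping.single (x # fst p, snd p) 1 + Poly_Mapping.single (fst p, x # snd p) 1)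
       (unshuffle xs)"

lemma unshuffle_commute: "ev2 (unshuffle xs) (\<lambda>a b. F b a) = ev2 (unshuffle xs) F"
proof (induction xs arbitrary: F)
  case (Cons x xs)
  show ?case
    using Cons[of "\<lambda>a b. F (x # a) b"] Cons[of "\<lambda>a b. F a (x # b)"] by (simp add: ev_fun_add)
qed simp

lemma unshuffle_assoc:
  "ev2 (unshuffle xs) (\<lambda>a b. ev2 (unshuffle b) (\<lambda>c d. F a c d)) = ev2 (unshuffle xs) (\<lambda>a b.
      ev2 (unshuffle a) (\<lambda>c d. F c d b))"
proof (induction xs arbitrary: F)
  case (Cons x xs)
  show ?case
    using Cons[of "\<lambda>a c d. F (x # a) c d"] Cons[of "\<lambda>a c d. F a (x # c) d"]
      Cons[of "\<lambda>a c d. F a c (x # d)"]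
    by (simp add: ev_fun_add)
qed simp

lemma unshuffle_append:
  "ev2 (unshuffle (xs @ ys)) F = ev2 (unshuffle xs) (\<lambda>a b. ev2 (unshuffle ys) (\<lambda>c d.
      F (a @ c) (b @ d)))"
proof (induction xs arbitrary: F)
  case (Cons x xs)
  show ?case
    using Cons[of "\<lambda>a b. F (x # a) b"] Cons[of "\<lambda>a b. F a (x # b)"] by (simp add: ev_fun_add)
qed simp

lemma unshuffle_unit: "ev2 (unshuffle xs) (\<lambda>a b. if a = [] then F b else 0) = F xs"
proof (induction xs arbitrary: F)
  case (Cons x xs)
  show ?case
    using Cons[of "\<lambda>b. F (x # b)"] by (simp cong: if_cong)
qed simp

text \<open>The tensor product of the two coproducts above, applied at the root. The subtrees travel
  unchanged with their edges.\<close>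

definition coprod :: "('k, 'x, 'd::finite) tree \<Rightarrow> (('k, 'x, 'd) tree \<times> ('k, 'x, 'd) tree) \<Rightarrow>\<^sub>0 real"
  where
  "coprod x = lin (\<lambda>p. lin (\<lambda>q. Poly_Mapping.single (Node (fst p) (fst q), Node (snd p) (snd q)) 1)
     (unshuffle (edges x))) (mi_coprod (root_dec x))"

lemma ev_coprod:
  "ev (coprod x) F = ev2 (mi_coprod (root_dec x)) (\<lambda>p q. ev2 (unshuffle (edges x)) (\<lambda>a b.
      F (Node p a, Node q b)))"
  by (simp add: coprod_def)

lemma coprod_commute: "ev2 (coprod x) (\<lambda>a b. F b a) = ev2 (coprod x) F"
proof -
  have "ev2 (coprod x) F = ev2 (mi_coprod (root_dec x)) (\<lambda>q p. ev2 (unshuffle (edges x)) (\<lambda>a b.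
      F (Node q a) (Node p b)))"
    by (simp add: ev_coprod)
  also have "\<dots> = ev2 (mi_coprod (root_dec x)) (\<lambda>p q. ev2 (unshuffle (edges x)) (\<lambda>a b.
      F (Node q a) (Node p b)))"
    by (rule mi_coprod_commute[symmetric])
  also have "\<dots> = ev2 (mi_coprod (root_dec x)) (\<lambda>p q. ev2 (unshuffle (edges x)) (\<lambda>b a.
      F (Node q a) (Node p b)))"
    by (intro ev_cong unshuffle_commute[symmetric])
  also have "\<dots> = ev2 (coprod x) (\<lambda>a b. F b a)"
    by (simp add: ev_coprod)
  finally show ?thesis by simp
qed

lemma coprod_assoc:
  "ev2 (coprod x) (\<lambda>a b. ev2 (coprod b) (\<lambda>c d. F a c d)) = ev2 (coprod x) (\<lambda>a b.
      ev2 (coprod a) (\<lambda>c d. F c d b))"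
proof -
  let ?n = "root_dec x" and ?es = "edges x"
  have "ev2 (coprod x) (\<lambda>a b. ev2 (coprod b) (\<lambda>c d. F a c d)) =
      ev2 (mi_coprod ?n) (\<lambda>p q. ev2 (mi_coprod q) (\<lambda>r s. ev2 (unshuffle ?es) (\<lambda>a b.
        ev2 (unshuffle b) (\<lambda>c d. F (Node p a) (Node r c) (Node s d)))))"
    unfolding ev_coprod tree.sel fst_conv snd_conv by (simp only: ev_swap[of "unshuffle ?es"])
  also have "\<dots> = ev2 (mi_coprod ?n) (\<lambda>p q. ev2 (mi_coprod p) (\<lambda>r s. ev2 (unshuffle ?es) (\<lambda>a b.
        ev2 (unshuffle b) (\<lambda>c d. F (Node r a) (Node s c) (Node q d)))))"
    by (rule mi_coprod_assoc)
  also have "\<dots> = ev2 (mi_coprod ?n) (\<lambda>p q. ev2 (mi_coprod p) (\<lambda>r s. ev2 (unshuffle ?es) (\<lambda>a b.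
        ev2 (unshuffle a) (\<lambda>c d. F (Node r c) (Node s d) (Node q b)))))"
    by (intro ev_cong unshuffle_assoc)
  also have "\<dots> = ev2 (coprod x) (\<lambda>a b. ev2 (coprod a) (\<lambda>c d. F c d b))"
    unfolding ev_coprod tree.sel fst_conv snd_conv by (simp only: ev_swap[of "unshuffle ?es"])
  finally show ?thesis .
qed

section \<open>Cocommutative coalgebras in tested form\<close>

locale cocomm_coalg =
  fixes D :: "'a \<Rightarrow> ('a \<times> 'a) \<Rightarrow>\<^sub>0 real"
  assumes assoc: "\<And>x F. ev2 (D x) (\<lambda>a b. ev2 (D b) (\<lambda>c d. F a c d)) = ev2 (D x) (\<lambda>a b.
      ev2 (D a) (\<lambda>c d. F c d b))"
    and commute: "\<And>x F. ev2 (D x) (\<lambda>a b. F b a) = ev2 (D x) F"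
begin

text \<open>Coassociativity brings the first two of three legs into one factor, where
  cocommutativity exchanges them.\<close>

lemma left_commute:
  "ev2 (D x) (\<lambda>a b. ev2 (D b) (\<lambda>c d. F a c d)) = ev2 (D x) (\<lambda>c b. ev2 (D b) (\<lambda>a d. F a c d))"
proof -
  have "ev2 (D x) (\<lambda>a b. ev2 (D b) (\<lambda>c d. F a c d)) = ev2 (D x) (\<lambda>b d. ev2 (D b) (\<lambda>a c. F a c d))"
    by (rule assoc)
  also have "\<dots> = ev2 (D x) (\<lambda>b d. ev2 (D b) (\<lambda>c a. F a c d))"
    by (intro ev_cong commute)
  also have "\<dots> = ev2 (D x) (\<lambda>c b. ev2 (D b) (\<lambda>a d. F a c d))"
    by (rule assoc[symmetric])
  finally show ?thesis .
qed

text \<open>Exchanges the middle two of four legs. Two operations that both split their argument are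
  made compatible in this way: parts sorted by operation become parts sorted by side.\<close>

lemma interchange:
  "ev2 (D x) (\<lambda>a b. ev2 (D a) (\<lambda>a1 a2. ev2 (D b) (\<lambda>b1 b2. F a1 a2 b1 b2))) =
   ev2 (D x) (\<lambda>a b. ev2 (D a) (\<lambda>a1 b1. ev2 (D b) (\<lambda>a2 b2. F a1 a2 b1 b2)))"
proof -
  have "ev2 (D x) (\<lambda>a b. ev2 (D a) (\<lambda>a1 a2. ev2 (D b) (\<lambda>b1 b2. F a1 a2 b1 b2))) =
      ev2 (D x) (\<lambda>a1 c. ev2 (D c) (\<lambda>a2 b. ev2 (D b) (\<lambda>b1 b2. F a1 a2 b1 b2)))"
    by (rule assoc[symmetric])
  also have "\<dots> = ev2 (D x) (\<lambda>a1 c. ev2 (D c) (\<lambda>b1 b. ev2 (D b) (\<lambda>a2 b2. F a1 a2 b1 b2)))"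
    by (intro ev_cong left_commute)
  also have "\<dots> = ev2 (D x) (\<lambda>a b. ev2 (D a) (\<lambda>a1 b1. ev2 (D b) (\<lambda>a2 b2. F a1 a2 b1 b2)))"
    by (rule assoc)
  finally show ?thesis .
qed

end

interpretation mi_coprod: cocomm_coalg mi_coprod
  by unfold_locales (rule mi_coprod_assoc mi_coprod_commute)+

interpretation unshuffle: cocomm_coalg unshuffle
  by unfold_locales (rule unshuffle_assoc unshuffle_commute)+

interpretation coprod: cocomm_coalg coprod
  by unfold_locales (rule coprod_assoc coprod_commute)+

section \<open>Attaching edges to a root\<close>

definition lower :: "('k, 'x, 'd::finite) edge \<Rightarrow> nat ^ 'd \<Rightarrow> ('k, 'x, 'd) edge" where
  "lower e l = ((fst (fst e), snd (fst e) - l), snd e)"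

lemma lower_simps [simp]:
  "fst (fst (lower e l)) = fst (fst e)" "snd (fst (lower e l)) = snd (fst e) - l" "snd (lower e l) =
      snd e"
  by (simp_all add: lower_def)

lemma lower_lower: "lower (lower e l) m = lower e (l + m)"
  by (simp add: lower_def mi_diff_diff)

text \<open>The edges are attached one at a time, the rightmost first: a multinomial coefficient is a
  product of binomial coefficients of the decorations left over by the previous edges.\<close>

primrec attach :: "('k, 'x, 'd::finite) edge list \<Rightarrow> nat ^ 'd \<Rightarrow> (nat ^ 'd) \<times>
    ('k, 'x, 'd) edge list \<Rightarrow>\<^sub>0 real" where
  "attach [] n = Poly_Mapping.single (n, []) 1"
| "attach (e # es) n = lin (\<lambda>p. lin (\<lambda>q.
     Poly_Mapping.single (snd q, lower e (fst q) # snd p) (of_bool (fst q \<le> snd (fst e))))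
     (mi_coprod (fst p))) (attach es n)"

lemma mi_le_diff_iff: "(l :: nat ^ 'd) \<le> a \<and> m \<le> a - l \<longleftrightarrow> l + m \<le> a"
  by (auto simp: less_eq_vec_def intro: add_leD1) (metis Nat.le_diff_conv2 add.commute add_leD1)+

text \<open>Vandermonde's identity: the two decorations merge into one.\<close>

lemma attach_attach:
  "ev2 (attach es b) (\<lambda>b' es'. ev2 (attach es' n) (\<lambda>n' zs. \<psi> (n' + b') zs)) =
      ev2 (attach es (n + b)) \<psi>"
proof (induction es arbitrary: \<psi>)
  case (Cons e es)
  let ?a = "snd (fst e)"
  have "ev2 (attach (e # es) b) (\<lambda>b' es'. ev2 (attach es' n) (\<lambda>n' zs. \<psi> (n' + b') zs)) =
      ev2 (attach es b) (\<lambda>b' es'. ev2 (mi_coprod b') (\<lambda>l r. ev2 (attach es' n) (\<lambda>n' zs.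
        ev2 (mi_coprod n') (\<lambda>m s. of_bool (l + m \<le> ?a) * \<psi> (s + r) (lower e (l + m) # zs)))))"
    by (simp add: lower_lower mi_le_diff_iff flip: mult.assoc ev_fun_mult of_bool_conj)
  also have "\<dots> = ev2 (attach es b) (\<lambda>b' es'. ev2 (attach es' n) (\<lambda>n' zs. ev2 (mi_coprod b') (\<lambda>l r.
      ev2 (mi_coprod n') (\<lambda>m s. of_bool (l + m \<le> ?a) * \<psi> (r + s) (lower e (l + m) # zs)))))"
    by (simp only: ev_swap[of "mi_coprod _" "attach _ n"] add.commute)
  \<comment> \<open>The two binomial coproducts stand side by side and only \<open>l + m\<close> and
    \<open>r + s\<close> enter, so they merge into one coproduct of \<open>b' + n'\<close>.\<close>
  also have "\<dots> = ev2 (attach es b) (\<lambda>b' es'. ev2 (attach es' n) (\<lambda>n' zs.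
      ev2 (mi_coprod (b' + n')) (\<lambda>l r. of_bool (l \<le> ?a) * \<psi> r (lower e l # zs))))"
    by (intro ev_cong mi_coprod_add[symmetric])
  also have "\<dots> = ev2 (attach es b) (\<lambda>b' es'. ev2 (attach es' n) (\<lambda>n' zs.
      ev2 (mi_coprod (n' + b')) (\<lambda>l r. of_bool (l \<le> ?a) * \<psi> r (lower e l # zs))))"
    by (simp only: add.commute)
  also have "\<dots> = ev2 (attach (e # es) (n + b)) \<psi>"
    by (subst Cons) simp
  finally show ?case .
qed (simp add: add.commute)

lemma attach_append:
  "ev2 (attach (es @ es') n) \<psi> = ev2 (attach es' n) (\<lambda>n' zs'. ev2 (attach es n') (\<lambda>n'' zs.
      \<psi> n'' (zs @ zs')))"
proof (induction es arbitrary: \<psi>)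
  case (Cons e es)
  show ?case
    using Cons[of "\<lambda>n' zs. ev2 (mi_coprod n') (\<lambda>l r.
        of_bool (l \<le> snd (fst e)) * \<psi> r (lower e l # zs))"]
    by simp
qed simp

text \<open>What an edge takes from the decoration can be taken from the part on its own side. For
  an edge that goes to the left this is coassociativity of \<open>mi_coprod\<close>, for one that
  goes to the right left commutation.\<close>

lemma attach_unshuffle:
  "ev2 (attach es n) (\<lambda>n' es'. ev2 (mi_coprod n') (\<lambda>p q. ev2 (unshuffle es') (\<lambda>a b. F p a q b))) =
   ev2 (mi_coprod n) (\<lambda>p q. ev2 (unshuffle es) (\<lambda>a b. ev2 (attach a p) (\<lambda>p' a'.
     ev2 (attach b q) (\<lambda>q' b'. F p' a' q' b'))))"
proof (induction es arbitrary: F)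
  case (Cons e es)
  let ?a = "snd (fst e)"
  let ?l = "\<lambda>l es. lower e l # es"
  have "ev2 (attach (e # es) n) (\<lambda>n' es'. ev2 (mi_coprod n') (\<lambda>p q. ev2 (unshuffle es') (\<lambda>a b.
      F p a q b))) =
      ev2 (attach es n) (\<lambda>n' es'. ev2 (mi_coprod n') (\<lambda>l r. ev2 (mi_coprod r) (\<lambda>p q.
        ev2 (unshuffle es') (\<lambda>a b. of_bool (l \<le> ?a) * F p (?l l a) q b)))) +
      ev2 (attach es n) (\<lambda>n' es'. ev2 (mi_coprod n') (\<lambda>l r. ev2 (mi_coprod r) (\<lambda>p q.
        ev2 (unshuffle es') (\<lambda>a b. of_bool (l \<le> ?a) * F p a q (?l l b)))))"
    by (simp add: ev_fun_add ev_fun_mult distrib_left)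
  also have "ev2 (attach es n) (\<lambda>n' es'. ev2 (mi_coprod n') (\<lambda>l r. ev2 (mi_coprod r) (\<lambda>p q.
      ev2 (unshuffle es') (\<lambda>a b. of_bool (l \<le> ?a) * F p (?l l a) q b)))) =
      ev2 (attach es n) (\<lambda>n' es'. ev2 (mi_coprod n') (\<lambda>p q. ev2 (mi_coprod p) (\<lambda>l r.
        ev2 (unshuffle es') (\<lambda>a b. of_bool (l \<le> ?a) * F r (?l l a) q b))))"
    by (intro ev_cong mi_coprod_assoc)
  also have "\<dots> = ev2 (attach es n) (\<lambda>n' es'. ev2 (mi_coprod n') (\<lambda>p q. ev2 (unshuffle es') (\<lambda>a b.
      ev2 (mi_coprod p) (\<lambda>l r. of_bool (l \<le> ?a) * F r (?l l a) q b))))"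
    by (simp only: ev_swap[of "mi_coprod _" "unshuffle _"])
  also have "\<dots> = ev2 (mi_coprod n) (\<lambda>p q. ev2 (unshuffle es) (\<lambda>a b. ev2 (attach a p) (\<lambda>p' a'.
      ev2 (attach b q) (\<lambda>q' b'. ev2 (mi_coprod p') (\<lambda>l r.
      of_bool (l \<le> ?a) * F r (?l l a') q' b')))))"
    by (rule Cons)
  also have "\<dots> = ev2 (mi_coprod n) (\<lambda>p q. ev2 (unshuffle es) (\<lambda>a b. ev2 (attach (e # a) p) (\<lambda>p' a'.
      ev2 (attach b q) (\<lambda>q' b'. F p' a' q' b'))))"
    by (simp add: ev_fun_mult ev_swap[of "mi_coprod _" "attach _ _"] flip: ev_fun_mult)
  also have "ev2 (attach es n) (\<lambda>n' es'. ev2 (mi_coprod n') (\<lambda>l r. ev2 (mi_coprod r) (\<lambda>p q.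
      ev2 (unshuffle es') (\<lambda>a b. of_bool (l \<le> ?a) * F p a q (?l l b))))) =
      ev2 (attach es n) (\<lambda>n' es'. ev2 (mi_coprod n') (\<lambda>p q. ev2 (mi_coprod q) (\<lambda>l r.
        ev2 (unshuffle es') (\<lambda>a b. of_bool (l \<le> ?a) * F p a r (?l l b)))))"
    by (intro ev_cong mi_coprod.left_commute)
  also have "\<dots> = ev2 (attach es n) (\<lambda>n' es'. ev2 (mi_coprod n') (\<lambda>p q. ev2 (unshuffle es') (\<lambda>a b.
      ev2 (mi_coprod q) (\<lambda>l r. of_bool (l \<le> ?a) * F p a r (?l l b)))))"
    by (simp only: ev_swap[of "mi_coprod _" "unshuffle _"])
  also have "\<dots> = ev2 (mi_coprod n) (\<lambda>p q. ev2 (unshuffle es) (\<lambda>a b. ev2 (attach a p) (\<lambda>p' a'.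
      ev2 (attach b q) (\<lambda>q' b'. ev2 (mi_coprod q') (\<lambda>l r.
      of_bool (l \<le> ?a) * F p' a' r (?l l b'))))))"
    by (rule Cons)
  also have "\<dots> = ev2 (mi_coprod n) (\<lambda>p q. ev2 (unshuffle es) (\<lambda>a b. ev2 (attach a p) (\<lambda>p' a'.
      ev2 (attach (e # b) q) (\<lambda>q' b'. F p' a' q' b'))))"
    by simp
  finally show ?case
    by (simp add: ev_fun_add)
qed simp

section \<open>Distributing decorations and edges over vertices\<close>

text \<open>In use, \<open>W\<close> separates two supports and may be larger than the first of
  them; outside the supports both arguments have their default value.\<close>

definition merge :: "'u set \<Rightarrow> ('u \<Rightarrow> 'b) \<Rightarrow> ('u \<Rightarrow> 'b) \<Rightarrow> 'u \<Rightarrow> 'b" where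
  "merge W f g = (\<lambda>u. if u \<in> W then f u else g u)"

text \<open>The default \<open>z\<close> off the range of \<open>g\<close> keeps a transported
  function in the canonical form of \<open>decos\<close> (value 0), \<open>distr_edges\<close>
  (value \<open>[]\<close>) and \<open>placements\<close> (value \<open>None\<close>).\<close>

definition push :: "'b \<Rightarrow> ('u \<Rightarrow> 'v) \<Rightarrow> ('u \<Rightarrow> 'b) \<Rightarrow> 'v \<Rightarrow> 'b" where
  "push z g f = (\<lambda>v. if v \<in> range g then f (inv g v) else z)"

lemma push_apply [simp]: "inj g \<Longrightarrow> push z g f (g u) = f u"
  by (simp add: push_def)

lemma push_upd: "inj g \<Longrightarrow> push z g (f(u := b)) = (push z g f)(g u := b)"
  by (auto simp: push_def fun_eq_iff)

lemma push_const: "push z g (\<lambda>_. z) = (\<lambda>_. z)"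
  by (auto simp: push_def)

lemma merge_upd1: "p \<in> W \<Longrightarrow> merge W (f(p := b)) g = (merge W f g)(p := b)"
  by (auto simp: merge_def)

lemma merge_upd2: "p \<notin> W \<Longrightarrow> merge W f (g(p := b)) = (merge W f g)(p := b)"
  by (auto simp: merge_def)

lemma merge_const: "merge W (\<lambda>_. z) (\<lambda>_. z) = (\<lambda>_. z)"
  by (auto simp: merge_def)

lemma merge_in [simp]: "u \<in> W \<Longrightarrow> merge W f g u = f u"
  and merge_out [simp]: "u \<notin> W \<Longrightarrow> merge W f g u = g u"
  by (simp_all add: merge_def)

definition decos :: "'u set \<Rightarrow> nat ^ 'd \<Rightarrow> ('u \<Rightarrow> nat ^ 'd) set" where
  "decos V m = {\<delta>. (\<forall>u. u \<notin> V \<longrightarrow> \<delta> u = 0) \<and> (\<Sum>u\<in>V. \<delta> u) = m}"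

definition distr_mi :: "'u set \<Rightarrow> nat ^ 'd \<Rightarrow> ('u \<Rightarrow> nat ^ 'd) \<Rightarrow>\<^sub>0 real" where
  "distr_mi V m = (\<Sum>\<delta>\<in>decos V m. Poly_Mapping.single \<delta> (mi_multinomial m V \<delta>))"

text \<open>Members of \<open>decos\<close> exhaust \<open>m\<close>, so the leftover factor of the
  multinomial is \<open>0! = 1\<close>.\<close>

lemma ev_distr_mi: "ev (distr_mi V m) \<Phi> = (\<Sum>\<delta>\<in>decos V m. mi_fact m / (\<Prod>u\<in>V. mi_fact (\<delta> u)) * \<Phi> \<delta>)"
  by (auto simp: distr_mi_def decos_def mi_multinomial_def intro!: sum.cong)

lemma mi_sum_nth: "(\<Sum>u\<in>V. \<delta> u) $ i = (\<Sum>u\<in>V. \<delta> u $ i)"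
  by (induction V rule: infinite_finite_induct) auto

lemma finite_decos: "finite V \<Longrightarrow> finite (decos V (m :: nat ^ 'd))"
proof (rule finite_subset)
  assume V: "finite V"
  show "decos V m \<subseteq> {\<delta>. \<forall>u. (u \<in> V \<longrightarrow> \<delta> u \<in> {l. l \<le> m}) \<and> (u \<notin> V \<longrightarrow> \<delta> u = 0)}"
    using V by (auto simp: decos_def less_eq_vec_def mi_sum_nth intro: member_le_sum)
  show "finite {\<delta>. \<forall>u. (u \<in> V \<longrightarrow> \<delta> u \<in> {l. l \<le> m}) \<and> (u \<notin> V \<longrightarrow> \<delta> u = 0)}"
    by (rule finite_set_of_finite_funs[OF V finite_mi_le])
qed

text \<open>A multinomial over a disjoint union is the binomial of the two partial sums times the
  multinomials of the parts.\<close>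

lemma ev_distr_mi_union:
  assumes "finite V1" "finite V2" "V1 \<subseteq> W" "V2 \<inter> W = {}"
  shows "ev (distr_mi (V1 \<union> V2) m) \<Phi> =
    ev2 (mi_coprod m) (\<lambda>p q. ev (distr_mi V1 p) (\<lambda>\<delta>1. ev (distr_mi V2 q) (\<lambda>\<delta>2. \<Phi> (merge W \<delta>1
      \<delta>2))))" (is "_ = ?R")
proof -
  have disj: "V1 \<inter> V2 = {}" using assms by auto
  let ?r = "\<lambda>V \<delta> u. if u \<in> V then \<delta> u else (0 :: nat ^ 'd)"
  have merge1: "(\<Sum>u\<in>V1. merge W a b u) = (\<Sum>u\<in>V1. a u)" "(\<Prod>u\<in>V1. mi_fact (merge W a b u)) =
      (\<Prod>u\<in>V1. mi_fact (a u))"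
    for a b :: "_ \<Rightarrow> nat ^ 'd"
    using assms by (auto intro!: sum.cong prod.cong)
  have merge2: "(\<Sum>u\<in>V2. merge W a b u) = (\<Sum>u\<in>V2. b u)" "(\<Prod>u\<in>V2. mi_fact (merge W a b u)) =
      (\<Prod>u\<in>V2. mi_fact (b u))"
    for a b :: "_ \<Rightarrow> nat ^ 'd"
    using assms(4) by (auto simp: merge_def disjoint_iff intro!: sum.cong prod.cong)
  have r: "(\<Sum>u\<in>V. ?r V \<delta> u) = (\<Sum>u\<in>V. \<delta> u)" for V \<delta>
    by (auto intro!: sum.cong)
  have "?R = (\<Sum>p\<in>{p. p \<le> m}. \<Sum>\<delta>1\<in>decos V1 p. \<Sum>\<delta>2\<in>decos V2 (m - p).
      mi_fact m / (\<Prod>u\<in>V1 \<union> V2. mi_fact (merge W \<delta>1 \<delta>2 u)) * \<Phi> (merge W \<delta>1 \<delta>2))"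
    by (simp add: ev_mi_coprod ev_distr_mi sum_distrib_left prod.union_disjoint assms disj merge1
      merge2 field_simps)
  also have "\<dots> = (\<Sum>(p, \<delta>1, \<delta>2)\<in>Sigma {p. p \<le> m} (\<lambda>p. decos V1 p \<times> decos V2 (m - p)).
      mi_fact m / (\<Prod>u\<in>V1 \<union> V2. mi_fact (merge W \<delta>1 \<delta>2 u)) * \<Phi> (merge W \<delta>1 \<delta>2))"
    by (simp add: sum.Sigma finite_mi_le finite_decos assms)
  also have "\<dots> = ev (distr_mi (V1 \<union> V2) m) \<Phi>"
    unfolding ev_distr_mi
  \<comment> \<open>\<open>p\<close> is recovered as the share of \<open>V1\<close>; each part is
    set to zero outside its own vertices.\<close>
  proof (rule sum.reindex_bij_witness[of _ "\<lambda>\<delta>. (\<Sum>u\<in>V1. \<delta> u, ?r V1 \<delta>, ?r V2 \<delta>)" "\<lambda>(p, \<delta>1, \<delta>2). merge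
      W \<delta>1 \<delta>2"])
    fix \<delta> assume \<delta>: "\<delta> \<in> decos (V1 \<union> V2) m"
    show "(\<lambda>(p, \<delta>1, \<delta>2). merge W \<delta>1 \<delta>2) (\<Sum>u\<in>V1. \<delta> u, ?r V1 \<delta>, ?r V2 \<delta>) = \<delta>"
      using \<delta> assms by (auto simp: merge_def decos_def fun_eq_iff)
    have "(\<Sum>u\<in>V1. \<delta> u) + (\<Sum>u\<in>V2. \<delta> u) = m"
      using \<delta> assms disj by (simp add: decos_def sum.union_disjoint)
    then show "(\<Sum>u\<in>V1. \<delta> u, ?r V1 \<delta>, ?r V2 \<delta>) \<in> Sigma {p. p \<le> m} (\<lambda>p. decos V1 p \<times> decos V2
        (m - p))"
      by (auto simp: decos_def r)
  next
    fix z assume "z \<in> Sigma {p. p \<le> m} (\<lambda>p. decos V1 p \<times> decos V2 (m - p))"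
    then obtain p \<delta>1 \<delta>2 where z: "z = (p, \<delta>1, \<delta>2)" "p \<le> m" "\<delta>1 \<in> decos V1 p" "\<delta>2 \<in> decos V2 (m - p)"
      by auto
    have "?r V1 (merge W \<delta>1 \<delta>2) = \<delta>1" "?r V2 (merge W \<delta>1 \<delta>2) = \<delta>2"
      using z assms by (auto simp: decos_def merge_def fun_eq_iff)
    moreover have "(\<Sum>u\<in>V1. \<delta>1 u) = p"
      using z by (simp add: decos_def)
    ultimately show "((\<lambda>\<delta>. (\<Sum>u\<in>V1. \<delta> u, ?r V1 \<delta>, ?r V2 \<delta>)) (case z of (p, \<delta>1, \<delta>2) \<Rightarrow> merge W \<delta>1 \<delta>2))
        = z"
      unfolding z(1) prod.case by (simp add: merge1)
    show "(case z of (p, \<delta>1, \<delta>2) \<Rightarrow> merge W \<delta>1 \<delta>2) \<in> decos (V1 \<union> V2) m"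
      using z assms disj by (auto simp: decos_def sum.union_disjoint merge1 merge2 mi_le_diff) (auto
        simp: merge_def)
  qed auto
  finally show ?thesis by simp
qed

lemma ev_distr_mi_image:
  fixes \<Phi> :: "('v \<Rightarrow> nat ^ 'd) \<Rightarrow> real"
  assumes "inj g"
  shows "ev (distr_mi (g ` V) m) \<Phi> = ev (distr_mi V m) (\<lambda>\<delta>. \<Phi> (push 0 g \<delta>))"
proof -
  have inj: "inj_on g V" using assms by (rule inj_on_subset) auto
  show ?thesis
    unfolding ev_distr_mi
  proof (rule sum.reindex_bij_witness[of _ "push 0 g" "\<lambda>\<delta>. \<delta> \<circ> g"])
    fix \<delta> assume "\<delta> \<in> decos (g ` V) m"
    then show eq: "push 0 g (\<delta> \<circ> g) = \<delta>"
      using assms by (auto simp: push_def fun_eq_iff decos_def)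
    show "\<delta> \<circ> g \<in> decos V m"
      using \<open>\<delta> \<in> _\<close> assms inj by (auto simp: decos_def sum.reindex inj_image_mem_iff)
    show "mi_fact m / (\<Prod>u\<in>V. mi_fact ((\<delta> \<circ> g) u)) * \<Phi> (push 0 g (\<delta> \<circ> g)) =
         mi_fact m / (\<Prod>u\<in>g ` V. mi_fact (\<delta> u)) * \<Phi> \<delta>"
      using inj by (simp add: eq prod.reindex)
  next
    fix \<delta> assume \<delta>: "\<delta> \<in> decos V m"
    show "push 0 g \<delta> \<circ> g = \<delta>"
      using assms by (simp add: fun_eq_iff)
    show "push 0 g \<delta> \<in> decos (g ` V) m"
      using \<delta> assms inj by (auto simp: decos_def sum.reindex) (auto simp: push_def)
  qed
qed

lemma ev_distr_mi_empty: "ev (distr_mi {} m) \<Phi> = (if m = 0 then \<Phi> (\<lambda>_. 0) else 0)"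
proof -
  have "decos {} m = (if m = 0 then {\<lambda>_ :: 'a. 0} else {})"
    by (auto simp: decos_def fun_eq_iff)
  then show ?thesis by (simp add: ev_distr_mi)
qed

lemma ev_distr_mi_singleton: "ev (distr_mi {u} m) \<Phi> = \<Phi> ((\<lambda>_. 0)(u := m))"
proof -
  have "decos {u} m = {(\<lambda>_ :: 'a. 0)(u := m)}"
    by (auto simp: decos_def fun_eq_iff)
  then show ?thesis by (simp add: ev_distr_mi)
qed

lemma ev_distr_mi_cong:
  "(\<And>\<delta>. (\<And>u. u \<notin> V \<Longrightarrow> \<delta> u = 0) \<Longrightarrow> \<Phi> \<delta> = \<Psi> \<delta>) \<Longrightarrow> ev (distr_mi V m) \<Phi> = ev (distr_mi V m) \<Psi>"
  unfolding ev_distr_mi by (intro sum.cong) (auto simp: decos_def)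

text \<open>Every edge comes with the amount by which its decoration is going to be lowered.\<close>

primrec distr_edges :: "'u set \<Rightarrow> ('k, 'x, 'd::finite) edge list \<Rightarrow>
    ('u \<Rightarrow> (('k, 'x, 'd) edge \<times> (nat ^ 'd)) list) \<Rightarrow>\<^sub>0 real" where
  "distr_edges V [] = Poly_Mapping.single (\<lambda>_. []) 1"
| "distr_edges V (e # es) =
     lin (\<lambda>h. \<Sum>p\<in>V. \<Sum>l\<in>{l. l \<le> snd (fst e)}. Poly_Mapping.single (h(p :=
       (e, l) # h p)) 1) (distr_edges V es)"

text \<open>Edges choose their vertices independently. Recording first only whether the choice falls
  into \<open>V1\<close> or \<open>V2\<close> unshuffles the list.\<close>

lemma ev_distr_edges_union:
  assumes "finite V1" "finite V2" "V1 \<subseteq> W" "V2 \<inter> W = {}"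
  shows "ev (distr_edges (V1 \<union> V2) es) \<Phi> =
    ev2 (unshuffle es) (\<lambda>a b. ev (distr_edges V1 a) (\<lambda>h1.
      ev (distr_edges V2 b) (\<lambda>h2. \<Phi> (merge W h1 h2))))"
proof (induction es arbitrary: \<Phi>)
  case (Cons e es)
  have disj: "V1 \<inter> V2 = {}" using assms by auto
  have out: "p \<in> V2 \<Longrightarrow> p \<notin> W" for p using assms by auto
  show ?case
    using assms(3) out
    by (simp add: sum.union_disjoint assms disj ev_fun_add Cons ev_fun_sum merge_upd1 merge_upd2
        subset_iff)
qed (simp add: merge_const)

lemma ev_distr_edges_image:
  assumes "inj g"
  shows "ev (distr_edges (g ` V) es) \<Phi> = ev (distr_edges V es) (\<lambda>h. \<Phi> (push [] g h))"
proof (induction es arbitrary: \<Phi>)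
  case (Cons e es)
  have inj: "inj_on g V" using assms by (rule inj_on_subset) auto
  show ?case
    by (simp add: Cons sum.reindex inj push_upd assms)
qed (simp add: push_const)

lemma ev_distr_edges_empty: "ev (distr_edges {} es) \<Phi> = (if es = [] then \<Phi> (\<lambda>_. []) else 0)"
  by (cases es) simp_all

lemma ev_distr_edges_cong:
  "(\<And>h. (\<And>u. u \<notin> V \<Longrightarrow> h u = []) \<Longrightarrow> \<Phi> h = \<Psi> h) \<Longrightarrow> ev (distr_edges V es) \<Phi> = ev (distr_edges V es) \<Psi>"
proof (induction es arbitrary: \<Phi> \<Psi>)
  case (Cons e es)
  show ?case
    unfolding distr_edges.simps ev_lin ev_sum ev_single
    by (intro Cons.IH sum.cong refl arg_cong[where f = "\<lambda>x. 1 * x"] Cons.prems) auto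
qed simp

definition distr_root :: "'u set \<Rightarrow> ('k, 'x, 'd::finite) tree \<Rightarrow>
    (('u \<Rightarrow> nat ^ 'd) \<times> ('u \<Rightarrow> (('k, 'x, 'd) edge \<times> (nat ^ 'd)) list)) \<Rightarrow>\<^sub>0 real" where
  "distr_root V x =
      lin (\<lambda>\<delta>. lin (\<lambda>h. Poly_Mapping.single (\<delta>, h) 1) (distr_edges V (edges x))) (distr_mi V
      (root_dec x))"

lemma ev_distr_root: "ev (distr_root V x) \<Phi> = ev (distr_mi V (root_dec x)) (\<lambda>\<delta>.
    ev (distr_edges V (edges x)) (\<lambda>h. \<Phi> (\<delta>, h)))"
  by (simp add: distr_root_def)

text \<open>The reason for \<open>coprod\<close>: a distribution over two disjoint sets of vertices
  is a splitting followed by separate distributions. All recursions below are instances.\<close>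

lemma ev_distr_root_union:
  assumes "finite V1" "finite V2" "V1 \<subseteq> W" "V2 \<inter> W = {}"
  shows "ev (distr_root (V1 \<union> V2) x) \<Phi> =
    ev2 (coprod x) (\<lambda>x1 x2. ev2 (distr_root V1 x1) (\<lambda>\<delta>1 h1. ev2 (distr_root V2 x2) (\<lambda>\<delta>2 h2.
      \<Phi> (merge W \<delta>1 \<delta>2, merge W h1 h2))))"
  unfolding ev_distr_root ev_coprod ev_distr_mi_union[OF assms] ev_distr_edges_union[OF assms]
    fst_conv snd_conv tree.sel
  by (simp only: ev_swap[of "distr_mi _ _" "unshuffle _"] ev_swap[of "distr_mi _ _" "distr_edges _
      _"])

lemma ev_distr_root_image:
  assumes "inj g"
  shows "ev (distr_root (g ` V) x) \<Phi> = ev2 (distr_root V x) (\<lambda>\<delta> h. \<Phi> (push 0 g \<delta>, push [] g h))"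
  unfolding ev_distr_root ev_distr_mi_image[OF assms] ev_distr_edges_image[OF assms] by simp

text \<open>Without vertices there is no place for a decoration or an edge; this is how the counit
  enters.\<close>

lemma ev_distr_root_empty: "ev (distr_root {} x) \<Phi> = (if x =
    Node 0 [] then \<Phi> (\<lambda>_. 0, \<lambda>_. []) else 0)"
  unfolding ev_distr_root ev_distr_mi_empty ev_distr_edges_empty by (cases x) auto

lemma ev_distr_root_cong:
  "(\<And>\<delta> h. (\<And>u. u \<notin> V \<Longrightarrow> \<delta> u = 0) \<Longrightarrow> (\<And>u. u \<notin> V \<Longrightarrow> h u = []) \<Longrightarrow> \<Phi> (\<delta>, h) = \<Psi> (\<delta>, h)) \<Longrightarrow>
   ev (distr_root V x) \<Phi> = ev (distr_root V x) \<Psi>"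
  unfolding ev_distr_root by (intro ev_distr_mi_cong ev_distr_edges_cong) blast

section \<open>Multinomials as iterated binomials\<close>

definition multinom :: "nat ^ 'd \<Rightarrow> (nat ^ 'd) list \<Rightarrow> real" where
  "multinom n ls =
      (if sum_list ls \<le> n then mi_fact n / (prod_list (map mi_fact ls) * mi_fact (n - sum_list ls))
      else 0)"

lemma multinom_Nil [simp]: "multinom n [] = 1"
  by (simp add: multinom_def less_eq_vec_def)

text \<open>The leftmost edge draws from what the others leave over, in accordance with the order of
  \<open>attach\<close>.\<close>

lemma multinom_Cons:
  "multinom n (l # ls) =
      (if l \<le> n - sum_list ls then multinom n ls * (mi_fact (n - sum_list ls) / (mi_fact l * mi_fact
      (n - sum_list ls - l))) else 0)"
proof (cases "sum_list ls \<le> n")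
  case True
  then have "l \<le> n - sum_list ls \<longleftrightarrow> l + sum_list ls \<le> n"
    using mi_le_diff_iff[of "sum_list ls" n l] by (simp add: add.commute)
  with True show ?thesis
    by (simp add: multinom_def mi_diff_diff add.commute)
next
  case False
  then have "\<not> l + sum_list ls \<le> n"
    using mi_le_add(2)[of "sum_list ls" l] by (meson order_trans)
  with False show ?thesis
    by (simp add: multinom_def)
qed

text \<open>Lowerings beyond the remaining decoration have weight zero, so the range
  \<open>l \<le> a\<close> can be traded for that of the binomial coproduct, with
  \<open>l \<le> a\<close> kept as an indicator.\<close>

lemma multinom_step:
  "(\<Sum>l\<in>{l. l \<le> a}. multinom n (l # ls) * \<phi> (n - (l + sum_list ls)) l) =
   multinom n ls * ev2 (mi_coprod (n - sum_list ls)) (\<lambda>l r. of_bool (l \<le> a) * \<phi> r l)"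
proof -
  let ?n = "n - sum_list ls"
  let ?c = "\<lambda>l. multinom n ls * (mi_fact ?n / (mi_fact l * mi_fact (?n - l)))"
  have "(\<Sum>l\<in>{l. l \<le> a}. multinom n (l # ls) * \<phi> (n - (l + sum_list ls)) l) =
      (\<Sum>l\<in>{l. l \<le> a \<and> l \<le> ?n}. ?c l * \<phi> (?n - l) l)"
    unfolding multinom_Cons by (intro sum.mono_neutral_cong_right) (auto simp: finite_mi_le
      mi_diff_diff add.commute)
  also have "\<dots> = (\<Sum>l\<in>{l. l \<le> ?n}. ?c l * (of_bool (l \<le> a) * \<phi> (?n - l) l))"
    by (intro sum.mono_neutral_cong_left) (auto simp: finite_mi_le)
  also have "\<dots> = multinom n ls * ev2 (mi_coprod ?n) (\<lambda>l r. of_bool (l \<le> a) * \<phi> r l)"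
    by (simp add: ev_mi_coprod sum_distrib_left mult.assoc)
  finally show ?thesis .
qed

text \<open>For a single receiving vertex, the closed multinomial formula of the definition meets
  the form in which edges are attached one at a time.\<close>

lemma ev_distr_edges_singleton:
  "ev (distr_edges {u} es) (\<lambda>h. multinom n (map snd (h u)) * \<psi> (n - sum_list (map snd
      (h u)), map (\<lambda>p. lower (fst p) (snd p)) (h u))) =
   ev (attach es n) \<psi>"
proof (induction es arbitrary: \<psi>)
  case (Cons e es)
  have "ev (attach (e # es) n) \<psi> = ev (distr_edges {u} es) (\<lambda>h. multinom n (map snd (h u)) *
     ev2 (mi_coprod (n - sum_list (map snd (h u)))) (\<lambda>l r. of_bool (l \<le> snd (fst e)) *
       \<psi> (r, lower e l # map (\<lambda>p. lower (fst p) (snd p)) (h u))))"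
    using Cons[of "\<lambda>p. ev2 (mi_coprod (fst p)) (\<lambda>l r.
        of_bool (l \<le> snd (fst e)) * \<psi> (r, lower e l # snd p))"]
    by simp
  also have "\<dots> = ev (distr_edges {u} es) (\<lambda>h.
      \<Sum>l\<in>{l. l \<le> snd (fst e)}. multinom n (l # map snd (h u)) * \<psi> (n - (l + sum_list (map snd
      (h u))), lower e l # map (\<lambda>p. lower (fst p) (snd p)) (h u)))"
    by (intro ev_cong multinom_step[symmetric])
  finally show ?case
    by simp
qed simp

section \<open>The recursive structure of the action\<close>

text \<open>Renumbers the vertices of a forest when a further edge is put to its left.\<close>

definition shift_vertex :: "vertex \<Rightarrow> vertex" where
  "shift_vertex p = (case p of [] \<Rightarrow> [] | i # q \<Rightarrow> Suc i # q)"

lemma shift_vertex_simps [simp]: "shift_vertex [] = []" "shift_vertex (i # p) = Suc i # p"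
  by (simp_all add: shift_vertex_def)

lemma inj_shift_vertex: "inj shift_vertex"
  by (rule injI) (auto simp: shift_vertex_def split: list.splits)

lemma inj_Cons: "inj ((#) i)"
  by (rule injI) simp

text \<open>Only the end point of a noise edge is a noise vertex. Its descendants, absent in admissible
  trees, count as ordinary vertices, so that no admissibility is needed in the recursion.\<close>

definition edge_verts :: "('k, 'x, 'd::finite) edge \<Rightarrow> vertex set" where
  "edge_verts c = verts (snd c) - (if noise_edge c then {[]} else {})"

primrec forest_verts :: "('k, 'x, 'd::finite) edge list \<Rightarrow> vertex set" where
  "forest_verts [] = {}"
| "forest_verts (c # cs) = (#) 0 ` edge_verts c \<union> shift_vertex ` forest_verts cs"

lemma Cons_in_forest_verts: "i # p \<in> forest_verts es \<longleftrightarrow> i < length es \<and> p \<in> edge_verts (es ! i)"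
proof (induction es arbitrary: i)
  case (Cons c cs)
  have "Suc j # p \<in> shift_vertex ` forest_verts cs \<longleftrightarrow> j # p \<in> forest_verts cs" for j
    using inj_image_mem_iff[OF inj_shift_vertex, of "j # p"] by simp
  moreover have "0 # p \<notin> shift_vertex ` forest_verts cs"
    by (auto simp: shift_vertex_def split: list.splits)
  ultimately show ?case
    using Cons by (cases i) auto
qed simp

lemma Nil_notin_forest_verts [simp]: "[] \<notin> forest_verts es"
  by (induction es) (auto simp: shift_vertex_def split: list.splits)

lemma noise_vertex_Cons:
  "noise_vertex (Node n es) (i # p) \<longleftrightarrow> (if p =
      [] then noise_edge (es ! i) else noise_vertex (snd (es ! i)) p)"
  by (simp add: noise_vertex_def)

lemma verts_Node: "verts (Node n es) = insert [] (forest_verts es)"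
proof (rule set_eqI)
  fix p
  show "p \<in> verts (Node n es) \<longleftrightarrow> p \<in> insert [] (forest_verts es)"
  proof (cases p)
    case Nil
    then show ?thesis by (simp add: verts_def noise_vertex_def)
  next
    case (Cons i q)
    have "[] \<in> verts (snd (es ! i))"
      by (simp add: verts_def noise_vertex_def)
    with Cons show ?thesis
      by (auto simp: verts_def Cons_in_forest_verts edge_verts_def noise_vertex_Cons
        noise_vertex_def)
  qed
qed

lemma edge_verts_noise: "noise_edge c \<Longrightarrow> edge_verts c = forest_verts (edges (snd c))"
  by (cases "snd c") (simp add: edge_verts_def verts_Node)

lemma edge_verts_kernel: "\<not> noise_edge c \<Longrightarrow> edge_verts c = verts (snd c)"
  by (simp add: edge_verts_def)

lemma finite_forest_verts: "finite (forest_verts es)"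
  using finite_verts[of "Node undefined es"] by (simp add: verts_Node)

lemma finite_edge_verts: "finite (edge_verts c)"
  by (simp add: edge_verts_def finite_verts)

definition amend_forest ::
  "(vertex \<Rightarrow> nat ^ 'd \<Rightarrow> nat ^ 'd) \<Rightarrow> (vertex \<Rightarrow> ('k, 'x, 'd) edge list) \<Rightarrow>
   ('k, 'x, 'd::finite) edge list \<Rightarrow> ('k, 'x, 'd) edge list" where
  "amend_forest g h es =
      map (\<lambda>i. (fst (es ! i), amend (\<lambda>p. g (i # p)) (\<lambda>p. h (i # p)) (snd (es ! i))))
      [0..<length es]"

lemma amend_Node: "amend g h (Node n es) = Node (g [] n) (h [] @ amend_forest g h es)"
  by (simp add: amend_forest_def)

lemma amend_forest_Nil [simp]: "amend_forest g h [] = []"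
  by (simp add: amend_forest_def)

lemma amend_forest_Cons:
  "amend_forest g h (c # cs) = (fst c, amend (\<lambda>p. g (0 # p)) (\<lambda>p. h (0 # p)) (snd c)) #
     amend_forest (\<lambda>p. g (shift_vertex p)) (\<lambda>p. h (shift_vertex p)) cs"
  by (simp add: amend_forest_def upt_conv_Cons comp_def flip: map_Suc_upt del: upt_Suc)

lemma amend_forest_cong:
  assumes "\<And>i p. g (i # p) = g' (i # p)" "\<And>i p. h (i # p) = h' (i # p)"
  shows "amend_forest g h es = amend_forest g' h' es"
  unfolding amend_forest_def using assms by simp

declare amend.simps [simp del]

type_synonym ('k, 'x, 'd) attachment = "vertex \<Rightarrow> (('k, 'x, 'd) edge \<times> (nat ^ 'd)) list"

text \<open>At a receiving vertex the difference truncates only where \<open>weight\<close>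
  vanishes.\<close>

definition grow :: "(vertex \<Rightarrow> nat ^ 'd) \<Rightarrow> ('k, 'x, 'd) attachment \<Rightarrow> vertex \<Rightarrow> nat ^ 'd \<Rightarrow> nat ^
    ('d::finite)" where
  "grow \<delta> h u n = n - sum_list (map snd (h u)) + \<delta> u"

definition lowered :: "('k, 'x, 'd) attachment \<Rightarrow> vertex \<Rightarrow> ('k, 'x, 'd::finite) edge list" where
  "lowered h u = map (\<lambda>p. lower (fst p) (snd p)) (h u)"

lemma grow_shift:
  "(\<lambda>p. grow \<delta> h (i # p)) = grow (\<lambda>p. \<delta> (i # p)) (\<lambda>p. h (i # p))"
  "(\<lambda>p. grow \<delta> h (shift_vertex p)) = grow (\<lambda>p. \<delta> (shift_vertex p)) (\<lambda>p. h (shift_vertex p))"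
  by (simp_all add: grow_def fun_eq_iff)

lemma lowered_shift:
  "(\<lambda>p. lowered h (i # p)) = lowered (\<lambda>p. h (i # p))"
  "(\<lambda>p. lowered h (shift_vertex p)) = lowered (\<lambda>p. h (shift_vertex p))"
  by (simp_all add: lowered_def fun_eq_iff)

definition weight :: "vertex set \<Rightarrow> (vertex \<Rightarrow> nat ^ 'd) \<Rightarrow> ('k, 'x, 'd::finite) attachment \<Rightarrow> real"
  where
  "weight V d h = (\<Prod>u\<in>V. multinom (d u) (map snd (h u)))"

text \<open>The action on what lies above a vertex that itself receives nothing. The decoration in
  \<open>Node 0 es\<close> is a dummy, since \<open>[]\<close> is no vertex of the forest.\<close>

definition star_forest :: "('k, 'x, 'd::finite) tree \<Rightarrow> ('k, 'x, 'd) edge list \<Rightarrow>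
    ('k, 'x, 'd) edge list \<Rightarrow>\<^sub>0 real" where
  "star_forest x es =
      lin (\<lambda>p. Poly_Mapping.single (amend_forest (grow (fst p) (snd p)) (lowered (snd p)) es)
      (weight (forest_verts es) (dec (Node 0 es)) (snd p))) (distr_root (forest_verts es) x)"

text \<open>The end point of a noise edge keeps its decoration and receives no edges, so the action
  passes directly to the forest above it.\<close>

definition star_edge :: "('k, 'x, 'd::finite) tree \<Rightarrow> ('k, 'x, 'd) edge \<Rightarrow> ('k, 'x, 'd) edge \<Rightarrow>\<^sub>0 real"
  where
  "star_edge x c =
      (if noise_edge c then lin (\<lambda>cs. Poly_Mapping.single (fst c, Node (root_dec (snd c)) cs) 1)
      (star_forest x (edges (snd c))) else lin (\<lambda>t. Poly_Mapping.single (fst c, t) 1)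
      (x \<star>\<^sub>+ snd c))"

lemma sum_PiE_Suc:
  "(\<Sum>f\<in>(\<Pi>\<^sub>E j\<in>{..<Suc k}. B j). G f) =
   (\<Sum>b\<in>B 0. \<Sum>f\<in>(\<Pi>\<^sub>E j\<in>{..<k}. B (Suc j)). G (case_nat b f))"
proof -
  have "(\<Sum>b\<in>B 0. \<Sum>f\<in>(\<Pi>\<^sub>E j\<in>{..<k}. B (Suc j)). G (case_nat b f)) =
      (\<Sum>(b, f)\<in>B 0 \<times> (\<Pi>\<^sub>E j\<in>{..<k}. B (Suc j)). G (case_nat b f))"
    by (simp add: sum.cartesian_product)
  also have "\<dots> = (\<Sum>f\<in>(\<Pi>\<^sub>E j\<in>{..<Suc k}. B j). G f)"
  proof (rule sum.reindex_bij_witness[of _ "\<lambda>f. (f 0, f \<circ> Suc)" "\<lambda>(b, f). case_nat b f"])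
    fix f assume f: "f \<in> (\<Pi>\<^sub>E j\<in>{..<Suc k}. B j)"
    show "(f 0, f \<circ> Suc) \<in> B 0 \<times> (\<Pi>\<^sub>E j\<in>{..<k}. B (Suc j))"
      using f by (auto simp: PiE_iff extensional_def)
    show "(case (f 0, f \<circ> Suc) of (b, f) \<Rightarrow> case_nat b f) = f"
      by (auto simp: fun_eq_iff split: nat.splits)
  next
    fix z assume "z \<in> B 0 \<times> (\<Pi>\<^sub>E j\<in>{..<k}. B (Suc j))"
    then obtain b f where z: "z = (b, f)" "b \<in> B 0" "f \<in> (\<Pi>\<^sub>E j\<in>{..<k}. B (Suc j))" by blast
    have "case_nat b f j \<in> B j" if "j < Suc k" for j
      using z that by (cases j) auto
    moreover have "case_nat b f j = undefined" if "\<not> j < Suc k" for j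
      using PiE_arb[OF z(3), of "j - 1"] that by (cases j) auto
    ultimately show "(case z of (b, f) \<Rightarrow> case_nat b f) \<in> (\<Pi>\<^sub>E j\<in>{..<Suc k}. B j)"
      by (auto simp: z(1))
    show "(\<lambda>f. (f 0, f \<circ> Suc)) (case z of (b, f) \<Rightarrow> case_nat b f) = z"
      by (simp add: z(1) comp_def)
    show "G (case z of (b, f) \<Rightarrow> case_nat b f) = (case z of (b, f) \<Rightarrow> G (case_nat b f))"
      by (simp add: z(1))
  qed
  finally show ?thesis by simp
qed

text \<open>Induction peels off the edge numbered \<open>0\<close>. As \<open>filter\<close> keeps
  the numbers increasing, each vertex receives its edges in their order in
  \<open>es\<close>.\<close>

lemma ev_distr_edges_PiE:
  "ev (distr_edges V es) \<Phi> =
   (\<Sum>f\<in>{..<length es} \<rightarrow>\<^sub>E V. \<Sum>l\<in>(\<Pi>\<^sub>E j\<in>{..<length es}. {l. l \<le> snd (fst (es ! j))}).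
     \<Phi> (\<lambda>u. map (\<lambda>j. (es ! j, l j)) (filter (\<lambda>j. f j = u) [0..<length es])))"
proof (induction es arbitrary: \<Phi>)
  case (Cons e es)
  let ?h = "\<lambda>es f l u. map (\<lambda>j. (es ! j, l j)) (filter (\<lambda>j. f j = u) [0..<length es])"
  have h: "(\<lambda>u. map (\<lambda>j. ((e # es) ! j, case_nat m l j)) (filter (\<lambda>j. case_nat p f j =
      u) [0..<Suc (length es)])) =
      (?h es f l)(p := (e, m) # ?h es f l p)" for p f m l
    by (rule ext)
      (simp add: upt_conv_Cons filter_map comp_def flip: map_Suc_upt del: upt_Suc)
  have "ev (distr_edges V (e # es)) \<Phi> = (\<Sum>f\<in>{..<length es} \<rightarrow>\<^sub>E V.
      \<Sum>l\<in>(\<Pi>\<^sub>E j\<in>{..<length es}. {l. l \<le> snd (fst (es ! j))}). \<Sum>p\<in>V.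
      \<Sum>m\<in>{l. l \<le> snd (fst e)}. \<Phi> ((?h es f l)(p := (e, m) # ?h es f l p)))"
    by (simp add: Cons)
  also have "\<dots> = (\<Sum>f\<in>{..<length es} \<rightarrow>\<^sub>E V. \<Sum>p\<in>V.
      \<Sum>l\<in>(\<Pi>\<^sub>E j\<in>{..<length es}. {l. l \<le> snd (fst (es ! j))}).
      \<Sum>m\<in>{l. l \<le> snd (fst e)}. \<Phi> ((?h es f l)(p := (e, m) # ?h es f l p)))"
    by (intro sum.cong refl sum.swap)
  also have "\<dots> = (\<Sum>p\<in>V. \<Sum>f\<in>{..<length es} \<rightarrow>\<^sub>E V.
      \<Sum>l\<in>(\<Pi>\<^sub>E j\<in>{..<length es}. {l. l \<le> snd (fst (es ! j))}).
      \<Sum>m\<in>{l. l \<le> snd (fst e)}. \<Phi> ((?h es f l)(p := (e, m) # ?h es f l p)))"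
    by (rule sum.swap)
  also have "\<dots> = (\<Sum>p\<in>V. \<Sum>f\<in>{..<length es} \<rightarrow>\<^sub>E V. \<Sum>m\<in>{l. l \<le> snd (fst e)}.
      \<Sum>l\<in>(\<Pi>\<^sub>E j\<in>{..<length es}. {l. l \<le> snd (fst (es ! j))}). \<Phi> ((?h es f l)(p :=
      (e, m) # ?h es f l p)))"
    by (intro sum.cong refl sum.swap)
  finally show ?case
    by (simp only: list.size add_0_right add_Suc_right sum_PiE_Suc h nth_Cons_0 nth_Cons_Suc)
qed simp

lemma mi_multinomial_multinom:
  "mi_multinomial n {j. j < k \<and> P j} l = multinom n (map l (filter P [0..<k]))"
proof -
  have "{j. j < k \<and> P j} = set (filter P [0..<k])" by auto
  then have "(\<Sum>j\<in>{j. j < k \<and> P j}. l j) = sum_list (map l (filter P [0..<k]))"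
    "(\<Prod>j\<in>{j. j < k \<and> P j}. mi_fact (l j)) = prod_list (map (\<lambda>j. mi_fact (l j)) (filter P [0..<k]))"
    by (metis distinct_filter distinct_upt sum.distinct_set_conv_list prod.distinct_set_conv_list)+
  then show ?thesis
    unfolding mi_multinomial_def multinom_def by (simp add: comp_def)
qed

text \<open>Replaces the maps \<open>f\<close>, \<open>l\<close> and \<open>\<delta>\<close> of the
  definition by one distribution of the root of \<open>x\<close>, which can be split along sets of
  vertices.\<close>

lemma ev_star:
  "ev (x \<star>\<^sub>+ y) \<phi> =
      ev2 (distr_root (verts y) x) (\<lambda>\<delta> h. weight (verts y) (dec y) h * \<phi> (amend (grow \<delta> h)
      (lowered h) y))"
proof -
  let ?k = "length (edges x)" and ?V = "verts y"
  let ?js = "\<lambda>f u. filter (\<lambda>j. f j = u) [0..<?k]"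
  let ?h = "\<lambda>f l u. map (\<lambda>j. (edges x ! j, l j)) (?js f u)"
  have tree: "graft_tree x y f l \<delta> = amend (grow \<delta> (?h f l)) (lowered (?h f l)) y" for f l \<delta>
    unfolding graft_tree_def Let_def grow_def lowered_def
    by (simp add: comp_def lower_def split_beta)
  have coeff: "graft_coeff x y f l \<delta> =
      mi_multinomial (root_dec x) ?V \<delta> * weight ?V (dec y) (?h f l)" for f l \<delta>
    unfolding graft_coeff_def weight_def mi_multinomial_multinom by (simp add: comp_def)
  have "ev (x \<star>\<^sub>+ y) \<phi> = (\<Sum>f\<in>{..<?k} \<rightarrow>\<^sub>E ?V. \<Sum>l\<in>(\<Pi>\<^sub>E j\<in>{..<?k}. {l. l \<le> snd (fst (edges x ! j))}).
      ev (distr_mi ?V (root_dec x)) (\<lambda>\<delta>. weight ?V (dec y) (?h f l) * \<phi> (amend (grow \<delta> (?h f l))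
      (lowered (?h f l)) y)))"
    unfolding star_plus_def by (simp add: tree coeff distr_mi_def decos_def mult.assoc)
  also have "\<dots> = ev (distr_edges ?V (edges x)) (\<lambda>h. ev (distr_mi ?V (root_dec x)) (\<lambda>\<delta>.
      weight ?V (dec y) h * \<phi> (amend (grow \<delta> h) (lowered h) y)))"
    by (rule ev_distr_edges_PiE[symmetric])
  also have "\<dots> = ev2 (distr_root ?V x) (\<lambda>\<delta> h. weight ?V (dec y) h * \<phi> (amend (grow \<delta> h)
      (lowered h) y))"
    unfolding ev_distr_root fst_conv snd_conv by (rule ev_swap)
  finally show ?thesis .
qed

lemma ev_star_forest:
  "ev (star_forest x es) \<psi> = ev2 (distr_root (forest_verts es) x) (\<lambda>\<delta> h.
     weight (forest_verts es) (dec (Node 0 es)) h * \<psi> (amend_forest (grow \<delta> h) (lowered h) es))"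
  by (simp add: star_forest_def)

lemma star_forest_Nil: "ev (star_forest x []) \<psi> = (if x = Node 0 [] then \<psi> [] else 0)"
  by (simp add: ev_star_forest ev_distr_root_empty weight_def)

lemma dec_forest_verts: "u \<in> forest_verts es \<Longrightarrow> dec (Node n es) u = dec (Node m es) u"
  by (cases u) (auto simp: dec_def)

lemma ev_star_edge:
  "ev (star_edge x c) \<psi> =
      ev2 (distr_root (edge_verts c) x) (\<lambda>\<delta> h. weight (edge_verts c) (dec (snd c)) h * \<psi>
      (fst c, amend (grow \<delta> h) (lowered h) (snd c)))"
proof (cases "noise_edge c")
  case True
  obtain n es where c: "snd c = Node n es" by (cases "snd c")
  have weight: "weight (forest_verts es) (dec (Node 0 es)) h =
      weight (forest_verts es) (dec (Node n es)) h" for h :: "('a, 'b, 'c) attachment"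
    unfolding weight_def by (intro prod.cong refl arg_cong2[where f = multinom] dec_forest_verts)
  \<comment> \<open>\<open>[]\<close> lies outside the set of receiving vertices, so the congruence
    rule provides \<open>\<delta> [] = 0\<close> and \<open>h [] = []\<close>: the noise vertex
    stays as it is.\<close>
  show ?thesis
    unfolding star_edge_def ev_star_forest using True
    by (auto simp: edge_verts_noise c weight ev_star_forest amend_Node grow_def lowered_def intro!:
      ev_distr_root_cong)
next
  case False
  then show ?thesis
    by (simp add: star_edge_def ev_star edge_verts_kernel)
qed

lemma weight_Un:
  "finite V1 \<Longrightarrow> finite V2 \<Longrightarrow> V1 \<inter> V2 = {} \<Longrightarrow> weight (V1 \<union> V2) d h = weight V1 d h * weight V2 d h"
  unfolding weight_def by (rule prod.union_disjoint)

text \<open>The vertices of the first tree and of the remaining forest are disjoint, and weights and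
  amended trees factor accordingly; the rest is \<open>ev_distr_root_union\<close>.\<close>

lemma star_forest_Cons:
  "ev (star_forest x (c # cs)) \<psi> =
   ev2 (coprod x) (\<lambda>x1 x2. ev (star_edge x1 c) (\<lambda>c'. ev (star_forest x2 cs) (\<lambda>cs'. \<psi> (c' # cs'))))"
proof -
  let ?V1 = "(#) (0 :: nat) ` edge_verts c" and ?V2 = "shift_vertex ` forest_verts cs" and ?W =
    "range ((#) (0 :: nat))"
  have disj: "?V2 \<inter> ?W = {}" "?V1 \<subseteq> ?W" "?V1 \<inter> ?V2 = {}"
    by (auto simp: shift_vertex_def split: list.splits)
  have fin: "finite ?V1" "finite ?V2"
    by (simp_all add: finite_edge_verts finite_forest_verts)
  have notW: "shift_vertex p \<notin> ?W" for p
    by (auto simp: shift_vertex_def split: list.splits)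
  have m1: "merge ?W (push z1 ((#) 0) f) g (0 # p) = f p" for z1 :: 'z and f g p
    by (simp add: inj_Cons)
  have m2: "merge ?W f (push z2 shift_vertex g) (shift_vertex p) = g p" for z2 :: 'z and f g p
    by (simp add: merge_def notW inj_shift_vertex)
  have wt1: "weight ?V1 d h = weight (edge_verts c) (\<lambda>p. d (0 # p)) (\<lambda>p. h (0 # p))" for d and h ::
    "('a, 'b, 'c) attachment"
    unfolding weight_def by (simp add: prod.reindex)
  have wt2: "weight ?V2 d h =
      weight (forest_verts cs) (\<lambda>p. d (shift_vertex p)) (\<lambda>p. h (shift_vertex
        p))" for d and h :: "('a, 'b, 'c) attachment"
    unfolding weight_def using inj_shift_vertex by (simp add: prod.reindex inj_on_subset)
  have dec1: "dec (Node 0 (c # cs)) (0 # p) = dec (snd c) p" for p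
    by (simp add: dec_def)
  have "weight (forest_verts cs) (\<lambda>p. dec (Node 0 (c # cs)) (shift_vertex p)) h =
      weight (forest_verts cs) (dec (Node 0 cs)) h" for h :: "('a, 'b, 'c) attachment"
    unfolding weight_def
  proof (intro prod.cong refl arg_cong2[where f = multinom])
    fix u assume "u \<in> forest_verts cs"
    then show "dec (Node 0 (c # cs)) (shift_vertex u) = dec (Node 0 cs) u"
      by (cases u) (auto simp: dec_def)
  qed
  note weight = weight_Un[OF fin disj(3)] wt1 wt2 dec1 this
  have "ev (star_forest x (c # cs)) \<psi> = ev2 (coprod x) (\<lambda>x1 x2.
      ev2 (distr_root (edge_verts c) x1) (\<lambda>\<delta>1 h1.
      ev2 (distr_root (forest_verts cs) x2) (\<lambda>\<delta>2 h2. weight (edge_verts c) (dec (snd c)) h1 *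
      (weight (forest_verts cs) (dec (Node 0 cs)) h2 * \<psi> ((fst c, amend (grow \<delta>1 h1) (lowered h1)
      (snd c)) # amend_forest (grow \<delta>2 h2) (lowered h2) cs)))))"
    unfolding ev_star_forest forest_verts.simps ev_distr_root_union[OF fin disj(2,1)]
      ev_distr_root_image[OF inj_Cons] ev_distr_root_image[OF inj_shift_vertex]
      amend_forest_Cons weight fst_conv snd_conv
    by (simp add: grow_shift lowered_shift m1 m2 mult.assoc)
  also have "\<dots> = ev2 (coprod x) (\<lambda>x1 x2. ev (star_edge x1 c) (\<lambda>c'. ev (star_forest x2 cs) (\<lambda>cs'.
      \<psi> (c' # cs'))))"
    unfolding ev_star_edge ev_star_forest ev_fun_mult ..
  finally show ?thesis .
qed

text \<open>The same splitting, with \<open>{[]}\<close> as one of the two sets of vertices. The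
  share \<open>x1\<close> falls on the root: its decoration is added there, and its edges come to
  stand left of the old ones.\<close>

lemma star_Node:
  "ev (x \<star>\<^sub>+ Node n ys) \<phi> =
   ev2 (coprod x) (\<lambda>x1 x2. ev2 (attach (edges x1) n) (\<lambda>n' es'. ev (star_forest x2 ys) (\<lambda>ys'.
     \<phi> (Node (n' + root_dec x1) (es' @ ys')))))"
proof -
  let ?V2 = "forest_verts ys"
  have insert: "insert [] ?V2 = {[]} \<union> ?V2" by simp
  have *: "finite {[] :: vertex}" "finite ?V2" "{[]} \<subseteq> {[] :: vertex}" "?V2 \<inter> {[]} = {}"
    by (simp_all add: finite_forest_verts)
  have wt1: "weight {[]} (dec (Node n ys)) h = multinom n (map snd (h []))" for h :: "('a, 'b, 'c)
      attachment"
    by (simp add: weight_def dec_def)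
  have wt2: "weight ?V2 (dec (Node n ys)) (merge {[]} h1 h2) = weight ?V2 (dec (Node 0 ys)) h2" for
    h1 h2 :: "('a, 'b, 'c) attachment"
    unfolding weight_def
    by (intro prod.cong refl arg_cong2[where f = multinom] dec_forest_verts) (auto simp: merge_def)
  have amend: "amend (grow (merge {[]} \<delta>1 \<delta>2) (merge {[]} h1 h2)) (lowered (merge {[]} h1 h2))
      (Node n ys) =
     Node (grow \<delta>1 h1 [] n) (lowered h1 [] @ amend_forest (grow \<delta>2 h2) (lowered h2) ys)"
    for \<delta>1 \<delta>2 and h1 h2 :: "('a, 'b, 'c) attachment"
    unfolding amend_Node
    by (simp add: grow_def lowered_def cong: amend_forest_cong)
  have "ev (x \<star>\<^sub>+ Node n ys) \<phi> = ev2 (coprod x) (\<lambda>x1 x2.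
      ev (distr_edges {[] :: vertex} (edges x1)) (\<lambda>h1. multinom n (map snd (h1
      [])) * ev (star_forest x2 ys) (\<lambda>ys'.
      \<phi> (Node (n - sum_list (map snd (h1 [])) + root_dec x1) (map (\<lambda>p. lower (fst p) (snd p)) (h1
      []) @ ys')))))"
    unfolding ev_star verts_Node insert ev_distr_root_union[OF *] weight_Un[OF *(1,2) *(4)[unfolded
      Int_commute[of ?V2]]]
      fst_conv snd_conv wt1 wt2 amend ev_distr_root[of "{[]}"] ev_distr_mi_singleton ev_star_forest
    by (simp add: grow_def lowered_def mult.assoc ev_fun_mult)
  also have "\<dots> = ev2 (coprod x) (\<lambda>x1 x2. ev2 (attach (edges x1) n) (\<lambda>n' es'.
      ev (star_forest x2 ys) (\<lambda>ys'. \<phi> (Node (n' + root_dec x1) (es' @ ys')))))"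
    by (subst ev_distr_edges_singleton[where u = "[]" and \<psi> = "\<lambda>p. ev (star_forest _ ys) (\<lambda>ys'.
     \<phi> (Node (fst p + root_dec _) (snd p @ ys')))", symmetric]) simp
  finally show ?thesis .
qed

section \<open>Multiplicativity and associativity\<close>

lemma coprod_unit: "ev2 (coprod x) (\<lambda>a b. if a = Node 0 [] then F b else 0) = F x"
proof -
  have "ev2 (coprod x) (\<lambda>a b. if a = Node 0 [] then F b else 0) =
      ev2 (mi_coprod (root_dec x)) (\<lambda>p q. if p = 0 then
        ev2 (unshuffle (edges x)) (\<lambda>a b. if a = [] then F (Node q b) else 0) else 0)"
    unfolding ev_coprod by (intro ev_cong) (simp cong: if_cong)
  also have "\<dots> = F x"
    using unshuffle_unit[of "edges x" "\<lambda>b. F (Node (root_dec x) b)"] by (subst mi_coprod_unit) simp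
  finally show ?thesis .
qed

lemma star_forest_append:
  "ev (star_forest x (as @ bs)) \<psi> =
   ev2 (coprod x) (\<lambda>x1 x2. ev (star_forest x1 as) (\<lambda>as'. ev (star_forest x2 bs) (\<lambda>bs'.
     \<psi> (as' @ bs'))))"
proof (induction as arbitrary: x \<psi>)
  case Nil
  show ?case
    using coprod_unit[of x "\<lambda>x2. ev (star_forest x2 bs) \<psi>"] by (simp add: star_forest_Nil cong:
      if_cong)
next
  case (Cons a as)
  have "ev (star_forest x ((a # as) @ bs)) \<psi> = ev2 (coprod x) (\<lambda>x1 x2. ev2 (coprod x2) (\<lambda>u v.
      ev (star_edge x1 a) (\<lambda>a'. ev (star_forest u as) (\<lambda>as'. ev (star_forest v bs) (\<lambda>bs'.
      \<psi> (a' # as' @ bs'))))))"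
    by (simp add: star_forest_Cons Cons ev_swap[of "star_edge _ _" "coprod _"])
  also have "\<dots> = ev2 (coprod x) (\<lambda>x1 v. ev2 (coprod x1) (\<lambda>u1 u. ev (star_edge u1 a) (\<lambda>a'.
      ev (star_forest u as) (\<lambda>as'. ev (star_forest v bs) (\<lambda>bs'. \<psi> (a' # as' @ bs'))))))"
    by (rule coprod_assoc)
  finally show ?case
    by (simp add: star_forest_Cons)
qed

text \<open>Multiplicativity on forests. The share of \<open>x\<close> that acts on the first edge
  must end up on the side chosen for that edge: coassociativity puts it on the left, left
  commutation on the right.\<close>

lemma star_forest_unshuffle:
  "ev (star_forest x ys) (\<lambda>ys'. ev2 (unshuffle ys') F) =
   ev2 (coprod x) (\<lambda>x1 x2. ev2 (unshuffle ys) (\<lambda>as bs. ev (star_forest x1 as) (\<lambda>as'.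
     ev (star_forest x2 bs) (\<lambda>bs'. F as' bs'))))"
proof (induction ys arbitrary: x F)
  case Nil
  show ?case
    using coprod_unit[of x "\<lambda>x2. if x2 = Node 0 [] then F [] [] else 0"] by (simp add:
      star_forest_Nil cong: if_cong)
next
  case (Cons c cs)
  have "ev (star_forest x (c # cs)) (\<lambda>ys'. ev2 (unshuffle ys') F) =
      ev2 (coprod x) (\<lambda>x1 x2. ev (star_edge x1 c) (\<lambda>c'. ev (star_forest x2 cs) (\<lambda>cs'.
        ev2 (unshuffle cs') (\<lambda>as bs. F (c' # as) bs)))) +
      ev2 (coprod x) (\<lambda>x1 x2. ev (star_edge x1 c) (\<lambda>c'. ev (star_forest x2 cs) (\<lambda>cs'.
        ev2 (unshuffle cs') (\<lambda>as bs. F as (c' # bs)))))"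
    by (simp add: star_forest_Cons ev_fun_add)
  also have "ev2 (coprod x) (\<lambda>x1 x2. ev (star_edge x1 c) (\<lambda>c'. ev (star_forest x2 cs) (\<lambda>cs'.
      ev2 (unshuffle cs') (\<lambda>as bs. F (c' # as) bs)))) =
      ev2 (coprod x) (\<lambda>x1 x2. ev (star_edge x1 c) (\<lambda>c'. ev2 (coprod x2) (\<lambda>u v.
        ev2 (unshuffle cs) (\<lambda>as bs. ev (star_forest u as) (\<lambda>as'. ev (star_forest v bs) (\<lambda>bs'.
        F (c' # as') bs'))))))"
    by (intro ev_cong Cons)
  also have "\<dots> =
      ev2 (coprod x) (\<lambda>x1 x2. ev2 (coprod x2) (\<lambda>u v. ev2 (unshuffle cs) (\<lambda>as bs.
        ev (star_edge x1 c) (\<lambda>c'. ev (star_forest u as) (\<lambda>as'. ev (star_forest v bs) (\<lambda>bs'.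
        F (c' # as') bs'))))))"
    by (simp only: ev_swap[of "star_edge _ _" "coprod _"] ev_swap[of "star_edge _ _" "unshuffle _"])
  also have "\<dots> = ev2 (coprod x) (\<lambda>x1 v. ev2 (coprod x1) (\<lambda>u1 u. ev2 (unshuffle cs) (\<lambda>as bs.
      ev (star_edge u1 c) (\<lambda>c'. ev (star_forest u as) (\<lambda>as'. ev (star_forest v bs) (\<lambda>bs'.
      F (c' # as') bs'))))))"
    by (rule coprod_assoc)
  also have "\<dots> = ev2 (coprod x) (\<lambda>x1 v. ev2 (unshuffle cs) (\<lambda>as bs.
      ev (star_forest x1 (c # as)) (\<lambda>as'. ev (star_forest v bs) (\<lambda>bs'. F as' bs'))))"
    by (simp add: star_forest_Cons ev_swap[of "unshuffle _" "coprod _"])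
  also have "ev2 (coprod x) (\<lambda>x1 x2. ev (star_edge x1 c) (\<lambda>c'. ev (star_forest x2 cs) (\<lambda>cs'.
      ev2 (unshuffle cs') (\<lambda>as bs. F as (c' # bs))))) =
      ev2 (coprod x) (\<lambda>x1 x2. ev (star_edge x1 c) (\<lambda>c'. ev2 (coprod x2) (\<lambda>u v.
        ev2 (unshuffle cs) (\<lambda>as bs. ev (star_forest u as) (\<lambda>as'. ev (star_forest v bs) (\<lambda>bs'.
        F as' (c' # bs')))))))"
    by (intro ev_cong Cons)
  also have "\<dots> =
      ev2 (coprod x) (\<lambda>x1 x2. ev2 (coprod x2) (\<lambda>u v. ev2 (unshuffle cs) (\<lambda>as bs.
        ev (star_edge x1 c) (\<lambda>c'. ev (star_forest u as) (\<lambda>as'. ev (star_forest v bs) (\<lambda>bs'.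
        F as' (c' # bs')))))))"
    by (simp only: ev_swap[of "star_edge _ _" "coprod _"] ev_swap[of "star_edge _ _" "unshuffle _"])
  also have "\<dots> = ev2 (coprod x) (\<lambda>u x2. ev2 (coprod x2) (\<lambda>x1 v. ev2 (unshuffle cs) (\<lambda>as bs.
      ev (star_edge x1 c) (\<lambda>c'. ev (star_forest u as) (\<lambda>as'. ev (star_forest v bs) (\<lambda>bs'.
      F as' (c' # bs')))))))"
    by (rule coprod.left_commute)
  also have "\<dots> = ev2 (coprod x) (\<lambda>x1 x2. ev2 (unshuffle cs) (\<lambda>as bs. ev (star_forest x1 as) (\<lambda>as'.
      ev (star_forest x2 (c # bs)) (\<lambda>bs'. F as' bs'))))"
    by (simp add: star_forest_Cons ev_swap[of "unshuffle _" "coprod _"] ev_swap[of "star_edge _ _"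
      "star_forest _ _"] ev_swap[of "star_forest _ _" "coprod _"])
  finally show ?case
    by (simp add: ev_fun_add)
qed

text \<open>Splitting a term splits the share at the root and the share in the forest, which makes
  four parts of \<open>x\<close>; exchanging the middle two collects them into one action on each
  side.\<close>

lemma star_coprod:
  "ev (x \<star>\<^sub>+ y) (\<lambda>z. ev2 (coprod z) F) =
   ev2 (coprod x) (\<lambda>x1 x2. ev2 (coprod y) (\<lambda>y1 y2. ev (x1 \<star>\<^sub>+ y1) (\<lambda>z1. ev (x2 \<star>\<^sub>+ y2) (\<lambda>z2.
     F z1 z2))))"
proof (cases y)
  case (Node n ys)
  let ?G = "\<lambda>r e1 s e2 u v. ev2 (mi_coprod n) (\<lambda>p q. ev2 (unshuffle ys) (\<lambda>c d.
      ev2 (attach e1 p) (\<lambda>p' a. ev2 (attach e2 q) (\<lambda>q' b. ev (star_forest u c) (\<lambda>c'.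
      ev (star_forest v d) (\<lambda>d'. F (Node (p' + r) (a @ c')) (Node (q' + s) (b @ d'))))))))"
  have 1: "ev2 (attach es n) (\<lambda>n' es'. ev (star_forest x2 ys) (\<lambda>ys'.
      ev2 (coprod (Node (n' + m) (es' @ ys'))) F)) =
      ev2 (mi_coprod m) (\<lambda>r s. ev2 (unshuffle es) (\<lambda>e1 e2.
        ev2 (coprod x2) (\<lambda>u v. ?G r e1 s e2 u v)))" for es m x2
  proof -
    have "ev2 (attach es n) (\<lambda>n' es'. ev (star_forest x2 ys) (\<lambda>ys'.
        ev2 (coprod (Node (n' + m) (es' @ ys'))) F)) =
      ev2 (attach es n) (\<lambda>n' es'. ev (star_forest x2 ys) (\<lambda>ys'. ev2 (mi_coprod n') (\<lambda>p q.
        ev2 (mi_coprod m) (\<lambda>r s. ev2 (unshuffle es') (\<lambda>a b. ev2 (unshuffle ys') (\<lambda>c d.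
        F (Node (p + r) (a @ c)) (Node (q + s) (b @ d))))))))"
      unfolding ev_coprod tree.sel fst_conv snd_conv
      by (intro ev_cong, subst mi_coprod_add, intro ev_cong unshuffle_append)
    also have "\<dots> = ev2 (mi_coprod m) (\<lambda>r s. ev2 (attach es n) (\<lambda>n' es'. ev2 (mi_coprod n') (\<lambda>p q.
        ev2 (unshuffle es') (\<lambda>a b. ev (star_forest x2 ys) (\<lambda>ys'. ev2 (unshuffle ys') (\<lambda>c d.
        F (Node (p + r) (a @ c)) (Node (q + s) (b @ d))))))))"
      by (simp only: ev_swap[of "star_forest _ _" "mi_coprod _"] ev_swap[of "star_forest _ _"
        "unshuffle _"] ev_swap[of _ "mi_coprod m"])
    also have "\<dots> = ev2 (mi_coprod m) (\<lambda>r s. ev2 (mi_coprod n) (\<lambda>p q. ev2 (unshuffle es) (\<lambda>e1 e2.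
        ev2 (attach e1 p) (\<lambda>p' a. ev2 (attach e2 q) (\<lambda>q' b. ev (star_forest x2 ys) (\<lambda>ys'.
        ev2 (unshuffle ys') (\<lambda>c d. F (Node (p' + r) (a @ c)) (Node (q' + s) (b @ d)))))))))"
      by (intro ev_cong attach_unshuffle)
    also have "\<dots> = ev2 (mi_coprod m) (\<lambda>r s. ev2 (mi_coprod n) (\<lambda>p q. ev2 (unshuffle es) (\<lambda>e1 e2.
        ev2 (attach e1 p) (\<lambda>p' a. ev2 (attach e2 q) (\<lambda>q' b. ev2 (coprod x2) (\<lambda>u v.
        ev2 (unshuffle ys) (\<lambda>c d. ev (star_forest u c) (\<lambda>c'. ev (star_forest v d) (\<lambda>d'.
        F (Node (p' + r) (a @ c')) (Node (q' + s) (b @ d')))))))))))"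
      by (intro ev_cong star_forest_unshuffle)
    also have "\<dots> = ev2 (mi_coprod m) (\<lambda>r s. ev2 (unshuffle es) (\<lambda>e1 e2.
        ev2 (coprod x2) (\<lambda>u v. ?G r e1 s e2 u v)))"
      by (simp only: ev_swap[of "attach _ _" "coprod x2"] ev_swap[of "mi_coprod n" "coprod x2"]
        ev_swap[of "mi_coprod n" "unshuffle es"] ev_swap[of "attach _ _" "unshuffle ys"])
    finally show ?thesis .
  qed
  have "ev (x \<star>\<^sub>+ y) (\<lambda>z. ev2 (coprod z) F) = ev2 (coprod x) (\<lambda>x1 x2. ev2 (coprod x1) (\<lambda>a b.
      ev2 (coprod x2) (\<lambda>u v. ?G (root_dec a) (edges a) (root_dec b) (edges b) u v)))"
    unfolding Node star_Node 1 ev_coprod[of "fst _"] by simp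
  also have "\<dots> = ev2 (coprod x) (\<lambda>x1 x2. ev2 (coprod x1) (\<lambda>a u. ev2 (coprod x2) (\<lambda>b v.
      ?G (root_dec a) (edges a) (root_dec b) (edges b) u v)))"
    by (rule coprod.interchange)
  also have "\<dots> = ev2 (coprod x) (\<lambda>x1 x2. ev2 (coprod y) (\<lambda>y1 y2. ev (x1 \<star>\<^sub>+ y1) (\<lambda>z1.
      ev (x2 \<star>\<^sub>+ y2) (\<lambda>z2. F z1 z2))))"
    unfolding Node ev_coprod[of "Node _ _"] star_Node tree.sel fst_conv snd_conv
    by (simp only: ev_swap[of "mi_coprod n" "coprod _"] ev_swap[of "unshuffle ys" "coprod _"]
      ev_swap[of "attach _ _" "coprod _"]
      ev_swap[of "star_forest _ _" "coprod _"] ev_swap[of "star_forest _ _" "attach _ _"])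
  finally show ?thesis .
qed

text \<open>Edge labels stay fixed under the action, so only the subtree has to be followed; the
  flag says whether the edge leading to it carries noise.\<close>

definition star_child :: "bool \<Rightarrow> ('k, 'x, 'd::finite) tree \<Rightarrow> ('k, 'x, 'd) tree \<Rightarrow>
    ('k, 'x, 'd) tree \<Rightarrow>\<^sub>0 real" where
  "star_child b x t =
      (if b then lin (\<lambda>cs. Poly_Mapping.single (Node (root_dec t) cs) 1) (star_forest x (edges t))
      else x \<star>\<^sub>+ t)"

lemma ev_star_edge_star_child: "ev (star_edge x c) \<psi> = ev (star_child (noise_edge c) x (snd c)) (\<lambda>t.
    \<psi> (fst c, t))"
  by (simp add: star_edge_def star_child_def)

lemma noise_edge_lower [simp]: "noise_edge (lower c l) = noise_edge c"
  by (simp add: noise_edge_def)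

lemma noise_edge_Pair [simp]: "noise_edge (fst c, t) = noise_edge c"
  by (simp add: noise_edge_def)

lemma lower_Pair: "lower (fst c, t) l = (fst (lower c l), t)"
  by (simp add: lower_def)

text \<open>Acting changes the subtrees, attaching changes the decorations of the edges leading to
  them, and neither depends on the other.\<close>

lemma star_forest_attach:
  "ev (star_forest x ys) (\<lambda>ys'. ev2 (attach ys' n) (\<lambda>n' zs. \<psi> n' zs)) =
   ev2 (attach ys n) (\<lambda>n' ys'. ev (star_forest x ys') (\<lambda>zs. \<psi> n' zs))"
proof (induction ys arbitrary: x \<psi>)
  case (Cons c cs)
  have "ev (star_forest x (c # cs)) (\<lambda>ys'. ev2 (attach ys' n) (\<lambda>n' zs. \<psi> n' zs)) =
    ev2 (coprod x) (\<lambda>x1 x2. ev (star_edge x1 c) (\<lambda>c'. ev (star_forest x2 cs) (\<lambda>cs'.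
      ev2 (attach cs' n) (\<lambda>n' zs. ev2 (mi_coprod n') (\<lambda>l r.
      of_bool (l \<le> snd (fst c')) * \<psi> r (lower c' l # zs))))))"
    by (simp add: star_forest_Cons)
  also have "\<dots> = ev2 (coprod x) (\<lambda>x1 x2. ev (star_edge x1 c) (\<lambda>c'. ev2 (attach cs n) (\<lambda>n' cs'.
      ev (star_forest x2 cs') (\<lambda>zs. ev2 (mi_coprod n') (\<lambda>l r.
      of_bool (l \<le> snd (fst c')) * \<psi> r (lower c' l # zs))))))"
    by (intro ev_cong Cons)
  also have "\<dots> = ev2 (attach cs n) (\<lambda>n' cs'. ev2 (coprod x) (\<lambda>x1 x2. ev2 (mi_coprod n') (\<lambda>l r.
      ev (star_edge x1 c) (\<lambda>c'. ev (star_forest x2 cs') (\<lambda>zs.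
      of_bool (l \<le> snd (fst c')) * \<psi> r (lower c' l # zs))))))"
    by (simp only: ev_swap[of "star_edge _ _" "attach cs n"] ev_swap[of "coprod _" "attach cs n"]
      ev_swap[of "star_forest _ _" "mi_coprod _"] ev_swap[of "star_edge _ _" "mi_coprod _"])
  also have "\<dots> = ev2 (attach cs n) (\<lambda>n' cs'. ev2 (mi_coprod n') (\<lambda>l r.
      of_bool (l \<le> snd (fst c)) * ev2 (coprod x) (\<lambda>x1 x2. ev (star_edge x1 (lower c l)) (\<lambda>c'.
      ev (star_forest x2 cs') (\<lambda>zs. \<psi> r (c' # zs))))))"
    by (simp add: ev_star_edge_star_child lower_Pair ev_fun_mult ev_swap[of "coprod _"
      "mi_coprod _"])
  also have "\<dots> = ev2 (attach (c # cs) n) (\<lambda>n' ys'. ev (star_forest x ys') (\<lambda>zs. \<psi> n' zs))"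
    by (simp add: star_forest_Cons)
  finally show ?case .
qed (simp add: star_forest_Nil)

text \<open>If the root of a term is dissolved into a vertex of decoration \<open>n\<close>, the
  edges that \<open>x\<close> put there are lowered a second time, now at the expense of
  \<open>n\<close> instead of the old decoration. \<open>attach_attach\<close> merges both
  lowerings.\<close>

lemma star_attach:
  "ev (x \<star>\<^sub>+ y) (\<lambda>z. ev2 (attach (edges z) n) (\<lambda>n' zs. \<psi> (n' + root_dec z) zs)) =
   ev2 (attach (edges y) n) (\<lambda>n' ys. ev2 (coprod x) (\<lambda>x1 x2.
     ev2 (attach (edges x1) (n' + root_dec y)) (\<lambda>n'' es. ev (star_forest x2 ys) (\<lambda>ys'.
     \<psi> (n'' + root_dec x1) (es @ ys')))))"
proof (cases y)
  case (Node b ys)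
  have "ev (x \<star>\<^sub>+ y) (\<lambda>z. ev2 (attach (edges z) n) (\<lambda>n' zs. \<psi> (n' + root_dec z) zs)) =
      ev2 (coprod x) (\<lambda>x1 x2. ev2 (attach (edges x1) b) (\<lambda>b' es. ev (star_forest x2 ys) (\<lambda>ys'.
        ev2 (attach ys' n) (\<lambda>n1 zs'. ev2 (attach es n1) (\<lambda>n2 zs.
        \<psi> (n2 + b' + root_dec x1) (zs @ zs'))))))"
    unfolding Node star_Node tree.sel add.assoc by (intro ev_cong attach_append)
  also have "\<dots> = ev2 (coprod x) (\<lambda>x1 x2. ev2 (attach (edges x1) b) (\<lambda>b' es.
      ev2 (attach ys n) (\<lambda>n1 ys'. ev (star_forest x2 ys') (\<lambda>zs'. ev2 (attach es n1) (\<lambda>n2 zs.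
      \<psi> (n2 + b' + root_dec x1) (zs @ zs'))))))"
    by (intro ev_cong star_forest_attach)
  also have "\<dots> = ev2 (attach ys n) (\<lambda>n1 ys'. ev2 (coprod x) (\<lambda>x1 x2. ev (star_forest x2 ys') (\<lambda>zs'.
      ev2 (attach (edges x1) b) (\<lambda>b' es. ev2 (attach es n1) (\<lambda>n2 zs.
      \<psi> (n2 + b' + root_dec x1) (zs @ zs'))))))"
    by (simp only: ev_swap[of _ "attach ys n"] ev_swap[of "attach _ b" "star_forest _ _"])
  also have "\<dots> = ev2 (attach ys n) (\<lambda>n1 ys'. ev2 (coprod x) (\<lambda>x1 x2. ev (star_forest x2 ys') (\<lambda>zs'.
      ev2 (attach (edges x1) (n1 + b)) (\<lambda>n2 zs. \<psi> (n2 + root_dec x1) (zs @ zs')))))"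
    by (intro ev_cong attach_attach)
  also have "\<dots> = ev2 (attach ys n) (\<lambda>n1 ys'. ev2 (coprod x) (\<lambda>x1 x2.
      ev2 (attach (edges x1) (n1 + b)) (\<lambda>n2 zs. ev (star_forest x2 ys') (\<lambda>zs'.
      \<psi> (n2 + root_dec x1) (zs @ zs')))))"
    by (simp only: ev_swap[of "star_forest _ _" "attach _ _"])
  finally show ?thesis by (simp add: Node)
qed

text \<open>A term without edges requires that neither factor has any. Then nothing is lowered, and
  the decorations add up to zero only if both vanish.\<close>

lemma star_unit:
  "ev (x \<star>\<^sub>+ y) (\<lambda>z. if z = Node 0 [] then c else 0) = (if x = Node 0 [] \<and> y =
      Node 0 [] then c else 0)"
proof (cases y)
  case (Node n ys)
  have 0: "n' + m = 0 \<longleftrightarrow> n' = 0 \<and> m = 0" for n' m :: "nat ^ 'c"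
    by (auto simp: vec_eq_iff)
  have 1: "ev2 (attach (edges x1) n) (\<lambda>n' es. ev (star_forest x2 ys) (\<lambda>ys'.
      if Node (n' + root_dec x1) (es @ ys') = Node 0 [] then c else 0)) =
    (if y = Node 0 [] then if x1 = Node 0 [] then if x2 = Node 0 [] then c else 0 else 0 else
      0)" for x1 x2
    by (cases x1; cases "edges x1"; cases ys) (auto simp: Node star_forest_Nil star_forest_Cons 0
      cong: if_cong)
  show ?thesis
    unfolding Node star_Node 1[unfolded Node]
    using coprod_unit[of x "\<lambda>b. if b = Node 0 [] then c else 0"]
    by (cases "n = 0"; cases ys) simp_all
qed

text \<open>The recursion through a noise edge passes to the forest above its end point, so forests are
  treated along with trees.\<close>

lemma star_assoc_aux:
  "(\<forall>x y \<phi>. ev (x \<star>\<^sub>+ y) (\<lambda>z. ev (z \<star>\<^sub>+ w) \<phi>) = ev (y \<star>\<^sub>+ w) (\<lambda>z. ev (x \<star>\<^sub>+ z) \<phi>)) \<and>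
   (\<forall>x y \<psi>. ev (x \<star>\<^sub>+ y) (\<lambda>z. ev (star_forest z (edges w)) \<psi>) = ev (star_forest y (edges w)) (\<lambda>ws.
     ev (star_forest x ws) \<psi>))"
proof (induction w rule: measure_induct_rule[of size])
  case (less w)
  obtain n ws where w: "w = Node n ws" by (cases w)
  \<comment> \<open>A noise edge is covered by the forest half of the induction hypothesis, a kernel
    edge by the tree half.\<close>
  have star_edge: "ev (x \<star>\<^sub>+ y) (\<lambda>z. ev (star_edge z c) \<psi>) = ev (star_edge y c) (\<lambda>c'.
      ev (star_edge x c') \<psi>)"
    if "c \<in> set ws" for x y c \<psi>
  proof -
    have "size (snd c) < size w" using size_edge[OF that] w by simp
    note IH = less[OF this]
    show ?thesis
      by (cases "noise_edge c") (simp_all add: ev_star_edge_star_child star_child_def IH)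
  qed
  have forest: "ev (x \<star>\<^sub>+ y) (\<lambda>z. ev (star_forest z us) \<psi>) = ev (star_forest y us) (\<lambda>ws.
      ev (star_forest x ws) \<psi>)"
    if "set us \<subseteq> set ws" for us x y \<psi>
    using that
  proof (induction us arbitrary: x y \<psi>)
    case Nil
    show ?case
      using star_unit[of x y "\<psi> []"] by (simp add: star_forest_Nil)
  next
    case (Cons c cs)
    have "ev (x \<star>\<^sub>+ y) (\<lambda>z. ev (star_forest z (c # cs)) \<psi>) =
        ev2 (coprod x) (\<lambda>x1 x2. ev2 (coprod y) (\<lambda>y1 y2. ev (x1 \<star>\<^sub>+ y1) (\<lambda>z1. ev (x2 \<star>\<^sub>+ y2) (\<lambda>z2.
          ev (star_edge z1 c) (\<lambda>c'. ev (star_forest z2 cs) (\<lambda>cs'. \<psi> (c' # cs')))))))"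
      unfolding star_forest_Cons by (rule star_coprod)
    also have "\<dots> = ev2 (coprod x) (\<lambda>x1 x2. ev2 (coprod y) (\<lambda>y1 y2. ev (x1 \<star>\<^sub>+ y1) (\<lambda>z1.
        ev (star_edge z1 c) (\<lambda>c'. ev (star_forest y2 cs) (\<lambda>cs'. ev (star_forest x2 cs') (\<lambda>cs''.
        \<psi> (c' # cs'')))))))"
      using Cons by (simp add: ev_swap[of "_ \<star>\<^sub>+ _" "star_edge _ _"])
    also have "\<dots> = ev2 (coprod x) (\<lambda>x1 x2. ev2 (coprod y) (\<lambda>y1 y2. ev (star_edge y1 c) (\<lambda>c'.
        ev (star_edge x1 c') (\<lambda>c''. ev (star_forest y2 cs) (\<lambda>cs'. ev (star_forest x2 cs') (\<lambda>cs''.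
        \<psi> (c'' # cs'')))))))"
      using Cons.prems by (simp add: star_edge)
    also have "\<dots> = ev (star_forest y (c # cs)) (\<lambda>ws. ev (star_forest x ws) \<psi>)"
      by (simp add: star_forest_Cons ev_swap[of "coprod x"] ev_swap[of "star_edge _ _" "star_forest
          _ cs"])
    finally show ?case .
  qed
  have tree: "ev (x \<star>\<^sub>+ y) (\<lambda>z. ev (z \<star>\<^sub>+ w) \<phi>) = ev (y \<star>\<^sub>+ w) (\<lambda>z. ev (x \<star>\<^sub>+ z) \<phi>)" for x y \<phi>
  proof -
  have "ev (x \<star>\<^sub>+ y) (\<lambda>z. ev (z \<star>\<^sub>+ w) \<phi>) =
      ev2 (coprod x) (\<lambda>x1 x2. ev2 (coprod y) (\<lambda>y1 y2. ev (x1 \<star>\<^sub>+ y1) (\<lambda>z1. ev (x2 \<star>\<^sub>+ y2) (\<lambda>z2.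
        ev2 (attach (edges z1) n) (\<lambda>n' es'. ev (star_forest z2 ws) (\<lambda>ws'.
        \<phi> (Node (n' + root_dec z1) (es' @ ws'))))))))"
    unfolding w star_Node by (rule star_coprod)
  also have "\<dots> = ev2 (coprod x) (\<lambda>x1 x2. ev2 (coprod y) (\<lambda>y1 y2. ev (x1 \<star>\<^sub>+ y1) (\<lambda>z1.
      ev2 (attach (edges z1) n) (\<lambda>n' es'. ev (star_forest y2 ws) (\<lambda>ws'.
      ev (star_forest x2 ws') (\<lambda>ws''. \<phi> (Node (n' + root_dec z1) (es' @ ws''))))))))"
    by (simp add: ev_swap[of "_ \<star>\<^sub>+ _" "attach _ _"] forest)
  \<comment> \<open>The root edges of a term of \<open>x1 \<star>\<^sub>+ y1\<close> are being
    attached to the root of \<open>w\<close>; instead those of \<open>y1\<close> are attached first,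
    and \<open>x1\<close> acts afterwards.\<close>
  also have "\<dots> = ev2 (coprod x) (\<lambda>x1 x2. ev2 (coprod y) (\<lambda>y1 y2. ev2 (attach (edges y1) n) (\<lambda>n' es.
      ev2 (coprod x1) (\<lambda>u v. ev2 (attach (edges u) (n' + root_dec y1)) (\<lambda>n'' es'.
      ev (star_forest v es) (\<lambda>es''. ev (star_forest y2 ws) (\<lambda>ws'. ev (star_forest x2 ws') (\<lambda>ws''.
      \<phi> (Node (n'' + root_dec u) ((es' @ es'') @ ws''))))))))))"
    by (intro ev_cong star_attach)
  also have "\<dots> = ev2 (coprod y) (\<lambda>y1 y2. ev2 (attach (edges y1) n) (\<lambda>n' es.
      ev (star_forest y2 ws) (\<lambda>ws'. ev2 (coprod x) (\<lambda>x1 x2. ev2 (coprod x1) (\<lambda>u v.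
      ev2 (attach (edges u) (n' + root_dec y1)) (\<lambda>n'' es'. ev (star_forest v es) (\<lambda>es''.
      ev (star_forest x2 ws') (\<lambda>ws''. \<phi> (Node (n'' + root_dec u) (es' @ es'' @ ws''))))))))))"
    by (simp only: ev_swap[of "coprod x"] ev_swap[of _ "star_forest _ ws"] append_assoc)
  \<comment> \<open>\<open>u\<close> acts on the root, \<open>v\<close> on the edges stemming from
    \<open>y1\<close> and \<open>x2\<close> on the forest of \<open>w\<close>. The new bracketing is
    that of an action on the concatenated forest.\<close>
  also have "\<dots> = ev2 (coprod y) (\<lambda>y1 y2. ev2 (attach (edges y1) n) (\<lambda>n' es.
      ev (star_forest y2 ws) (\<lambda>ws'. ev2 (coprod x) (\<lambda>u x'. ev2 (coprod x') (\<lambda>v x2.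
      ev2 (attach (edges u) (n' + root_dec y1)) (\<lambda>n'' es'. ev (star_forest v es) (\<lambda>es''.
      ev (star_forest x2 ws') (\<lambda>ws''. \<phi> (Node (n'' + root_dec u) (es' @ es'' @ ws''))))))))))"
    by (intro ev_cong coprod_assoc[symmetric])
  also have "\<dots> = ev (y \<star>\<^sub>+ w) (\<lambda>z. ev (x \<star>\<^sub>+ z) \<phi>)"
    unfolding w star_Node star_forest_append by (simp add: ev_swap[of "coprod _" "attach _ _"])
  finally show ?thesis .
  qed
  show ?case
    using tree forest[of ws] by (simp add: w)
qed

lemma star_assoc: "ev (x \<star>\<^sub>+ y) (\<lambda>z. ev (z \<star>\<^sub>+ w) \<phi>) = ev (y \<star>\<^sub>+ w) (\<lambda>z. ev (x \<star>\<^sub>+ z) \<phi>)"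
  using star_assoc_aux by blast

section \<open>The recursive structure of insertions\<close>

definition noise_free :: "('k, 'x, 'd::finite) tree \<Rightarrow> bool" where
  "noise_free x \<longleftrightarrow> (\<forall>e\<in>set (edges x). \<not> noise_edge e)"

definition edge_free_verts :: "('k, 'x, 'd::finite) edge \<Rightarrow> vertex set" where
  "edge_free_verts c = free_verts (snd c) - (if noise_edge c then {[]} else {})"

primrec forest_free_verts :: "('k, 'x, 'd::finite) edge list \<Rightarrow> vertex set" where
  "forest_free_verts [] = {}"
| "forest_free_verts (c # cs) = (#) 0 ` edge_free_verts c \<union> shift_vertex ` forest_free_verts cs"

lemma Cons_in_forest_free_verts: "i # p \<in> forest_free_verts es \<longleftrightarrow> i < length es \<and> p \<in> edge_free_verts
    (es ! i)"
proof (induction es arbitrary: i)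
  case (Cons c cs)
  have "Suc j # p \<in> shift_vertex ` forest_free_verts cs \<longleftrightarrow> j # p \<in> forest_free_verts cs" for j
    using inj_image_mem_iff[OF inj_shift_vertex, of "j # p"] by simp
  moreover have "0 # p \<notin> shift_vertex ` forest_free_verts cs"
    by (auto simp: shift_vertex_def split: list.splits)
  ultimately show ?case
    using Cons by (cases i) auto
qed simp

lemma Nil_notin_forest_free_verts [simp]: "[] \<notin> forest_free_verts es"
  by (induction es) (auto simp: shift_vertex_def split: list.splits)

lemma free_verts_Node:
  "free_verts (Node n es) = (if noise_free (Node n es) then {[]} else {}) \<union> forest_free_verts es"
proof (rule set_eqI)
  fix p
  show "p \<in> free_verts (Node n es) \<longleftrightarrow> p \<in> (if noise_free (Node n es) then {[]}
      else {}) \<union> forest_free_verts es"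
  proof (cases p)
    case Nil
    then show ?thesis by (simp add: free_verts_def verts_Node noise_free_def)
  next
    case (Cons i q)
    then show ?thesis
      by (auto simp: free_verts_def verts_Node Cons_in_forest_verts Cons_in_forest_free_verts
        edge_verts_def edge_free_verts_def)
  qed
qed

lemma free_verts_nonroot: "free_verts x - {[]} = forest_free_verts (edges x)"
  by (cases x) (auto simp: free_verts_Node)

lemma edge_free_verts_noise: "noise_edge c \<Longrightarrow> edge_free_verts c = forest_free_verts (edges (snd c))"
  by (simp add: edge_free_verts_def free_verts_nonroot)

lemma edge_free_verts_kernel: "\<not> noise_edge c \<Longrightarrow> edge_free_verts c = free_verts (snd c)"
  by (simp add: edge_free_verts_def)

lemma finite_free_verts: "finite (free_verts x)"
  by (rule finite_subset[OF _ finite_verts[of x]]) (auto simp: free_verts_def)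

lemma finite_forest_free_verts: "finite (forest_free_verts es)"
  using finite_free_verts[of "Node undefined es"] by (simp add: free_verts_Node split: if_splits)

lemma finite_edge_free_verts: "finite (edge_free_verts c)"
  by (simp add: edge_free_verts_def finite_free_verts)

text \<open>An injective choice of vertices is encoded as the partial map that sends each chosen vertex to
  the tree inserted there.\<close>

primrec placements :: "'t list \<Rightarrow> 'u set \<Rightarrow> ('u \<Rightarrow> 't option) \<Rightarrow>\<^sub>0 real" where
  "placements [] V = Poly_Mapping.single Map.empty 1"
| "placements (t # ts) V =
    (\<Sum>p\<in>V. lin (\<lambda>M. Poly_Mapping.single (M(p \<mapsto> t)) 1) (placements ts (V - {p})))"

text \<open>Each tree is placed in one of the two sets; since these are disjoint, injectivity is a
  condition on each of them separately.\<close>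

lemma ev_placements_union:
  assumes "finite V1" "finite V2" "V1 \<subseteq> W" "V2 \<inter> W = {}"
  shows "ev (placements ts (V1 \<union> V2)) \<Phi> =
    ev2 (unshuffle ts) (\<lambda>a b. ev (placements a V1) (\<lambda>M1.
      ev (placements b V2) (\<lambda>M2. \<Phi> (merge W M1 M2))))"
  using assms
proof (induction ts arbitrary: V1 V2 \<Phi>)
  case (Cons t ts)
  have disj: "V1 \<inter> V2 = {}" using Cons.prems by auto
  have 1: "ev (placements ts (V1 \<union> V2 - {p})) (\<lambda>M. \<Phi> (M(p \<mapsto> t))) =
      ev2 (unshuffle ts) (\<lambda>a b. ev (placements a (V1 - {p})) (\<lambda>M1.
        ev (placements b V2) (\<lambda>M2. \<Phi> (merge W (M1(p \<mapsto> t)) M2))))"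
    if "p \<in> V1" for p
  proof -
    have "V1 \<union> V2 - {p} = (V1 - {p}) \<union> V2" "p \<in> W"
      using that disj Cons.prems by auto
    moreover have "finite (V1 - {p})" "finite V2" "V1 - {p} \<subseteq> W" "V2 \<inter> W = {}"
      using Cons.prems by auto
    ultimately show ?thesis
      by (simp add: Cons.IH merge_upd1)
  qed
  have 2: "ev (placements ts (V1 \<union> V2 - {p})) (\<lambda>M. \<Phi> (M(p \<mapsto> t))) =
      ev2 (unshuffle ts) (\<lambda>a b. ev (placements a V1) (\<lambda>M1.
        ev (placements b (V2 - {p})) (\<lambda>M2. \<Phi> (merge W M1 (M2(p \<mapsto> t))))))"
    if "p \<in> V2" for p
  proof -
    have "V1 \<union> V2 - {p} = V1 \<union> (V2 - {p})" "p \<notin> W"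
      using that disj Cons.prems by auto
    moreover have "finite V1" "finite (V2 - {p})" "V1 \<subseteq> W" "(V2 - {p}) \<inter> W = {}"
      using Cons.prems by auto
    ultimately show ?thesis
      by (simp add: Cons.IH merge_upd2)
  qed
  show ?case
    using Cons.prems disj by (simp add: sum.union_disjoint 1 2 ev_fun_sum ev_fun_add)
qed (simp add: merge_const)

lemma ev_placements_image:
  assumes "inj g"
  shows "ev (placements ts (g ` V)) \<Phi> = ev (placements ts V) (\<lambda>M. \<Phi> (push None g M))"
proof (induction ts arbitrary: V \<Phi>)
  case (Cons t ts)
  have inj: "inj_on g V" using assms by (rule inj_on_subset) auto
  have "g ` V - {g p} = g ` (V - {p})" for p
    using assms by (auto simp: inj_eq)
  then show ?case
    by (simp add: Cons sum.reindex inj push_upd assms)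
qed (simp add: push_const)

lemma ev_placements_empty: "ev (placements ts {}) \<Phi> = (if ts = [] then \<Phi> Map.empty else 0)"
  by (cases ts) simp_all

lemma ev_placements_cong:
  "(\<And>M. finite (dom M) \<Longrightarrow> dom M \<subseteq> V \<Longrightarrow> \<Phi> M = \<Psi> M) \<Longrightarrow> ev (placements ts V) \<Phi> = ev (placements ts V) \<Psi>"
proof (induction ts arbitrary: V \<Phi> \<Psi>)
  case (Cons t ts)
  have "\<Phi> (M(p \<mapsto> t)) = \<Psi> (M(p \<mapsto> t))" if "p \<in> V" "finite (dom M)" "dom M \<subseteq> V - {p}" for p M
    using that by (intro Cons.prems[of "M(p \<mapsto> t)"]) (simp_all add: subset_iff del: fun_upd_apply)
  then show ?case
    unfolding placements.simps ev_sum ev_lin ev_single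
    by (intro sum.cong refl Cons.IH arg_cong[where f = "\<lambda>x. 1 * x"])
qed simp

definition insert_seq :: "vertex list \<Rightarrow> (vertex \<Rightarrow> ('k, 'x, 'd::finite) tree option) \<Rightarrow>
    ('k, 'x, 'd) tree \<Rightarrow> ('k, 'x, 'd) tree \<Rightarrow>\<^sub>0 real" where
  "insert_seq L M \<sigma> = foldr (\<lambda>p. lin (insert_at (the (M p)) p)) L (Poly_Mapping.single \<sigma> 1)"

lemma ev_insert_seq_Nil [simp]: "ev (insert_seq [] M \<sigma>) \<phi> = \<phi> \<sigma>"
  by (simp add: insert_seq_def)

lemma ev_insert_seq_Cons [simp]: "ev (insert_seq (p # L) M \<sigma>) \<phi> = ev (insert_seq L M \<sigma>) (\<lambda>\<rho>.
    ev (insert_at (the (M p)) p \<rho>) \<phi>)"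
  by (simp add: insert_seq_def)

lemma ev_insert_at: "ev (insert_at t v \<sigma>) \<phi> = ev (subtree_at \<sigma> v \<star>\<^sub>+ t) (\<lambda>\<rho>. \<phi> (replace_at \<sigma> v \<rho>))"
  by (simp add: insert_at_def)

lemma ev_insert_at_Cons:
  "ev (insert_at t (i # p) (Node n es)) \<phi> =
   ev (insert_at t p (snd (es ! i))) (\<lambda>\<rho>. \<phi> (Node n (es[i := (fst (es ! i), \<rho>)])))"
  by (simp add: ev_insert_at)

text \<open>Meant for positions other than \<open>[]\<close>: \<open>hd p\<close> selects the tree
  of the forest and \<open>tl p\<close> the vertex in it. Such insertions leave the common root
  alone, so it is not recorded.\<close>

primrec insert_seq_forest :: "vertex list \<Rightarrow> (vertex \<Rightarrow> ('k, 'x, 'd::finite) tree option) \<Rightarrow>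
    ('k, 'x, 'd) edge list \<Rightarrow> ('k, 'x, 'd) edge list \<Rightarrow>\<^sub>0 real" where
  "insert_seq_forest [] M es = Poly_Mapping.single es 1"
| "insert_seq_forest (p # L) M es = lin (\<lambda>es'. lin (\<lambda>\<rho>. Poly_Mapping.single (es'[hd p :=
    (fst (es' ! hd p), \<rho>)]) 1) (insert_at (the (M p)) (tl p) (snd (es' ! hd p))))
    (insert_seq_forest L M es)"

lemma insert_seq_Node: "[] \<notin> set L \<Longrightarrow> ev (insert_seq L M (Node n es)) \<phi> =
    ev (insert_seq_forest L M es) (\<lambda>es'. \<phi> (Node n es'))"
proof (induction L arbitrary: \<phi>)
  case (Cons p L)
  then obtain i q where "p = i # q" by (cases p) auto
  with Cons show ?case by (simp add: ev_insert_at_Cons)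
qed simp

lemma insert_seq_forest_append: "ev (insert_seq_forest (L1 @ L2) M es) \<psi> =
    ev (insert_seq_forest L2 M es) (\<lambda>es'. ev (insert_seq_forest L1 M es') \<psi>)"
  by (induction L1 arbitrary: \<psi>) simp_all

lemma insert_seq_forest_shift_vertex:
  "[] \<notin> set L \<Longrightarrow> ev (insert_seq_forest (map shift_vertex L) M (c # cs)) \<psi> =
      ev (insert_seq_forest L (\<lambda>p. M (shift_vertex p)) cs) (\<lambda>cs'. \<psi> (c # cs'))"
proof (induction L arbitrary: \<psi>)
  case (Cons p L)
  then obtain i q where "p = i # q" by (cases p) auto
  with Cons show ?case by simp
qed simp

lemma insert_seq_forest_0:
  "ev (insert_seq_forest (map ((#) 0) L) M (c # cs)) \<psi> =
      ev (insert_seq L (\<lambda>p. M (0 # p)) (snd c)) (\<lambda>t. \<psi> ((fst c, t) # cs))"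
  by (induction L arbitrary: \<psi>) simp_all

definition insert_map :: "(vertex \<Rightarrow> ('k, 'x, 'd::finite) tree option) \<Rightarrow> ('k, 'x, 'd) tree \<Rightarrow>
    ('k, 'x, 'd) tree \<Rightarrow>\<^sub>0 real" where
  "insert_map M = insert_seq (sorted_list_of_set (dom M)) M"

text \<open>The place of the first tree is removed from \<open>V\<close> before the others are
  placed, which encodes injectivity.\<close>

lemma sum_inj_placements:
  fixes V :: "'u set"
  assumes "finite V"
  shows "(\<Sum>v\<in>{v \<in> {..<length ts} \<rightarrow>\<^sub>E V. inj_on v {..<length ts}}. \<Phi> (map_of (zip (map v
      [0..<length ts]) ts))) =
    ev (placements ts V) \<Phi>"
  using assms
proof (induction ts arbitrary: V \<Phi>)
  case Nil
  then show ?case by simp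
next
  case (Cons t ts)
  let ?n = "length ts" and ?m = "\<lambda>v. map_of (zip (map v [0..<length ts]) ts)"
  have inj: "inj_on (case_nat p v) {..<Suc ?n} \<longleftrightarrow> p \<notin> v ` {..<?n} \<and> inj_on v {..<?n}" for p and v ::
    "nat \<Rightarrow> 'u"
  proof -
    have "{..<Suc ?n} = insert 0 (Suc ` {..<?n})"
      by (simp add: lessThan_Suc_eq_insert_0)
    moreover have "inj_on (case_nat p v) (Suc ` {..<?n}) \<longleftrightarrow> inj_on v {..<?n}"
      by (auto simp: inj_on_def)
    ultimately show ?thesis
      by (auto simp: image_image)
  qed
  have m: "map_of (zip (map (case_nat p v) [0..<Suc ?n]) (t # ts)) = (?m v)(p \<mapsto> t)" for p and v ::
    "nat \<Rightarrow> 'u"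
    by (simp add: upt_conv_Cons comp_def flip: map_Suc_upt del: upt_Suc)
  have fin: "finite ({..<Suc ?n} \<rightarrow>\<^sub>E V)" "finite ({..<?n} \<rightarrow>\<^sub>E V)"
    using Cons.prems by (simp_all add: finite_PiE)
  have "(\<Sum>v\<in>{v \<in> {..<Suc ?n} \<rightarrow>\<^sub>E V. inj_on v {..<Suc ?n}}. \<Phi> (map_of (zip (map v [0..<Suc ?n])
      (t # ts)))) =
      (\<Sum>p\<in>V. \<Sum>v\<in>{..<?n} \<rightarrow>\<^sub>E V. if p \<notin> v ` {..<?n} \<and> inj_on v {..<?n} then \<Phi> ((?m v)(p \<mapsto> t)) else 0)"
    unfolding sum.inter_filter[OF fin(1)] sum_PiE_Suc inj m by simp
  also have "\<dots> = (\<Sum>p\<in>V. \<Sum>v\<in>{v \<in> {..<?n} \<rightarrow>\<^sub>E (V - {p}). inj_on v {..<?n}}. \<Phi> ((?m v)(p \<mapsto> t)))"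
  proof (rule sum.cong[OF refl])
    fix p
    have "{v \<in> {..<?n} \<rightarrow>\<^sub>E (V - {p}). inj_on v {..<?n}} =
        {v \<in> {..<?n} \<rightarrow>\<^sub>E V. p \<notin> v ` {..<?n} \<and> inj_on v {..<?n}}"
      by (auto simp: PiE_iff)
    then show "(\<Sum>v\<in>{..<?n} \<rightarrow>\<^sub>E V.
        if p \<notin> v ` {..<?n} \<and> inj_on v {..<?n} then \<Phi> ((?m v)(p \<mapsto> t)) else 0) =
      (\<Sum>v\<in>{v \<in> {..<?n} \<rightarrow>\<^sub>E (V - {p}). inj_on v {..<?n}}. \<Phi> ((?m v)(p \<mapsto> t)))"
      by (simp only: sum.inter_filter[OF fin(2)])
  qed
  also have "\<dots> = (\<Sum>p\<in>V. ev (placements ts (V - {p})) (\<lambda>M. \<Phi> (M(p \<mapsto> t))))"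
    using Cons.prems by (intro sum.cong[OF refl] Cons.IH) simp
  also have "\<dots> = ev (placements (t # ts) V) \<Phi>"
    by simp
  finally show ?case by simp
qed

text \<open>For injective \<open>v\<close> the keys are distinct, so sorting the indices by
  \<open>v\<close> enumerates the chosen vertices increasingly, and the partial map determines the
  whole sequence of insertions.\<close>

lemma insert_all_insert_map:
  assumes "inj_on v {..<length ts}"
  shows "insert_all ts v \<sigma> = insert_map (map_of (zip (map v [0..<length ts]) ts)) \<sigma>"
proof -
  let ?n = "length ts"
  let ?M = "map_of (zip (map v [0..<?n]) ts)"
  let ?L = "sort_key v [0..<?n]"
  have M: "?M (v i) = Some (ts ! i)" if "i < ?n" for i
    using that assms by (intro map_of_is_SomeI) (auto simp: distinct_map atLeast0LessThan set_zip
      intro!: exI[of _ i])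
  have "sorted (map v ?L)" "distinct (map v ?L)"
    using assms by (simp_all add: distinct_map atLeast0LessThan)
  then have "sorted_list_of_set (set (map v ?L)) = map v ?L"
    by (rule sorted_list_of_set.idem_if_sorted_distinct)
  moreover have "set (map v ?L) = dom ?M"
    by (simp add: dom_map_of_zip)
  ultimately have L: "sorted_list_of_set (dom ?M) = map v ?L" by simp
  show ?thesis
    unfolding insert_all_def insert_map_def insert_seq_def L foldr_map comp_def
    by (intro foldr_cong refl) (simp add: M)
qed

lemma ev_insertions:
  assumes "finite V"
  shows "ev (insertions V ts \<sigma>) \<phi> = ev (placements ts V) (\<lambda>M. ev (insert_map M \<sigma>) \<phi>)"
  unfolding insertions_def sum_inj_placements[OF assms, symmetric]
  by (auto simp: insert_all_insert_map intro!: sum.cong)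

section \<open>Insertions into forests and into non-root vertices\<close>

definition ins_free :: "('k, 'x, 'd::finite) tree list \<Rightarrow> ('k, 'x, 'd) tree \<Rightarrow>
    ('k, 'x, 'd) tree \<Rightarrow>\<^sub>0 real" where
  "ins_free ts x = insertions (free_verts x) ts x"

definition ins_forest :: "('k, 'x, 'd::finite) tree list \<Rightarrow> ('k, 'x, 'd) edge list \<Rightarrow>
    ('k, 'x, 'd) edge list \<Rightarrow>\<^sub>0 real" where
  "ins_forest ts es =
      lin (\<lambda>M. insert_seq_forest (sorted_list_of_set (dom M)) M es) (placements ts
      (forest_free_verts es))"

definition ins_nonroot :: "('k, 'x, 'd::finite) tree list \<Rightarrow> ('k, 'x, 'd) tree \<Rightarrow>
    ('k, 'x, 'd) tree \<Rightarrow>\<^sub>0 real" where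
  "ins_nonroot ts x =
      lin (\<lambda>es. Poly_Mapping.single (Node (root_dec x) es) 1) (ins_forest ts (edges x))"

definition ins_child :: "bool \<Rightarrow> ('k, 'x, 'd::finite) tree list \<Rightarrow> ('k, 'x, 'd) tree \<Rightarrow>
    ('k, 'x, 'd) tree \<Rightarrow>\<^sub>0 real" where
  "ins_child b ts t = (if b then ins_nonroot ts t else ins_free ts t)"

lemma ev_ins_nonroot: "ev (ins_nonroot ts x) \<phi> = ev (ins_forest ts (edges x)) (\<lambda>es.
    \<phi> (Node (root_dec x) es))"
  by (simp add: ins_nonroot_def)

lemma insert_map_nonroot:
  assumes "finite (dom M)" "[] \<notin> dom M"
  shows "ev (insert_map M x) \<phi> =
      ev (insert_seq_forest (sorted_list_of_set (dom M)) M (edges x)) (\<lambda>es.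
      \<phi> (Node (root_dec x) es))"
  using assms by (cases x) (simp add: insert_map_def insert_seq_Node)

lemma ev_placements_ins_nonroot: "ev (placements ts (forest_free_verts (edges x))) (\<lambda>M.
    ev (insert_map M x) \<phi>) = ev (ins_nonroot ts x) \<phi>"
  unfolding ev_ins_nonroot ins_forest_def ev_lin
  by (intro ev_placements_cong insert_map_nonroot) auto

lemma ev_insertions_nonroot: "ev (insertions (free_verts x - {[]}) ts x) \<phi> =
    ev (ins_nonroot ts x) \<phi>"
  unfolding free_verts_nonroot ev_insertions[OF finite_forest_free_verts] by (rule
    ev_placements_ins_nonroot)

lemma ev_ins_child: "ev (ins_child (noise_edge c) ts (snd c)) \<phi> =
    ev (placements ts (edge_free_verts c)) (\<lambda>M. ev (insert_map M (snd c)) \<phi>)"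
  by (simp add: ins_child_def ins_free_def ev_insertions finite_free_verts edge_free_verts_noise
    edge_free_verts_kernel ev_placements_ins_nonroot)

lemma ins_forest_Nil: "ev (ins_forest ts []) \<psi> = (if ts = [] then \<psi> [] else 0)"
  by (simp add: ins_forest_def ev_placements_empty)

text \<open>Lexicographically, all vertices of the first tree precede those of later trees, so a
  sequence of insertions falls into two consecutive blocks. The vertex \<open>[]\<close>, fixed by
  \<open>shift_vertex\<close>, would come before both.\<close>

lemma sorted_list_of_set_vertices:
  assumes "finite A" "finite B" "[] \<notin> B"
  shows "sorted_list_of_set ((#) 0 ` A \<union> shift_vertex ` B) =
      map ((#) 0) (sorted_list_of_set A) @ map shift_vertex (sorted_list_of_set B)"
proof -
  let ?L = "map ((#) 0) (sorted_list_of_set A) @ map shift_vertex (sorted_list_of_set B)"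
  have shift_vertex_mono: "shift_vertex p \<le> shift_vertex q" if "p \<le> q" for p q
    using that by (auto simp: shift_vertex_def split: list.splits)
  have "sorted (map ((#) 0) (sorted_list_of_set A))"
    by (simp add: sorted_map sorted_wrt_mono_rel[of _ "(\<le>)"])
  moreover have "sorted (map shift_vertex (sorted_list_of_set B))"
    unfolding sorted_map by (rule sorted_wrt_mono_rel[of _ "(\<le>)"]) (simp_all add: shift_vertex_mono)
  moreover have "0 # p \<le> shift_vertex q" if "q \<in> B" for p q
    using that assms(3) by (cases q) auto
  ultimately have "sorted ?L"
    using assms by (auto simp: sorted_append)
  moreover have "inj_on shift_vertex C" for C
    using inj_shift_vertex by (rule inj_on_subset) simp
  then have "distinct ?L"
    by (auto simp: distinct_map shift_vertex_def split: list.splits)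
  moreover have "set ?L = (#) 0 ` A \<union> shift_vertex ` B"
    using assms by simp
  ultimately show ?thesis
    using sorted_list_of_set.idem_if_sorted_distinct by metis
qed

text \<open>The two blocks of insertions concern different trees and hence commute.\<close>

lemma ins_forest_Cons:
  "ev (ins_forest ts (c # cs)) \<psi> = ev2 (unshuffle ts) (\<lambda>a b.
      ev (ins_child (noise_edge c) a (snd c)) (\<lambda>t. ev (ins_forest b cs) (\<lambda>cs'.
      \<psi> ((fst c, t) # cs'))))"
proof -
  let ?V1 = "(#) (0 :: nat) ` edge_free_verts c" and ?V2 = "shift_vertex ` forest_free_verts cs" and
    ?W = "range ((#) (0 :: nat))"
  have notW: "shift_vertex p \<notin> ?W" for p
    by (auto simp: shift_vertex_def split: list.splits)
  then have ne: "0 # q \<noteq> shift_vertex p" for p q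
    by (metis rangeI)
  have *: "finite ?V1" "finite ?V2" "?V1 \<subseteq> ?W" "?V2 \<inter> ?W = {}"
    using notW by (auto simp: finite_edge_free_verts finite_forest_free_verts)
  let ?M = "\<lambda>M1 M2. merge ?W (push None ((#) 0) M1) (push None shift_vertex M2)"
  have m1: "?M M1 M2 (0 # p) = M1 p" for M1 M2 :: "vertex \<Rightarrow> ('a, 'b, 'c) tree option" and p
    by (simp add: inj_Cons)
  have m2: "?M M1 M2 (shift_vertex p) = M2 p" for M1 M2 :: "vertex \<Rightarrow> ('a, 'b, 'c) tree option" and p
    by (simp add: merge_def notW inj_shift_vertex)
  have step: "ev (insert_seq_forest (sorted_list_of_set (dom (?M M1 M2))) (?M M1 M2) (c # cs)) \<psi> =
      ev (insert_map M1 (snd c)) (\<lambda>t.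
        ev (insert_seq_forest (sorted_list_of_set (dom M2)) M2 cs) (\<lambda>cs'. \<psi> ((fst c, t) # cs')))"
    if "finite (dom M1)" "finite (dom M2)" "dom M2 \<subseteq> forest_free_verts cs"
    for M1 M2 :: "vertex \<Rightarrow> ('a, 'b, 'c) tree option"
  proof -
    have "dom (?M M1 M2) = (#) 0 ` dom M1 \<union> shift_vertex ` dom M2"
    proof (rule set_eqI)
      fix p :: vertex
      show "p \<in> dom (?M M1 M2) \<longleftrightarrow> p \<in> (#) 0 ` dom M1 \<union> shift_vertex ` dom M2"
      proof (cases "p \<in> ?W")
        case True
        then obtain q where "p = 0 # q" by auto
        then show ?thesis
          using m1[of M1 M2 q] ne by (auto simp: dom_def)
      next
        case False
        then show ?thesis
          using inj_shift_vertex by (auto simp: merge_def push_def dom_def split: if_splits)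
      qed
    qed
    moreover have nil: "[] \<notin> dom M2" using that(3) by auto
    ultimately have L: "sorted_list_of_set (dom (?M M1 M2)) =
        map ((#) 0) (sorted_list_of_set (dom M1)) @ map shift_vertex (sorted_list_of_set (dom M2))"
      using that by (simp add: sorted_list_of_set_vertices)
    show ?thesis
      unfolding L insert_seq_forest_append insert_map_def using nil that(2)
      by (simp add: insert_seq_forest_shift_vertex insert_seq_forest_0 m1 m2) (rule ev_swap)
  qed
  have "ev (ins_forest ts (c # cs)) \<psi> = ev2 (unshuffle ts) (\<lambda>a b.
      ev (placements a (edge_free_verts c)) (\<lambda>M1. ev (placements b (forest_free_verts cs)) (\<lambda>M2.
      ev (insert_seq_forest (sorted_list_of_set (dom (?M M1 M2))) (?M M1 M2) (c # cs)) \<psi>)))"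
    unfolding ins_forest_def ev_lin forest_free_verts.simps ev_placements_union[OF *]
      ev_placements_image[OF inj_Cons] ev_placements_image[OF inj_shift_vertex] ..
  also have "\<dots> = ev2 (unshuffle ts) (\<lambda>a b. ev (placements a (edge_free_verts c)) (\<lambda>M1.
      ev (placements b (forest_free_verts cs)) (\<lambda>M2. ev (insert_map M1 (snd c)) (\<lambda>t.
      ev (insert_seq_forest (sorted_list_of_set (dom M2)) M2 cs) (\<lambda>cs'. \<psi> ((fst c, t) # cs'))))))"
    by (intro ev_cong ev_placements_cong step)
  also have "\<dots> = ev2 (unshuffle ts) (\<lambda>a b. ev (ins_child (noise_edge c) a (snd c)) (\<lambda>t.
      ev (ins_forest b cs) (\<lambda>cs'. \<psi> ((fst c, t) # cs'))))"
    unfolding ev_ins_child ins_forest_def ev_lin by (simp only: ev_swap[of "placements _ _"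
      "insert_map _ _"])
  finally show ?thesis .
qed

text \<open>Injectivity admits at most one tree at the root. The flag says whether the root is free;
  it refers to the tree before any insertion.\<close>

definition ins_root :: "bool \<Rightarrow> ('k, 'x, 'd::finite) tree list \<Rightarrow> ('k, 'x, 'd) tree \<Rightarrow>
    ('k, 'x, 'd) tree \<Rightarrow>\<^sub>0 real" where
  "ins_root b ts \<rho> = (case ts of [] \<Rightarrow> Poly_Mapping.single \<rho> 1 | t # ts' \<Rightarrow> if b \<and> ts' =
      [] then \<rho> \<star>\<^sub>+ t else 0)"

text \<open>\<open>[]\<close> is the least vertex, so \<open>foldr\<close> performs the insertion at
  the root last: the whole tree, after all other insertions, acts on the inserted one.\<close>

lemma ev_ins_free: "ev (ins_free ts x) \<phi> = ev2 (unshuffle ts) (\<lambda>a b. ev (ins_nonroot b x) (\<lambda>\<rho>.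
    ev (ins_root (noise_free x) a \<rho>) \<phi>))"
proof -
  let ?R = "if noise_free x then {[]} else {} :: vertex set" and ?V = "forest_free_verts (edges x)"
  have *: "finite ?R" "finite ?V" "?R \<subseteq> {[]}" "?V \<inter> {[]} = {}"
    by (auto simp: finite_forest_free_verts)
  have free: "free_verts x = ?R \<union> ?V"
    by (cases x) (simp add: free_verts_Node)
  have 0: "merge {[]} Map.empty M = M" if "dom M \<subseteq> ?V" for M :: "vertex \<Rightarrow> ('a, 'b, 'c) tree option"
  proof -
    have "M [] = None" using that by (meson Nil_notin_forest_free_verts domIff subsetD)
    then show ?thesis by (auto simp: merge_def fun_eq_iff)
  qed
  have 1: "ev (insert_map (merge {[]} (Map.empty([] \<mapsto> t)) M) x) \<phi> = ev (insert_map M x) (\<lambda>\<rho>.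
      ev (\<rho> \<star>\<^sub>+ t) \<phi>)"
    if "finite (dom M)" "dom M \<subseteq> ?V" for M t
  proof -
    let ?M = "merge {[]} (Map.empty([] \<mapsto> t)) M"
    have nil: "[] \<notin> dom M" using that(2) by auto
    have dom: "dom ?M = insert [] (dom M)"
      by (auto simp: merge_def dom_def)
    have L: "sorted_list_of_set (dom ?M) = [] # sorted_list_of_set (dom M)"
    proof -
      have "sorted ([] # sorted_list_of_set (dom M))" "distinct ([] # sorted_list_of_set (dom M))"
        using nil that by simp_all
      from sorted_list_of_set.idem_if_sorted_distinct[OF this] show ?thesis
        using that dom by simp
    qed
    have "foldr (\<lambda>p. lin (insert_at (the (?M p)) p)) (sorted_list_of_set (dom M)) w =
        foldr (\<lambda>p. lin (insert_at (the (M p)) p)) (sorted_list_of_set (dom M)) w" for w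
      using nil that by (intro foldr_cong refl) (auto simp: merge_def)
    then show ?thesis
      unfolding insert_map_def L ev_insert_seq_Cons by (simp add: insert_seq_def ev_insert_at)
  qed
  have root: "ev (placements a ?R) (\<lambda>M1. ev (placements b ?V) (\<lambda>M2.
      ev (insert_map (merge {[]} M1 M2) x) \<phi>)) =
      ev (ins_nonroot b x) (\<lambda>\<rho>. ev (ins_root (noise_free x) a \<rho>) \<phi>)" for a b
  proof -
    have "ev (placements b ?V) (\<lambda>M2. ev (insert_map (merge {[]} Map.empty M2) x) \<phi>) =
        ev (ins_nonroot b x) \<phi>"
      unfolding ev_placements_ins_nonroot[symmetric] by (intro ev_placements_cong) (simp add: 0)
    moreover have "ev (placements b ?V) (\<lambda>M2.
        ev (insert_map (merge {[]} (Map.empty([] \<mapsto> t)) M2) x) \<phi>) =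
        ev (ins_nonroot b x) (\<lambda>\<rho>. ev (\<rho> \<star>\<^sub>+ t) \<phi>)" for t
      unfolding ev_placements_ins_nonroot[symmetric] by (intro ev_placements_cong 1)
    ultimately show ?thesis
      by (cases a) (simp_all add: ins_root_def ev_placements_empty)
  qed
  show ?thesis
    unfolding ins_free_def ev_insertions[OF finite_free_verts] unfolding free ev_placements_union[OF
      *] root ..
qed

section \<open>Insertions into the terms of a product\<close>

lemma ins_forest_append:
  "ev (ins_forest ts (as @ bs)) \<psi> = ev2 (unshuffle ts) (\<lambda>a b. ev (ins_forest a as) (\<lambda>as'.
      ev (ins_forest b bs) (\<lambda>bs'. \<psi> (as' @ bs'))))"
proof (induction as arbitrary: ts \<psi>)
  case Nil
  show ?case
    using unshuffle_unit[of ts "\<lambda>b. ev (ins_forest b bs) \<psi>"] by (simp add: ins_forest_Nil cong: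
      if_cong)
next
  case (Cons c cs)
  have "ev (ins_forest ts ((c # cs) @ bs)) \<psi> = ev2 (unshuffle ts) (\<lambda>a d. ev2 (unshuffle d) (\<lambda>u v.
      ev (ins_child (noise_edge c) a (snd c)) (\<lambda>t. ev (ins_forest u cs) (\<lambda>cs'.
      ev (ins_forest v bs) (\<lambda>bs'. \<psi> ((fst c, t) # cs' @ bs'))))))"
    by (simp add: ins_forest_Cons Cons ev_swap[of "ins_child _ _ _" "unshuffle _"])
  also have "\<dots> = ev2 (unshuffle ts) (\<lambda>d v. ev2 (unshuffle d) (\<lambda>a u.
      ev (ins_child (noise_edge c) a (snd c)) (\<lambda>t. ev (ins_forest u cs) (\<lambda>cs'.
      ev (ins_forest v bs) (\<lambda>bs'. \<psi> ((fst c, t) # cs' @ bs'))))))"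
    by (rule unshuffle_assoc)
  finally show ?case
    by (simp add: ins_forest_Cons)
qed

text \<open>The argument of \<open>star_forest_unshuffle\<close>, with the list of inserted trees in
  the role of \<open>x\<close>.\<close>

lemma ins_forest_unshuffle:
  "ev (ins_forest ts es) (\<lambda>es'. ev2 (unshuffle es') F) =
   ev2 (unshuffle ts) (\<lambda>a b. ev2 (unshuffle es) (\<lambda>as bs. ev (ins_forest a as) (\<lambda>as'.
     ev (ins_forest b bs) (\<lambda>bs'. F as' bs'))))"
proof (induction es arbitrary: ts F)
  case Nil
  show ?case
    using unshuffle_unit[of ts "\<lambda>b. if b = [] then F [] [] else 0"] by (simp add: ins_forest_Nil
      cong: if_cong)
next
  case (Cons c cs)
  let ?i = "\<lambda>a. ins_child (noise_edge c) a (snd c)" and ?c = "\<lambda>t. (fst c, t)"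
  have "ev (ins_forest ts (c # cs)) (\<lambda>es'. ev2 (unshuffle es') F) =
      ev2 (unshuffle ts) (\<lambda>a d. ev (?i a) (\<lambda>t. ev (ins_forest d cs) (\<lambda>cs'.
        ev2 (unshuffle cs') (\<lambda>as bs. F (?c t # as) bs)))) +
      ev2 (unshuffle ts) (\<lambda>a d. ev (?i a) (\<lambda>t. ev (ins_forest d cs) (\<lambda>cs'.
        ev2 (unshuffle cs') (\<lambda>as bs. F as (?c t # bs)))))"
    by (simp add: ins_forest_Cons ev_fun_add)
  also have "ev2 (unshuffle ts) (\<lambda>a d. ev (?i a) (\<lambda>t. ev (ins_forest d cs) (\<lambda>cs'.
      ev2 (unshuffle cs') (\<lambda>as bs. F (?c t # as) bs)))) =
      ev2 (unshuffle ts) (\<lambda>a d. ev (?i a) (\<lambda>t. ev2 (unshuffle d) (\<lambda>u v. ev2 (unshuffle cs) (\<lambda>as bs.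
        ev (ins_forest u as) (\<lambda>as'. ev (ins_forest v bs) (\<lambda>bs'. F (?c t # as') bs'))))))"
    by (intro ev_cong Cons)
  also have "\<dots> = ev2 (unshuffle ts) (\<lambda>a d. ev2 (unshuffle d) (\<lambda>u v. ev2 (unshuffle cs) (\<lambda>as bs.
      ev (?i a) (\<lambda>t. ev (ins_forest u as) (\<lambda>as'. ev (ins_forest v bs) (\<lambda>bs'.
      F (?c t # as') bs'))))))"
    by (simp only: ev_swap[of "ins_child _ _ _" "unshuffle _"])
  also have "\<dots> = ev2 (unshuffle ts) (\<lambda>d v. ev2 (unshuffle d) (\<lambda>a u. ev2 (unshuffle cs) (\<lambda>as bs.
      ev (?i a) (\<lambda>t. ev (ins_forest u as) (\<lambda>as'. ev (ins_forest v bs) (\<lambda>bs'.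
      F (?c t # as') bs'))))))"
    by (rule unshuffle_assoc)
  also have "\<dots> = ev2 (unshuffle ts) (\<lambda>d v. ev2 (unshuffle cs) (\<lambda>as bs. ev2 (unshuffle d) (\<lambda>a u.
      ev (?i a) (\<lambda>t. ev (ins_forest u as) (\<lambda>as'. ev (ins_forest v bs) (\<lambda>bs'.
      F (?c t # as') bs'))))))"
    by (simp only: ev_swap[of "unshuffle cs" "unshuffle _"])
  also have "\<dots> = ev2 (unshuffle ts) (\<lambda>a b. ev2 (unshuffle cs) (\<lambda>as bs.
      ev (ins_forest a (c # as)) (\<lambda>as'. ev (ins_forest b bs) (\<lambda>bs'. F as' bs'))))"
    by (simp add: ins_forest_Cons)
  also have "ev2 (unshuffle ts) (\<lambda>a d. ev (?i a) (\<lambda>t. ev (ins_forest d cs) (\<lambda>cs'.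
      ev2 (unshuffle cs') (\<lambda>as bs. F as (?c t # bs))))) =
      ev2 (unshuffle ts) (\<lambda>a d. ev (?i a) (\<lambda>t. ev2 (unshuffle d) (\<lambda>u v. ev2 (unshuffle cs) (\<lambda>as bs.
        ev (ins_forest u as) (\<lambda>as'. ev (ins_forest v bs) (\<lambda>bs'. F as' (?c t # bs')))))))"
    by (intro ev_cong Cons)
  also have "\<dots> = ev2 (unshuffle ts) (\<lambda>a d. ev2 (unshuffle d) (\<lambda>u v. ev2 (unshuffle cs) (\<lambda>as bs.
      ev (?i a) (\<lambda>t. ev (ins_forest u as) (\<lambda>as'. ev (ins_forest v bs) (\<lambda>bs'.
      F as' (?c t # bs')))))))"
    by (simp only: ev_swap[of "ins_child _ _ _" "unshuffle _"])
  also have "\<dots> = ev2 (unshuffle ts) (\<lambda>u d. ev2 (unshuffle d) (\<lambda>a v. ev2 (unshuffle cs) (\<lambda>as bs.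
      ev (?i a) (\<lambda>t. ev (ins_forest u as) (\<lambda>as'. ev (ins_forest v bs) (\<lambda>bs'.
      F as' (?c t # bs')))))))"
    by (rule unshuffle.left_commute)
  also have "\<dots> = ev2 (unshuffle ts) (\<lambda>u d. ev2 (unshuffle cs) (\<lambda>as bs. ev (ins_forest u as) (\<lambda>as'.
      ev2 (unshuffle d) (\<lambda>a v. ev (?i a) (\<lambda>t. ev (ins_forest v bs) (\<lambda>bs'. F as' (?c t # bs')))))))"
    by (simp only: ev_swap[of "unshuffle _" "unshuffle cs"] ev_swap[of "ins_child _ _ _" "ins_forest
        _ _"] ev_swap[of "unshuffle _" "ins_forest _ _"])
  also have "\<dots> = ev2 (unshuffle ts) (\<lambda>a b. ev2 (unshuffle cs) (\<lambda>as bs. ev (ins_forest a as) (\<lambda>as'.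
      ev (ins_forest b (c # bs)) (\<lambda>bs'. F as' bs'))))"
    by (simp add: ins_forest_Cons)
  finally show ?case
    by (simp add: ev_fun_add)
qed

lemma ins_forest_attach:
  "ev (ins_forest ts es) (\<lambda>es'. ev2 (attach es' n) (\<lambda>n' zs. \<psi> n' zs)) =
   ev2 (attach es n) (\<lambda>n' es'. ev (ins_forest ts es') (\<lambda>zs. \<psi> n' zs))"
proof (induction es arbitrary: ts \<psi>)
  case (Cons c cs)
  let ?i = "\<lambda>a. ins_child (noise_edge c) a (snd c)"
  have "ev (ins_forest ts (c # cs)) (\<lambda>es'. ev2 (attach es' n) (\<lambda>n' zs. \<psi> n' zs)) =
    ev2 (unshuffle ts) (\<lambda>a b. ev (?i a) (\<lambda>t. ev (ins_forest b cs) (\<lambda>cs'. ev2 (attach cs' n) (\<lambda>n' zs.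
      ev2 (mi_coprod n') (\<lambda>l r. of_bool (l \<le> snd (fst c)) * \<psi> r ((fst (lower c l), t) # zs))))))"
    by (simp add: ins_forest_Cons lower_Pair)
  also have "\<dots> = ev2 (unshuffle ts) (\<lambda>a b. ev (?i a) (\<lambda>t. ev2 (attach cs n) (\<lambda>n' cs'.
      ev (ins_forest b cs') (\<lambda>zs. ev2 (mi_coprod n') (\<lambda>l r.
      of_bool (l \<le> snd (fst c)) * \<psi> r ((fst (lower c l), t) # zs))))))"
    by (intro ev_cong Cons)
  also have "\<dots> = ev2 (attach cs n) (\<lambda>n' cs'. ev2 (mi_coprod n') (\<lambda>l r. ev2 (unshuffle ts) (\<lambda>a b.
      ev (?i a) (\<lambda>t. ev (ins_forest b cs') (\<lambda>zs.
      of_bool (l \<le> snd (fst c)) * \<psi> r ((fst (lower c l), t) # zs))))))"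
    by (simp only: ev_swap[of _ "attach cs n"] ev_swap[of _ "mi_coprod _"])
  also have "\<dots> = ev2 (attach (c # cs) n) (\<lambda>n' es'. ev (ins_forest ts es') (\<lambda>zs. \<psi> n' zs))"
    by (simp add: ins_forest_Cons ev_fun_mult)
  finally show ?case .
qed (simp add: ins_forest_Nil)

text \<open>Non-root insertions see only the branches, so the root can be split before them if the
  trees to be inserted are distributed along with the branches.\<close>

lemma ins_nonroot_coprod:
  "ev (ins_nonroot ts x) (\<lambda>x'. ev2 (coprod x') F) =
   ev2 (coprod x) (\<lambda>x1 x2. ev2 (unshuffle ts) (\<lambda>a b. ev (ins_nonroot a x1) (\<lambda>x1'.
     ev (ins_nonroot b x2) (\<lambda>x2'. F x1' x2'))))"
proof -
  let ?n = "root_dec x" and ?es = "edges x"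
  have "ev (ins_nonroot ts x) (\<lambda>x'. ev2 (coprod x') F) =
      ev2 (mi_coprod ?n) (\<lambda>p q. ev (ins_forest ts ?es) (\<lambda>es'. ev2 (unshuffle es') (\<lambda>a b.
        F (Node p a) (Node q b))))"
    unfolding ev_ins_nonroot ev_coprod tree.sel fst_conv snd_conv by (rule ev_swap)
  also have "\<dots> = ev2 (mi_coprod ?n) (\<lambda>p q. ev2 (unshuffle ts) (\<lambda>a b. ev2 (unshuffle ?es) (\<lambda>as bs.
      ev (ins_forest a as) (\<lambda>as'. ev (ins_forest b bs) (\<lambda>bs'. F (Node p as') (Node q bs'))))))"
    by (intro ev_cong ins_forest_unshuffle)
  also have "\<dots> = ev2 (coprod x) (\<lambda>x1 x2. ev2 (unshuffle ts) (\<lambda>a b. ev (ins_nonroot a x1) (\<lambda>x1'.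
      ev (ins_nonroot b x2) (\<lambda>x2'. F x1' x2'))))"
    unfolding ev_ins_nonroot ev_coprod tree.sel fst_conv snd_conv by (simp only: ev_swap[of
      "unshuffle ts" "unshuffle _"])
  finally show ?thesis .
qed

lemma ins_nonroot_unit:
  "ev (ins_nonroot ts x) (\<lambda>z. if z = Node 0 [] then c else 0) = (if x = Node 0 [] \<and> ts =
      [] then c else 0)"
  by (cases x; cases "edges x") (simp_all add: ev_ins_nonroot ins_forest_Nil ins_forest_Cons cong:
    if_cong)

section \<open>Supports: edge labels and noise edges at the root\<close>

lemma keys_unshuffle: "p \<in> Poly_Mapping.keys (unshuffle xs) \<Longrightarrow> set (fst p) \<subseteq> set xs \<and> set
    (snd p) \<subseteq> set xs"
proof (induction xs arbitrary: p)
  case (Cons x xs)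
  have "Poly_Mapping.keys (unshuffle (x # xs)) \<subseteq> {p. set (fst p) \<subseteq> set (x # xs) \<and> set (snd p) \<subseteq> set
      (x # xs)}"
  proof (rule keys_subsetI)
    fix \<phi> :: "'a list \<times> 'a list \<Rightarrow> real"
    assume \<phi>: "\<And>b. b \<in> {p. set (fst p) \<subseteq> set (x # xs) \<and> set (snd p) \<subseteq> set (x # xs)} \<Longrightarrow> \<phi> b = 0"
    have "\<phi> (x # fst p, snd p) = 0 \<and> \<phi> (fst p, x # snd p) = 0" if "p \<in> Poly_Mapping.keys
        (unshuffle xs)" for p
      using Cons.IH[OF that] by (auto intro!: \<phi>)
    then show "ev (unshuffle (x # xs)) \<phi> = 0"
      by (auto intro!: ev_eq_0)
  qed
  with Cons.prems show ?case by auto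
qed simp

lemma keys_coprod_edges:
  "p \<in> Poly_Mapping.keys (coprod x) \<Longrightarrow> set (edges (fst p)) \<subseteq> set (edges x) \<and> set (edges
      (snd p)) \<subseteq> set (edges x)"
proof -
  have "Poly_Mapping.keys (coprod x) \<subseteq> {p. set (edges (fst p)) \<subseteq> set (edges x) \<and> set (edges
      (snd p)) \<subseteq> set (edges x)}"
    by (rule keys_subsetI) (auto simp: ev_coprod dest!: keys_unshuffle intro!: ev_eq_0)
  then show "p \<in> Poly_Mapping.keys (coprod x) \<Longrightarrow> set (edges (fst p)) \<subseteq> set (edges x) \<and> set (edges
      (snd p)) \<subseteq> set (edges x)"
    by auto
qed

lemma keys_coprod_noise_free:
  "p \<in> Poly_Mapping.keys (coprod x) \<Longrightarrow> noise_free x \<Longrightarrow> noise_free (fst p) \<and> noise_free (snd p)"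
  using keys_coprod_edges[of p x] by (auto simp: noise_free_def)

lemma keys_attach: "p \<in> Poly_Mapping.keys (attach es n) \<Longrightarrow> map noise_edge (snd p) =
    map noise_edge es"
proof -
  have "Poly_Mapping.keys (attach es n) \<subseteq> {p. map noise_edge (snd p) = map noise_edge es}"
  proof (induction es)
    case (Cons e es)
    show ?case
      by (rule keys_subsetI) (use Cons in \<open>auto intro!: ev_eq_0\<close>)
  qed auto
  then show "p \<in> Poly_Mapping.keys (attach es n) \<Longrightarrow> map noise_edge (snd p) = map noise_edge es"
    by auto
qed

lemma keys_star_forest: "zs \<in> Poly_Mapping.keys (star_forest x es) \<Longrightarrow> map fst zs = map fst es"
proof -
  have "Poly_Mapping.keys (star_forest x es) \<subseteq> {zs. map fst zs = map fst es}"
  proof (induction es arbitrary: x)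
    case (Cons e es)
    show ?case
      by (rule keys_subsetI) (auto simp: star_forest_Cons ev_star_edge_star_child intro!: ev_eq_0
        dest!: subsetD[OF Cons])
  qed (auto simp: star_forest_def ev_distr_root_empty intro!: keys_subsetI)
  then show "zs \<in> Poly_Mapping.keys (star_forest x es) \<Longrightarrow> map fst zs = map fst es"
    by auto
qed

lemma noise_edge_map_fst: "map fst es = map fst es' \<Longrightarrow> map noise_edge es = map noise_edge es'"
  by (induction es es' rule: list_induct2') (auto simp: noise_edge_def)

lemma noise_free_map: "noise_free x \<longleftrightarrow> True \<notin> set (map noise_edge (edges x))"
  by (auto simp: noise_free_def)

text \<open>Attached edges stem from the noise-free root of \<open>x\<close>, and the action keeps
  the labels of the edges of \<open>y\<close>. Hence the root of \<open>y\<close> is free for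
  insertion before the product exactly if it is afterwards.\<close>

lemma keys_star_noise_free:
  assumes "z \<in> Poly_Mapping.keys (x \<star>\<^sub>+ y)" "noise_free x"
  shows "noise_free z = noise_free y"
proof -
  obtain n ys where y: "y = Node n ys" by (cases y)
  have "Poly_Mapping.keys (x \<star>\<^sub>+ y) \<subseteq> {z. noise_free z = noise_free y}"
  proof (rule keys_subsetI)
    fix \<phi> :: "('a, 'b, 'c) tree \<Rightarrow> real"
    assume \<phi>: "\<And>z. z \<in> {z. noise_free z = noise_free y} \<Longrightarrow> \<phi> z = 0"
    have "\<phi> (Node m (es' @ ys')) = 0"
      if "p \<in> Poly_Mapping.keys (coprod x)" "q \<in> Poly_Mapping.keys (attach (edges (fst p)) n)"
        "es' = snd q" "ys' \<in> Poly_Mapping.keys (star_forest (snd p) ys)" for p q m es' ys'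
    proof (rule \<phi>)
      have "noise_free (fst p)"
        using keys_coprod_noise_free[OF that(1) assms(2)] by simp
      then show "Node m (es' @ ys') \<in> {z. noise_free z = noise_free y}"
        using keys_attach[OF that(2)] noise_edge_map_fst[OF keys_star_forest[OF that(4)]]
        by (simp add: noise_free_map y that(3) del: set_map)
    qed
    then show "ev (x \<star>\<^sub>+ y) \<phi> = 0"
      unfolding y star_Node by (intro ev_eq_0) blast
  qed
  with assms(1) show ?thesis by auto
qed

text \<open>Inserting at the root is multiplication from the right, so by associativity it commutes
  with the action of \<open>x\<close> from the left.\<close>

lemma star_ins_root: "ev (x \<star>\<^sub>+ y) (\<lambda>\<rho>. ev (ins_root b ts \<rho>) \<phi>) = ev (ins_root b ts y) (\<lambda>\<rho>.
    ev (x \<star>\<^sub>+ \<rho>) \<phi>)"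
  by (cases ts; cases b; cases "tl ts") (simp_all add: ins_root_def star_assoc)

text \<open>At the root of \<open>y\<close> an insertion of \<open>t\<close> is the action of the whole tree on \<open>t\<close>, so that there
  the identity reduces to associativity.\<close>

lemma star_ins_free_aux:
  "(\<forall>x ts \<phi>. noise_free x \<longrightarrow> ev (x \<star>\<^sub>+ y) (\<lambda>z. ev (ins_free ts z) \<phi>) =
      ev2 (unshuffle ts) (\<lambda>a b. ev (ins_nonroot a x) (\<lambda>x'. ev (ins_free b y) (\<lambda>y'.
        ev (x' \<star>\<^sub>+ y') \<phi>)))) \<and>
   (\<forall>x ts \<psi>. noise_free x \<longrightarrow> ev (star_forest x (edges y)) (\<lambda>ys. ev (ins_forest ts ys) \<psi>) =
      ev2 (unshuffle ts) (\<lambda>a b. ev (ins_nonroot a x) (\<lambda>x'. ev (ins_forest b (edges y)) (\<lambda>ys.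
        ev (star_forest x' ys) \<psi>))))"
proof (induction y rule: measure_induct_rule[of size])
  case (less y)
  obtain n ys where y: "y = Node n ys" by (cases y)
  \<comment> \<open>Above a noise edge both the action and the insertions avoid the end point, which
    is the forest half of the induction hypothesis.\<close>
  have child: "ev (star_child k x (snd c)) (\<lambda>t. ev (ins_child k ts t) \<phi>) =
      ev2 (unshuffle ts) (\<lambda>a b. ev (ins_nonroot a x) (\<lambda>x'. ev (ins_child k b (snd c)) (\<lambda>t.
        ev (star_child k x' t) \<phi>)))"
    if "c \<in> set ys" "noise_free x" for c k x ts \<phi>
  proof -
    have "size (snd c) < size y" using size_edge[OF that(1)] y by simp
    note IH = less[OF this]
    show ?thesis
      using that(2) by (cases k) (simp_all add: star_child_def ins_child_def ev_ins_nonroot IH)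
  qed
  have forest: "ev (star_forest x us) (\<lambda>zs. ev (ins_forest ts zs) \<psi>) =
      ev2 (unshuffle ts) (\<lambda>a b. ev (ins_nonroot a x) (\<lambda>x'. ev (ins_forest b us) (\<lambda>zs.
        ev (star_forest x' zs) \<psi>)))"
    if "set us \<subseteq> set ys" "noise_free x" for us x ts \<psi>
    using that
  proof (induction us arbitrary: x ts \<psi>)
    case Nil
    have "ev (ins_nonroot a x) (\<lambda>x'. ev (ins_forest b []) (\<lambda>zs. ev (star_forest x' zs) \<psi>)) =
        (if a = [] then if b = [] \<and> x = Node 0 [] then \<psi> [] else 0 else 0)" for a b
      by (cases "b = []") (simp_all add: ins_forest_Nil star_forest_Nil ins_nonroot_unit)
    then have "ev2 (unshuffle ts) (\<lambda>a b. ev (ins_nonroot a x) (\<lambda>x'. ev (ins_forest b []) (\<lambda>zs.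
        ev (star_forest x' zs) \<psi>))) =
        ev2 (unshuffle ts) (\<lambda>a b. if a = [] then if b = [] \<and> x = Node 0 [] then \<psi> [] else 0 else 0)"
      by simp
    also have "\<dots> = (if ts = [] \<and> x = Node 0 [] then \<psi> [] else 0)"
      by (rule unshuffle_unit)
    finally show ?case by (simp add: ins_forest_Nil star_forest_Nil)
  next
    case (Cons c cs)
    let ?k = "noise_edge c" and ?t = "snd c" and ?c = "\<lambda>t. (fst c, t)"
    have c: "c \<in> set ys" "set cs \<subseteq> set ys" using Cons.prems by auto
    have "ev (star_forest x (c # cs)) (\<lambda>zs. ev (ins_forest ts zs) \<psi>) =
        ev2 (coprod x) (\<lambda>x1 x2. ev (star_child ?k x1 ?t) (\<lambda>t. ev (star_forest x2 cs) (\<lambda>zs.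
          ev2 (unshuffle ts) (\<lambda>a b. ev (ins_child ?k a t) (\<lambda>t'. ev (ins_forest b zs) (\<lambda>zs'.
          \<psi> (?c t' # zs')))))))"
      by (simp add: star_forest_Cons ev_star_edge_star_child ins_forest_Cons)
    also have "\<dots> = ev2 (coprod x) (\<lambda>x1 x2. ev2 (unshuffle ts) (\<lambda>a b. ev (star_child ?k x1 ?t) (\<lambda>t.
        ev (ins_child ?k a t) (\<lambda>t'. ev (star_forest x2 cs) (\<lambda>zs. ev (ins_forest b zs) (\<lambda>zs'.
        \<psi> (?c t' # zs')))))))"
      by (simp only: ev_swap[of _ "unshuffle ts"] ev_swap[of "star_forest _ _" "ins_child _ _ _"])
    also have "\<dots> = ev2 (coprod x) (\<lambda>x1 x2. ev2 (unshuffle ts) (\<lambda>a b. ev2 (unshuffle a) (\<lambda>a1 a2.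
        ev (ins_nonroot a1 x1) (\<lambda>x1'. ev (ins_child ?k a2 ?t) (\<lambda>t. ev (star_child ?k x1' t) (\<lambda>t'.
        ev2 (unshuffle b) (\<lambda>b1 b2. ev (ins_nonroot b1 x2) (\<lambda>x2'. ev (ins_forest b2 cs) (\<lambda>zs.
        ev (star_forest x2' zs) (\<lambda>zs'. \<psi> (?c t' # zs')))))))))))"
    \<comment> \<open>The hypotheses ask for noise-free factors, hence the restriction to the
      support of \<open>coprod x\<close>, both legs of which are noise-free.\<close>
    proof (intro ev_cong)
      fix p q
      assume "p \<in> Poly_Mapping.keys (coprod x)"
      then have nf: "noise_free (fst p)" "noise_free (snd p)"
        using keys_coprod_noise_free[OF _ Cons.prems(2)] by blast+
      show "ev (star_child ?k (fst p) ?t) (\<lambda>t. ev (ins_child ?k (fst q) t) (\<lambda>t'.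
          ev (star_forest (snd p) cs) (\<lambda>zs. ev (ins_forest (snd q) zs) (\<lambda>zs'. \<psi> (?c t' # zs'))))) =
        ev2 (unshuffle (fst q)) (\<lambda>a1 a2. ev (ins_nonroot a1 (fst p)) (\<lambda>x1'.
          ev (ins_child ?k a2 ?t) (\<lambda>t. ev (star_child ?k x1' t) (\<lambda>t'.
          ev2 (unshuffle (snd q)) (\<lambda>b1 b2. ev (ins_nonroot b1 (snd p)) (\<lambda>x2'.
          ev (ins_forest b2 cs) (\<lambda>zs. ev (star_forest x2' zs) (\<lambda>zs'. \<psi> (?c t' # zs')))))))))"
        unfolding child[OF c(1) nf(1)] Cons.IH[OF c(2) nf(2)] ..
    qed
    also have "\<dots> = ev2 (coprod x) (\<lambda>x1 x2. ev2 (unshuffle ts) (\<lambda>a b. ev2 (unshuffle a) (\<lambda>a1 a2.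
        ev2 (unshuffle b) (\<lambda>b1 b2. ev (ins_nonroot a1 x1) (\<lambda>x1'. ev (ins_nonroot b1 x2) (\<lambda>x2'.
        ev (ins_child ?k a2 ?t) (\<lambda>t. ev (ins_forest b2 cs) (\<lambda>zs. ev (star_child ?k x1' t) (\<lambda>t'.
        ev (star_forest x2' zs) (\<lambda>zs'. \<psi> (?c t' # zs')))))))))))"
      by (simp only: ev_swap[of "star_child _ _ _" "unshuffle _"] ev_swap[of "ins_child _ _ _"
        "unshuffle _"] ev_swap[of "ins_nonroot _ _" "unshuffle _"]
         ev_swap[of "star_child _ _ _" "ins_nonroot _ _"] ev_swap[of "ins_child _ _ _" "ins_nonroot
             _ _"] ev_swap[of "star_child _ _ _" "ins_forest _ _"])
    \<comment> \<open>The trees for the two parts of \<open>x\<close> are brought together, and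
      likewise those for \<open>?t\<close> and \<open>cs\<close>.\<close>
    also have "\<dots> = ev2 (coprod x) (\<lambda>x1 x2. ev2 (unshuffle ts) (\<lambda>a b. ev2 (unshuffle a) (\<lambda>a1 b1.
        ev2 (unshuffle b) (\<lambda>a2 b2. ev (ins_nonroot a1 x1) (\<lambda>x1'. ev (ins_nonroot b1 x2) (\<lambda>x2'.
        ev (ins_child ?k a2 ?t) (\<lambda>t. ev (ins_forest b2 cs) (\<lambda>zs. ev (star_child ?k x1' t) (\<lambda>t'.
        ev (star_forest x2' zs) (\<lambda>zs'. \<psi> (?c t' # zs')))))))))))"
      by (intro ev_cong unshuffle.interchange)
    also have "\<dots> = ev2 (unshuffle ts) (\<lambda>a b. ev2 (unshuffle a) (\<lambda>a1 b1. ev2 (unshuffle b) (\<lambda>a2 b2.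
        ev2 (coprod x) (\<lambda>x1 x2. ev (ins_nonroot a1 x1) (\<lambda>x1'. ev (ins_nonroot b1 x2) (\<lambda>x2'.
        ev (ins_child ?k a2 ?t) (\<lambda>t. ev (ins_forest b2 cs) (\<lambda>zs. ev (star_child ?k x1' t) (\<lambda>t'.
        ev (star_forest x2' zs) (\<lambda>zs'. \<psi> (?c t' # zs')))))))))))"
      by (simp only: ev_swap[of "coprod x" "unshuffle _"])
    also have "\<dots> = ev2 (unshuffle ts) (\<lambda>a b. ev2 (unshuffle b) (\<lambda>a2 b2. ev2 (unshuffle a) (\<lambda>a1 b1.
        ev2 (coprod x) (\<lambda>x1 x2. ev (ins_nonroot a1 x1) (\<lambda>x1'. ev (ins_nonroot b1 x2) (\<lambda>x2'.
        ev (ins_child ?k a2 ?t) (\<lambda>t. ev (ins_forest b2 cs) (\<lambda>zs. ev (star_child ?k x1' t) (\<lambda>t'.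
        ev (star_forest x2' zs) (\<lambda>zs'. \<psi> (?c t' # zs')))))))))))"
      by (rule ev_cong, rule ev_swap)
    also have "\<dots> = ev2 (unshuffle ts) (\<lambda>a b. ev2 (unshuffle b) (\<lambda>a2 b2. ev2 (coprod x) (\<lambda>x1 x2.
        ev2 (unshuffle a) (\<lambda>a1 b1. ev (ins_nonroot a1 x1) (\<lambda>x1'. ev (ins_nonroot b1 x2) (\<lambda>x2'.
        ev (ins_child ?k a2 ?t) (\<lambda>t. ev (ins_forest b2 cs) (\<lambda>zs. ev (star_child ?k x1' t) (\<lambda>t'.
        ev (star_forest x2' zs) (\<lambda>zs'. \<psi> (?c t' # zs')))))))))))"
      by (simp only: ev_swap[of "coprod x" "unshuffle _"])
    \<comment> \<open>Insertions into both parts of \<open>x\<close> combine to insertions into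
      \<open>x\<close>, whose result is split afterwards.\<close>
    also have "\<dots> = ev2 (unshuffle ts) (\<lambda>a b. ev2 (unshuffle b) (\<lambda>a2 b2. ev (ins_nonroot a x) (\<lambda>x'.
        ev2 (coprod x') (\<lambda>x1' x2'. ev (ins_child ?k a2 ?t) (\<lambda>t. ev (ins_forest b2 cs) (\<lambda>zs.
        ev (star_child ?k x1' t) (\<lambda>t'. ev (star_forest x2' zs) (\<lambda>zs'. \<psi> (?c t' # zs')))))))))"
      by (intro ev_cong ins_nonroot_coprod[symmetric])
    also have "\<dots> = ev2 (unshuffle ts) (\<lambda>a b. ev (ins_nonroot a x) (\<lambda>x'.
        ev (ins_forest b (c # cs)) (\<lambda>zs. ev (star_forest x' zs) \<psi>)))"
      unfolding ins_forest_Cons star_forest_Cons ev_star_edge_star_child noise_edge_Pair fst_conv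
        snd_conv
      by (simp only: ev_swap[of "unshuffle _" "ins_nonroot _ _"] ev_swap[of "ins_child _ _ _"
        "coprod _"] ev_swap[of "ins_forest _ _" "coprod _"])
    finally show ?case .
  qed
  \<comment> \<open>Non-root insertions into a product hit branches of \<open>x\<close> attached at
    the root, branches of \<open>x\<close> in the forest, or \<open>ys\<close>. Coassociativity of
    \<open>unshuffle\<close> gathers the first two kinds.\<close>
  have nonroot: "ev (x \<star>\<^sub>+ y) (\<lambda>z. ev (ins_nonroot ts z) \<phi>) =
      ev2 (unshuffle ts) (\<lambda>a b. ev (ins_nonroot a x) (\<lambda>x'. ev (ins_nonroot b y) (\<lambda>y'.
        ev (x' \<star>\<^sub>+ y') \<phi>)))"
    if "noise_free x" for x ts \<phi>
  proof -
    have "ev (x \<star>\<^sub>+ y) (\<lambda>z. ev (ins_nonroot ts z) \<phi>) =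
        ev2 (coprod x) (\<lambda>x1 x2. ev2 (attach (edges x1) n) (\<lambda>n' es. ev (star_forest x2 ys) (\<lambda>zs.
          ev2 (unshuffle ts) (\<lambda>a b. ev (ins_forest a es) (\<lambda>es'. ev (ins_forest b zs) (\<lambda>zs'.
          \<phi> (Node (n' + root_dec x1) (es' @ zs'))))))))"
      by (simp add: y star_Node ev_ins_nonroot ins_forest_append)
    also have "\<dots> = ev2 (coprod x) (\<lambda>x1 x2. ev2 (unshuffle ts) (\<lambda>a b.
        ev2 (attach (edges x1) n) (\<lambda>n' es. ev (ins_forest a es) (\<lambda>es'. ev (star_forest x2 ys) (\<lambda>zs.
        ev (ins_forest b zs) (\<lambda>zs'. \<phi> (Node (n' + root_dec x1) (es' @ zs'))))))))"
      by (simp only: ev_swap[of _ "unshuffle ts"] ev_swap[of "star_forest _ _" "ins_forest _ _"])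
    also have "\<dots> = ev2 (coprod x) (\<lambda>x1 x2. ev2 (unshuffle ts) (\<lambda>a b.
        ev (ins_forest a (edges x1)) (\<lambda>es. ev2 (attach es n) (\<lambda>n' es'. ev2 (unshuffle b) (\<lambda>c d.
        ev (ins_nonroot c x2) (\<lambda>x2'. ev (ins_forest d ys) (\<lambda>zs. ev (star_forest x2' zs) (\<lambda>zs'.
        \<phi> (Node (n' + root_dec x1) (es' @ zs')))))))))) "
    proof (intro ev_cong)
      fix p q
      assume "p \<in> Poly_Mapping.keys (coprod x)"
      then have nf: "noise_free (snd p)"
        using keys_coprod_noise_free[OF _ that] by blast
      show "ev2 (attach (edges (fst p)) n) (\<lambda>n' es. ev (ins_forest (fst q) es) (\<lambda>es'.
          ev (star_forest (snd p) ys) (\<lambda>zs. ev (ins_forest (snd q) zs) (\<lambda>zs'.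
          \<phi> (Node (n' + root_dec (fst p)) (es' @ zs')))))) =
        ev (ins_forest (fst q) (edges (fst p))) (\<lambda>es. ev2 (attach es n) (\<lambda>n' es'.
          ev2 (unshuffle (snd q)) (\<lambda>c d. ev (ins_nonroot c (snd p)) (\<lambda>x2'.
          ev (ins_forest d ys) (\<lambda>zs. ev (star_forest x2' zs) (\<lambda>zs'.
          \<phi> (Node (n' + root_dec (fst p)) (es' @ zs'))))))))"
        unfolding forest[OF subset_refl nf] by (rule ins_forest_attach[symmetric])
    qed
    also have "\<dots> = ev2 (unshuffle ts) (\<lambda>a b. ev2 (unshuffle b) (\<lambda>c d. ev2 (coprod x) (\<lambda>x1 x2.
        ev (ins_nonroot a x1) (\<lambda>x1'. ev (ins_nonroot c x2) (\<lambda>x2'. ev (ins_forest d ys) (\<lambda>zs.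
        ev2 (attach (edges x1') n) (\<lambda>n' es'. ev (star_forest x2' zs) (\<lambda>zs'.
        \<phi> (Node (n' + root_dec x1') (es' @ zs'))))))))))"
      unfolding ev_ins_nonroot[of _ "fst _"] tree.sel
      by (simp only: ev_swap[of "coprod _" "unshuffle _"] ev_swap[of "attach _ _" "unshuffle _"]
        ev_swap[of "ins_forest _ _" "unshuffle _"]
        ev_swap[of "attach _ _" "ins_nonroot _ _"] ev_swap[of "attach _ _" "ins_forest _ _"])
    also have "\<dots> = ev2 (unshuffle ts) (\<lambda>b d. ev2 (unshuffle b) (\<lambda>a c. ev2 (coprod x) (\<lambda>x1 x2.
        ev (ins_nonroot a x1) (\<lambda>x1'. ev (ins_nonroot c x2) (\<lambda>x2'. ev (ins_forest d ys) (\<lambda>zs.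
        ev2 (attach (edges x1') n) (\<lambda>n' es'. ev (star_forest x2' zs) (\<lambda>zs'.
        \<phi> (Node (n' + root_dec x1') (es' @ zs'))))))))))"
      by (rule unshuffle_assoc)
    also have "\<dots> = ev2 (unshuffle ts) (\<lambda>b d. ev2 (coprod x) (\<lambda>x1 x2. ev2 (unshuffle b) (\<lambda>a c.
        ev (ins_nonroot a x1) (\<lambda>x1'. ev (ins_nonroot c x2) (\<lambda>x2'. ev (ins_forest d ys) (\<lambda>zs.
        ev2 (attach (edges x1') n) (\<lambda>n' es'. ev (star_forest x2' zs) (\<lambda>zs'.
        \<phi> (Node (n' + root_dec x1') (es' @ zs'))))))))))"
      by (simp only: ev_swap[of "unshuffle _" "coprod _"])
    also have "\<dots> = ev2 (unshuffle ts) (\<lambda>b d. ev (ins_nonroot b x) (\<lambda>x'. ev2 (coprod x') (\<lambda>x1' x2'.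
        ev (ins_forest d ys) (\<lambda>zs. ev2 (attach (edges x1') n) (\<lambda>n' es'.
        ev (star_forest x2' zs) (\<lambda>zs'. \<phi> (Node (n' + root_dec x1') (es' @ zs'))))))))"
      by (intro ev_cong ins_nonroot_coprod[symmetric])
    also have "\<dots> = ev2 (unshuffle ts) (\<lambda>a b. ev (ins_nonroot a x) (\<lambda>x'. ev (ins_nonroot b y) (\<lambda>y'.
        ev (x' \<star>\<^sub>+ y') \<phi>)))"
      unfolding y ev_ins_nonroot[of _ "Node n ys"] tree.sel star_Node by (simp only: ev_swap[of
        "coprod _" "ins_forest _ _"])
    finally show ?thesis .
  qed
  have tree: "ev (x \<star>\<^sub>+ y) (\<lambda>z. ev (ins_free ts z) \<phi>) =
      ev2 (unshuffle ts) (\<lambda>a b. ev (ins_nonroot a x) (\<lambda>x'. ev (ins_free b y) (\<lambda>y'.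
        ev (x' \<star>\<^sub>+ y') \<phi>)))"
    if "noise_free x" for x ts \<phi>
  proof -
    \<comment> \<open>The root of every term is free exactly if that of \<open>y\<close> is, so one
      flag serves the whole sum.\<close>
    let ?k = "noise_free y"
    have "ev (x \<star>\<^sub>+ y) (\<lambda>z. ev (ins_free ts z) \<phi>) =
        ev (x \<star>\<^sub>+ y) (\<lambda>z. ev2 (unshuffle ts) (\<lambda>a b. ev (ins_nonroot b z) (\<lambda>\<rho>.
          ev (ins_root ?k a \<rho>) \<phi>)))"
      by (intro ev_cong) (simp add: ev_ins_free keys_star_noise_free that)
    also have "\<dots> = ev2 (unshuffle ts) (\<lambda>a b. ev (x \<star>\<^sub>+ y) (\<lambda>z. ev (ins_nonroot b z) (\<lambda>\<rho>.
        ev (ins_root ?k a \<rho>) \<phi>)))"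
      by (rule ev_swap)
    also have "\<dots> = ev2 (unshuffle ts) (\<lambda>a b. ev2 (unshuffle b) (\<lambda>c d. ev (ins_nonroot c x) (\<lambda>x'.
        ev (ins_nonroot d y) (\<lambda>y'. ev (ins_root ?k a y') (\<lambda>\<rho>. ev (x' \<star>\<^sub>+ \<rho>) \<phi>)))))"
      unfolding nonroot[OF that] star_ins_root ..
    \<comment> \<open>The root insertion \<open>a\<close> joins the insertions \<open>d\<close>
      above the root of \<open>y\<close>, so that together they form \<open>ins_free\<close> on
      \<open>y\<close>.\<close>
    also have "\<dots> = ev2 (unshuffle ts) (\<lambda>c b. ev2 (unshuffle b) (\<lambda>a d. ev (ins_nonroot c x) (\<lambda>x'.
        ev (ins_nonroot d y) (\<lambda>y'. ev (ins_root ?k a y') (\<lambda>\<rho>. ev (x' \<star>\<^sub>+ \<rho>) \<phi>)))))"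
      by (rule unshuffle.left_commute)
    also have "\<dots> = ev2 (unshuffle ts) (\<lambda>a b. ev (ins_nonroot a x) (\<lambda>x'. ev (ins_free b y) (\<lambda>y'.
        ev (x' \<star>\<^sub>+ y') \<phi>)))"
      unfolding ev_ins_free by (simp only: ev_swap[of "unshuffle _" "ins_nonroot _ _"])
    finally show ?thesis .
  qed
  show ?case
    using tree forest[OF subset_refl] by (simp add: y)
qed

lemma star_ins_free:
  "noise_free x \<Longrightarrow> ev (x \<star>\<^sub>+ y) (\<lambda>z. ev (ins_free ts z) \<phi>) =
    ev2 (unshuffle ts) (\<lambda>a b. ev (ins_nonroot a x) (\<lambda>x'. ev (ins_free b y) (\<lambda>y'.
      ev (x' \<star>\<^sub>+ y') \<phi>)))"
  using star_ins_free_aux by blast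

section \<open>Admissibility of the occurring trees\<close>

definition edge_ok :: "'k set \<Rightarrow> 'x set \<Rightarrow> ('k, 'x, 'd::finite) edge \<Rightarrow> bool" where
  "edge_ok \<I> \<Xi> e \<longleftrightarrow> admissible \<I> \<Xi> (snd e) \<and>
     (case fst (fst e) of Kernel G \<Rightarrow> G \<in> \<I> | Noise X \<Rightarrow> X \<in> \<Xi> \<and> edges (snd e) = [])"

lemma admissible_Node:
  "admissible \<I> \<Xi> (Node n es) \<longleftrightarrow> length (filter noise_edge es) \<le> 1 \<and> (\<forall>e\<in>set es. edge_ok \<I> \<Xi> e)"
  by (simp add: edge_ok_def)

declare admissible.simps [simp del]

lemma trees_iff:
  "x \<in> trees \<I> \<Xi> \<longleftrightarrow> length (filter noise_edge (edges x)) \<le> 1 \<and> (\<forall>e\<in>set (edges x). edge_ok \<I> \<Xi> e)"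
  by (cases x) (simp add: trees_def admissible_Node)

lemma trees0_iff: "x \<in> trees0 \<I> \<Xi> \<longleftrightarrow> noise_free x \<and> (\<forall>e\<in>set (edges x). edge_ok \<I> \<Xi> e)"
  unfolding trees0_def trees_iff noise_free_def by (auto simp: filter_empty_conv)

lemma noise_leaf: "edge_ok \<I> \<Xi> e \<Longrightarrow> noise_edge e \<Longrightarrow> edges (snd e) = []"
  by (auto simp: edge_ok_def noise_edge_def)

lemma edge_ok_replace:
  "edge_ok \<I> \<Xi> e \<Longrightarrow> \<not> noise_edge e \<Longrightarrow> t \<in> trees \<I> \<Xi> \<Longrightarrow> edge_ok \<I> \<Xi> (fst e, t)"
  by (auto simp: edge_ok_def noise_edge_def trees_def split: edge_type.splits)

lemma edge_ok_subtree: "edge_ok \<I> \<Xi> e \<Longrightarrow> snd e \<in> trees \<I> \<Xi>"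
  by (simp add: edge_ok_def trees_def)

lemma edge_ok_lower [simp]: "edge_ok \<I> \<Xi> (lower e l) = edge_ok \<I> \<Xi> e"
  by (simp add: edge_ok_def cong: edge_type.case_cong)

lemma filter_noise_length: "map fst es = map fst es' \<Longrightarrow> length (filter noise_edge es) =
    length (filter noise_edge es')"
  by (induction es es' rule: list_induct2') (auto simp: noise_edge_def)

lemma keys_attach_ok:
  assumes "\<forall>e\<in>set es. edge_ok \<I> \<Xi> e \<and> \<not> noise_edge e"
  shows "Poly_Mapping.keys (attach es n) \<subseteq> {p. \<forall>e\<in>set (snd p). edge_ok \<I> \<Xi> e \<and> \<not> noise_edge e}"
  using assms
proof (induction es)
  case (Cons e es)
  then have "Poly_Mapping.keys (attach es n) \<subseteq> {p. \<forall>e\<in>set (snd p). edge_ok \<I> \<Xi> e \<and> \<not> noise_edge e}"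
    by simp
  then show ?case
    by (intro keys_subsetI) (use Cons.prems in \<open>auto intro!: ev_eq_0\<close>)
qed auto

lemma coprod_trees0:
  assumes "p \<in> Poly_Mapping.keys (coprod x)" "x \<in> trees0 \<I> \<Xi>"
  shows "fst p \<in> trees0 \<I> \<Xi>" "snd p \<in> trees0 \<I> \<Xi>"
  using keys_coprod_edges[OF assms(1)] assms(2) by (auto simp: trees0_iff noise_free_def)

text \<open>Since \<open>x\<close> adds kernel edges only, no vertex obtains a second noise edge.
  The closure is required because the coactions vanish outside the basis by definition.\<close>

lemma keys_star_trees:
  "x \<in> trees0 \<I> \<Xi> \<Longrightarrow> y \<in> trees \<I> \<Xi> \<Longrightarrow> Poly_Mapping.keys (x \<star>\<^sub>+ y) \<subseteq> trees \<I> \<Xi>"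
proof (induction y arbitrary: x rule: measure_induct_rule[of size])
  case (less y)
  obtain n ys where y: "y = Node n ys" by (cases y)
  have forest: "Poly_Mapping.keys (star_forest x us) \<subseteq> {zs. \<forall>e\<in>set zs. edge_ok \<I> \<Xi> e}"
    if "set us \<subseteq> set ys" "x \<in> trees0 \<I> \<Xi>" for us x
    using that
  proof (induction us arbitrary: x)
    case Nil
    show ?case by (rule keys_subsetI) (simp add: star_forest_Nil)
  next
    case (Cons c cs)
    have c: "edge_ok \<I> \<Xi> c" "c \<in> set ys"
      using Cons.prems less.prems(2) by (auto simp: trees_iff y)
    have child: "edge_ok \<I> \<Xi> (fst c, t)" if "t \<in> Poly_Mapping.keys (star_child (noise_edge c) x
        (snd c))" "x \<in> trees0 \<I> \<Xi>" for t x
    proof (cases "noise_edge c")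
      case True
      \<comment> \<open>In an admissible tree a noise edge ends in a leaf, which leaves nothing to
        act on.\<close>
      then have "Poly_Mapping.keys (star_child True x (snd c)) \<subseteq> {snd c}"
        by (intro keys_subsetI, cases "snd c") (use noise_leaf[OF c(1)] in \<open>auto simp:
          star_child_def star_forest_Nil\<close>)
      then show ?thesis using that c True by auto
    next
      case False
      have "size (snd c) < size y" using size_edge[OF c(2)] y by simp
      then have "Poly_Mapping.keys (x \<star>\<^sub>+ snd c) \<subseteq> trees \<I> \<Xi>"
        using less.IH that(2) edge_ok_subtree[OF c(1)] by blast
      then show ?thesis
        using that False edge_ok_replace[OF c(1) False] by (auto simp: star_child_def)
    qed
    have IH: "zs \<in> Poly_Mapping.keys (star_forest x cs) \<Longrightarrow> \<forall>e\<in>set zs. edge_ok \<I> \<Xi> e"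
      if "x \<in> trees0 \<I> \<Xi>" for zs x
      using Cons.IH[OF _ that] Cons.prems(1) by auto
    show ?case
    proof (rule keys_subsetI)
      fix \<phi> :: "('a, 'b, 'c) edge list \<Rightarrow> real"
      assume \<phi>: "\<And>zs. zs \<in> {zs. \<forall>e\<in>set zs. edge_ok \<I> \<Xi> e} \<Longrightarrow> \<phi> zs = 0"
      show "ev (star_forest x (c # cs)) \<phi> = 0"
        unfolding star_forest_Cons ev_star_edge_star_child
      proof (intro ev_eq_0 \<phi>)
        fix p t zs
        assume p: "p \<in> Poly_Mapping.keys (coprod x)"
          and t: "t \<in> Poly_Mapping.keys (star_child (noise_edge c) (fst p) (snd c))"
          and zs: "zs \<in> Poly_Mapping.keys (star_forest (snd p) cs)"
        note p = coprod_trees0[OF p Cons.prems(2)]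
        show "(fst c, t) # zs \<in> {zs. \<forall>e\<in>set zs. edge_ok \<I> \<Xi> e}"
          using child[OF t p(1)] IH[OF p(2) zs] by auto
      qed
    qed
  qed
  show ?case
  proof (rule keys_subsetI)
    fix \<phi> :: "('a, 'b, 'c) tree \<Rightarrow> real"
    assume \<phi>: "\<And>z. z \<in> trees \<I> \<Xi> \<Longrightarrow> \<phi> z = 0"
    show "ev (x \<star>\<^sub>+ y) \<phi> = 0"
      unfolding y star_Node
    proof (intro ev_eq_0 \<phi>)
      fix p q zs
      assume p: "p \<in> Poly_Mapping.keys (coprod x)"
        and q: "q \<in> Poly_Mapping.keys (attach (edges (fst p)) n)"
        and zs: "zs \<in> Poly_Mapping.keys (star_forest (snd p) ys)"
      note p = coprod_trees0[OF p less.prems(1)]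
      have "\<forall>e\<in>set (edges (fst p)). edge_ok \<I> \<Xi> e \<and> \<not> noise_edge e"
        using p(1) by (auto simp: trees0_iff noise_free_def)
      then have q: "\<forall>e\<in>set (snd q). edge_ok \<I> \<Xi> e \<and> \<not> noise_edge e"
        using keys_attach_ok q by blast
      then have "filter noise_edge (snd q) = []"
        by (simp add: filter_empty_conv)
      moreover have "\<forall>e\<in>set zs. edge_ok \<I> \<Xi> e"
        using forest[OF subset_refl p(2)] zs by auto
      moreover have "length (filter noise_edge zs) \<le> 1"
        using filter_noise_length[OF keys_star_forest[OF zs]] less.prems(2) by (simp add: y
          trees_iff)
      ultimately show "Node (fst q + root_dec (fst p)) (snd q @ zs) \<in> trees \<I> \<Xi>"
        using q by (auto simp: trees_iff)
    qed
  qed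
qed

text \<open>A root insertion occurs only at a free root, so the tree that acts there lies in T^0 and
  \<open>keys_star_trees\<close> applies. The second claim ensures that the root is still free after
  the other insertions.\<close>

lemma keys_ins_free_trees:
  "set ts \<subseteq> trees \<I> \<Xi> \<Longrightarrow> y \<in> trees \<I> \<Xi> \<Longrightarrow>
   Poly_Mapping.keys (ins_free ts y) \<subseteq> trees \<I> \<Xi> \<and>
   Poly_Mapping.keys (ins_nonroot ts y) \<subseteq> {z. z \<in> trees \<I> \<Xi> \<and> noise_free z = noise_free y}"
proof (induction y arbitrary: ts rule: measure_induct_rule[of size])
  case (less y)
  obtain n ys where y: "y = Node n ys" by (cases y)
  have forest: "Poly_Mapping.keys (ins_forest ts us) \<subseteq> {zs. map fst zs =
      map fst us \<and> (\<forall>e\<in>set zs. edge_ok \<I> \<Xi> e)}"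
    if "set us \<subseteq> set ys" "set ts \<subseteq> trees \<I> \<Xi>" for us ts
    using that
  proof (induction us arbitrary: ts)
    case Nil
    show ?case by (rule keys_subsetI) (simp add: ins_forest_Nil)
  next
    case (Cons c cs)
    have c: "edge_ok \<I> \<Xi> c" "c \<in> set ys"
      using Cons.prems less.prems(2) by (auto simp: trees_iff y)
    have child: "edge_ok \<I> \<Xi> (fst c, t)"
      if "t \<in> Poly_Mapping.keys (ins_child (noise_edge c) ts (snd c))" "set ts \<subseteq> trees \<I> \<Xi>" for t ts
    proof (cases "noise_edge c")
      case True
      then have "Poly_Mapping.keys (ins_child True ts (snd c)) \<subseteq> {snd c}"
        by (intro keys_subsetI, cases "snd c") (use noise_leaf[OF c(1)] in \<open>auto simp: ins_child_def
          ev_ins_nonroot ins_forest_Nil\<close>)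
      then show ?thesis using that c True by auto
    next
      case False
      have "size (snd c) < size y" using size_edge[OF c(2)] y by simp
      then have "Poly_Mapping.keys (ins_free ts (snd c)) \<subseteq> trees \<I> \<Xi>"
        using less.IH that(2) edge_ok_subtree[OF c(1)] by blast
      then show ?thesis
        using that False edge_ok_replace[OF c(1) False] by (auto simp: ins_child_def)
    qed
    have IH: "zs \<in> Poly_Mapping.keys (ins_forest ts cs) \<Longrightarrow> map fst zs =
        map fst cs \<and> (\<forall>e\<in>set zs. edge_ok \<I> \<Xi> e)"
      if "set ts \<subseteq> trees \<I> \<Xi>" for zs ts
      using Cons.IH[OF _ that] Cons.prems(1) by auto
    show ?case
    proof (rule keys_subsetI)
      fix \<phi> :: "('a, 'b, 'c) edge list \<Rightarrow> real"
      assume \<phi>: "\<And>zs. zs \<in> {zs. map fst zs = map fst (c # cs) \<and> (\<forall>e\<in>set zs. edge_ok \<I> \<Xi> e)} \<Longrightarrow> \<phi> zs =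
          0"
      show "ev (ins_forest ts (c # cs)) \<phi> = 0"
        unfolding ins_forest_Cons
      proof (intro ev_eq_0 \<phi>)
        fix p t zs
        assume p: "p \<in> Poly_Mapping.keys (unshuffle ts)"
          and t: "t \<in> Poly_Mapping.keys (ins_child (noise_edge c) (fst p) (snd c))"
          and zs: "zs \<in> Poly_Mapping.keys (ins_forest (snd p) cs)"
        have "set (fst p) \<subseteq> trees \<I> \<Xi>" "set (snd p) \<subseteq> trees \<I> \<Xi>"
          using keys_unshuffle[OF p] Cons.prems(2) by auto
        then show "(fst c, t) # zs \<in> {zs. map fst zs =
            map fst (c # cs) \<and> (\<forall>e\<in>set zs. edge_ok \<I> \<Xi> e)}"
          using child[OF t] IH[OF _ zs] by auto
      qed
    qed
  qed
  have nonroot: "Poly_Mapping.keys (ins_nonroot ts y) \<subseteq> {z. z \<in> trees \<I> \<Xi> \<and> noise_free z =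
      noise_free y}"
    if "set ts \<subseteq> trees \<I> \<Xi>" for ts
  proof (rule keys_subsetI)
    fix \<phi> :: "('a, 'b, 'c) tree \<Rightarrow> real"
    assume \<phi>: "\<And>z. z \<in> {z. z \<in> trees \<I> \<Xi> \<and> noise_free z = noise_free y} \<Longrightarrow> \<phi> z = 0"
    show "ev (ins_nonroot ts y) \<phi> = 0"
      unfolding ev_ins_nonroot
    proof (intro ev_eq_0 \<phi>)
      fix zs assume "zs \<in> Poly_Mapping.keys (ins_forest ts (edges y))"
      then have zs: "map fst zs = map fst ys" "\<forall>e\<in>set zs. edge_ok \<I> \<Xi> e"
        using forest[OF subset_refl that] by (auto simp: y)
      show "Node (root_dec y) zs \<in> {z. z \<in> trees \<I> \<Xi> \<and> noise_free z = noise_free y}"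
        using zs(2) filter_noise_length[OF zs(1)] noise_edge_map_fst[OF zs(1)] less.prems(2)
        by (simp add: trees_iff y noise_free_map del: set_map)
    qed
  qed
  have "Poly_Mapping.keys (ins_free ts y) \<subseteq> trees \<I> \<Xi>"
  proof (rule keys_subsetI)
    fix \<phi> :: "('a, 'b, 'c) tree \<Rightarrow> real"
    assume \<phi>: "\<And>z. z \<in> trees \<I> \<Xi> \<Longrightarrow> \<phi> z = 0"
    show "ev (ins_free ts y) \<phi> = 0"
      unfolding ev_ins_free
    proof (intro ev_eq_0 \<phi>)
      fix p \<rho> z
      assume p: "p \<in> Poly_Mapping.keys (unshuffle ts)"
        and \<rho>: "\<rho> \<in> Poly_Mapping.keys (ins_nonroot (snd p) y)"
        and z: "z \<in> Poly_Mapping.keys (ins_root (noise_free y) (fst p) \<rho>)"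
      have sub: "set (fst p) \<subseteq> trees \<I> \<Xi>" "set (snd p) \<subseteq> trees \<I> \<Xi>"
        using keys_unshuffle[OF p] less.prems(1) by auto
      then have \<rho>: "\<rho> \<in> trees \<I> \<Xi>" "noise_free \<rho> = noise_free y"
        using nonroot[OF sub(2)] \<rho> by auto
      show "z \<in> trees \<I> \<Xi>"
      proof (cases "fst p")
        case Nil
        then show ?thesis using z \<rho> by (simp add: ins_root_def)
      next
        case (Cons t ts')
        then have "noise_free y" "z \<in> Poly_Mapping.keys (\<rho> \<star>\<^sub>+ t)" "t \<in> trees \<I> \<Xi>"
          using z sub by (auto simp: ins_root_def split: if_splits)
        then show ?thesis
          using keys_star_trees[of \<rho> \<I> \<Xi> t] \<rho> by (auto simp: trees0_iff trees_iff)
      qed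
    qed
  qed
  with nonroot[OF less.prems(1)] show ?case by simp
qed

section \<open>Monomials\<close>

lemma placements_swap: "ev (placements (t # s # ts) V) \<Phi> = ev (placements (s # t # ts) V) \<Phi>" if
  "finite V"
proof -
  have "(\<Sum>p\<in>V. \<Sum>q\<in>V - {p}. G p q) = (\<Sum>q\<in>V. \<Sum>p\<in>V - {q}. G p q)" for G :: "_ \<Rightarrow> _ \<Rightarrow> real"
  proof -
    have "(\<Sum>p\<in>V. \<Sum>q\<in>V - {p}. G p q) = (\<Sum>p\<in>V. \<Sum>q\<in>V. if q \<noteq> p then G p q else 0)"
      using that by (intro sum.cong refl sum.mono_neutral_cong_left) auto
    also have "\<dots> = (\<Sum>q\<in>V. \<Sum>p\<in>V. if p \<noteq> q then G p q else 0)"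
      by (subst sum.swap) (simp add: eq_commute)
    also have "\<dots> = (\<Sum>q\<in>V. \<Sum>p\<in>V - {q}. G p q)"
      using that by (intro sum.cong refl sum.mono_neutral_cong_right) auto
    finally show ?thesis .
  qed
  note swap = this
  have "ev (placements (t # s # ts) V) \<Phi> = (\<Sum>p\<in>V. \<Sum>q\<in>V - {p}.
      ev (placements ts (V - {p} - {q})) (\<lambda>M. \<Phi> (M(q \<mapsto> s, p \<mapsto> t))))"
    by simp
  also have "\<dots> = (\<Sum>q\<in>V. \<Sum>p\<in>V - {q}. ev (placements ts (V - {p} - {q})) (\<lambda>M. \<Phi> (M(q \<mapsto> s, p \<mapsto> t))))"
    by (rule swap)
  also have "\<dots> = (\<Sum>q\<in>V. \<Sum>p\<in>V - {q}. ev (placements ts (V - {q} - {p})) (\<lambda>M. \<Phi> (M(p \<mapsto> t, q \<mapsto> s))))"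
    by (intro sum.cong refl) (auto simp: fun_upd_twist Diff_insert2[symmetric] insert_commute)
  also have "\<dots> = ev (placements (s # t # ts) V) \<Phi>"
    by simp
  finally show ?thesis .
qed

lemma placements_move: "finite V \<Longrightarrow> ev (placements (as @ t # bs) V) \<Phi> =
    ev (placements (t # as @ bs) V) \<Phi>"
proof (induction as arbitrary: V \<Phi>)
  case (Cons a as)
  have "ev (placements ((a # as) @ t # bs) V) \<Phi> = ev (placements (a # t # as @ bs) V) \<Phi>"
    using Cons.prems by (simp only: append_Cons placements.simps ev_sum ev_lin) (simp only: Cons.IH
      finite_Diff placements.simps ev_sum ev_lin)
  with placements_swap[OF Cons.prems] show ?case by (simp only: append_Cons)
qed simp

lemma placements_mset: "finite V \<Longrightarrow> mset ts = mset us \<Longrightarrow> ev (placements ts V) \<Phi> =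
    ev (placements us V) \<Phi>"
proof (induction ts arbitrary: us V \<Phi>)
  case (Cons t ts)
  then have "t \<in> set us" by (metis list.set_intros(1) set_mset_mset)
  then obtain as bs where us: "us = as @ t # bs" by (meson split_list)
  with Cons.prems have "mset ts = mset (as @ bs)" by simp
  with Cons have "ev (placements (t # ts) V) \<Phi> = ev (placements (t # as @ bs) V) \<Phi>"
    by (simp only: placements.simps ev_sum ev_lin ev_single finite_Diff cong: sum.cong)
  also have "\<dots> = ev (placements us V) \<Phi>"
    unfolding us by (rule placements_move[OF Cons.prems(1), symmetric])
  finally show ?case .
qed simp

lemma ins_free_mset: "mset ts = mset us \<Longrightarrow> ev (ins_free ts x) \<phi> = ev (ins_free us x) \<phi>"
  unfolding ins_free_def ev_insertions[OF finite_free_verts] by (rule placements_mset[OF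
    finite_free_verts])

lemma ins_nonroot_mset: "mset ts = mset us \<Longrightarrow> ev (ins_nonroot ts x) \<phi> = ev (ins_nonroot us x) \<phi>"
  unfolding ev_placements_ins_nonroot[symmetric] by (rule placements_mset[OF
    finite_forest_free_verts])

text \<open>This is \<open>\<langle>a, a\<rangle>\<close>, by \<open>pairing_self\<close>, in a form
  that is recursive in the factors.\<close>

definition sym_factor :: "'a multiset \<Rightarrow> real" where
  "sym_factor a = (\<Prod>x\<in>set_mset a. fact (count a x))"

lemma sym_factor_nonzero [simp]: "sym_factor a \<noteq> 0"
  by (simp add: sym_factor_def)

lemma sym_factor_add: "sym_factor (add_mset t a) = real (Suc (count a t)) * sym_factor a"
proof -
  have s: "sym_factor b = (\<Prod>x\<in>insert t (set_mset a). fact (count b x))" if "set_mset b \<subseteq> insert t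
      (set_mset a)" for b
    unfolding sym_factor_def using that by (intro prod.mono_neutral_left) (auto simp: not_in_iff)
  have "sym_factor (add_mset t a) =
      fact (Suc (count a t)) * (\<Prod>x\<in>set_mset a - {t}. fact (count a x))"
    by (subst s) (auto simp: prod.insert_remove intro!: prod.cong split: if_splits)
  moreover have "sym_factor a = fact (count a t) * (\<Prod>x\<in>set_mset a - {t}. fact (count a x))"
    by (subst s) (auto simp: prod.insert_remove)
  ultimately show ?thesis by simp
qed

text \<open>A count of the bijections that respect labels: the first factor \<open>t\<close> has as
  many possible places as its multiplicity in \<open>t # ts\<close>.\<close>

lemma ev_placements_labels:
  assumes "finite V" "image_mset s (mset_set V) = mset ts"
  shows "ev (placements ts V) (\<lambda>M. of_bool (\<forall>p\<in>dom M. M p = Some (s p))) = sym_factor (mset ts)"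
  using assms
proof (induction ts arbitrary: V)
  case Nil
  then show ?case by (simp add: sym_factor_def)
next
  case (Cons t ts)
  have 1: "ev (placements ts (V - {p})) (\<lambda>M. of_bool (\<forall>q\<in>dom (M(p \<mapsto> t)). (M(p \<mapsto> t)) q =
      Some (s q))) =
      (if s p = t then sym_factor (mset ts) else 0)" if "p \<in> V" for p
  proof -
    have "ev (placements ts (V - {p})) (\<lambda>M. of_bool (\<forall>q\<in>dom (M(p \<mapsto> t)). (M(p \<mapsto> t)) q =
        Some (s q))) =
       ev (placements ts (V - {p})) (\<lambda>M. of_bool (s p = t) * of_bool (\<forall>q\<in>dom M. M q = Some (s q)))"
      by (intro ev_placements_cong) (auto simp: of_bool_def)
    moreover have "image_mset s (mset_set (V - {p})) = mset ts" if "s p = t"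
    proof -
      have "add_mset t (image_mset s (mset_set (V - {p}))) = mset (t # ts)"
        using Cons.prems \<open>p \<in> V\<close> that mset_set.remove[of V p] by simp
      then show ?thesis by simp
    qed
    ultimately show ?thesis
      using Cons.IH[of "V - {p}"] Cons.prems(1) by (simp add: ev_fun_mult)
  qed
  have "card {p \<in> V. s p = t} = count (image_mset s (mset_set V)) t"
    using Cons.prems(1) by (simp add: count_image_mset Int_def vimage_def conj_commute)
  then have card: "card {p \<in> V. s p = t} = Suc (count (mset ts) t)"
    by (simp add: Cons.prems(2))
  have "ev (placements (t # ts) V) (\<lambda>M. of_bool (\<forall>p\<in>dom M. M p = Some (s p))) =
      (\<Sum>p\<in>V. if s p = t then sym_factor (mset ts) else 0)"
    using 1 by (simp del: dom_fun_upd)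
  also have "\<dots> = sym_factor (mset (t # ts))"
    using Cons.prems(1) by (simp add: sum.inter_filter[symmetric] card sym_factor_add)
  finally show ?case .
qed

text \<open>Permutations of the indices amount to injective maps of a finite set into itself, so the
  count of placements applies, with index \<open>p\<close> labelled \<open>ts ! p\<close>.\<close>

lemma pairing_self: "pairing ts ts = sym_factor (mset ts)"
proof -
  let ?n = "length ts"
  let ?M = "\<lambda>v. map_of (zip (map v [0..<?n]) ts)"
  have M: "of_bool (\<forall>p\<in>dom (?M v). ?M v p = Some (ts ! p)) = (\<Prod>i<?n. of_bool (ts ! i =
      ts ! v i) :: real)"
    if inj: "inj_on v {..<?n}" for v
  proof -
    have "?M v (v i) = Some (ts ! i)" if "i < ?n" for i
      using that inj by (intro map_of_is_SomeI) (auto simp: distinct_map atLeast0LessThan set_zip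
        intro!: exI[of _ i])
    moreover have "dom (?M v) = v ` {..<?n}"
      by (simp add: dom_map_of_zip atLeast0LessThan)
    ultimately have "(\<forall>p\<in>dom (?M v). ?M v p = Some (ts ! p)) \<longleftrightarrow> (\<forall>i<?n. ts ! i = ts ! v i)"
      by auto
    moreover have "(\<Prod>i<?n. of_bool (ts ! i = ts ! v i) :: real) = of_bool (\<forall>i<?n. ts ! i =
        ts ! v i)"
      by (auto simp: of_bool_def intro!: prod_zero)
    ultimately show ?thesis by simp
  qed
  have "pairing ts ts = (\<Sum>v\<in>{v \<in> {..<?n} \<rightarrow>\<^sub>E {..<?n}. inj_on v {..<?n}}. \<Prod>i<?n. of_bool (ts ! i =
      ts ! v i))"
    unfolding pairing_def
  proof (simp, rule sum.reindex_bij_witness[of _ "\<lambda>v i. if i < ?n then v i else i" "\<lambda>\<pi>. restrict \<pi>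
      {..<?n}"])
    fix \<pi> assume "\<pi> \<in> {\<pi>. \<pi> permutes {..<?n}}"
    then have \<pi>: "\<pi> permutes {..<?n}" by simp
    show "(\<lambda>i. if i < ?n then restrict \<pi> {..<?n} i else i) = \<pi>"
      using permutes_not_in[OF \<pi>] by (auto simp: fun_eq_iff)
    have "inj_on \<pi> {..<?n}" using \<pi> permutes_inj_on by blast
    then show "restrict \<pi> {..<?n} \<in> {v \<in> {..<?n} \<rightarrow>\<^sub>E {..<?n}. inj_on v {..<?n}}"
      using permutes_in_image[OF \<pi>] by auto
    show "(\<Prod>i<?n. of_bool (ts ! i = ts ! restrict \<pi> {..<?n} i)) = (\<Prod>i<?n. of_bool (ts ! i =
        ts ! \<pi> i) :: real)"
      by (intro prod.cong) auto
  next
    fix v assume v: "v \<in> {v \<in> {..<?n} \<rightarrow>\<^sub>E {..<?n}. inj_on v {..<?n}}"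
    then show "restrict (\<lambda>i. if i < ?n then v i else i) {..<?n} = v"
      by (auto simp: fun_eq_iff PiE_iff extensional_def)
    let ?p = "\<lambda>i. if i < ?n then v i else i"
    have *: "?p ` {..<?n} \<subseteq> {..<?n}" "inj_on ?p {..<?n}"
      using v by (auto simp: inj_on_def)
    have "bij_betw ?p {..<?n} {..<?n}"
      unfolding bij_betw_def using *(2) endo_inj_surj[OF finite_lessThan *] by blast
    then show "?p \<in> {\<pi>. \<pi> permutes {..<?n}}"
      by (intro CollectI bij_imp_permutes) auto
  qed
  also have "\<dots> = (\<Sum>v\<in>{v \<in> {..<?n} \<rightarrow>\<^sub>E {..<?n}. inj_on v {..<?n}}. of_bool (\<forall>p\<in>dom (?M v). ?M v p =
      Some (ts ! p)))"
    by (intro sum.cong refl) (simp only: mem_Collect_eq M)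
  also have "\<dots> = ev (placements ts {..<?n}) (\<lambda>M. of_bool (\<forall>p\<in>dom M. M p = Some (ts ! p)))"
    by (rule sum_inj_placements) simp
  also have "\<dots> = sym_factor (mset ts)"
  proof (rule ev_placements_labels)
    have "mset ts = mset (map ((!) ts) [0..<?n])" by (simp add: map_nth)
    then show "image_mset ((!) ts) (mset_set {..<?n}) = mset ts"
      by (simp add: atLeast0LessThan)
  qed simp
  finally show ?thesis .
qed

lemma finite_submultisets: "finite {b. b \<subseteq># a}"
proof (induction a)
  case (add t a)
  have "{b. b \<subseteq># add_mset t a} \<subseteq> {b. b \<subseteq># a} \<union> add_mset t ` {b. b \<subseteq># a}"
  proof
    fix b assume b: "b \<in> {b. b \<subseteq># add_mset t a}"
    show "b \<in> {b. b \<subseteq># a} \<union> add_mset t ` {b. b \<subseteq># a}"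
    proof (cases "t \<in># b")
      case True
      then obtain b' where "b = add_mset t b'" by (meson multi_member_split)
      with b show ?thesis by auto
    next
      case False
      with b show ?thesis
        by (auto simp: subset_mset.le_iff_add) (metis UnE insert_DiffM2 insert_noteq_member
          mset_subset_eq_add_left union_iff union_single_eq_member multi_member_this
            add_mset_remove_trivial diff_union_single_conv)
    qed
  qed
  with add show ?case by (meson finite_Un finite_imageI finite_subset)
qed simp

text \<open>For \<open>a = mset ts\<close>, each \<open>b\<close> arises from \<open>\<langle>a,
  a\<rangle> / (\<langle>b, b\<rangle> \<langle>a - b, a - b\<rangle>)\<close> splittings. In the
  induction, the splittings with \<open>t\<close> on the left contribute the share
  \<open>count b t\<close> of the multiplicity \<open>?c\<close>, those with \<open>t\<close> on the
  right the remaining share.\<close>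

lemma unshuffle_mset:
  "ev2 (unshuffle ts) (\<lambda>p q. G (mset p) (mset q)) / sym_factor (mset ts) =
   (\<Sum>b\<in>{b. b \<subseteq># mset ts}. G b (mset ts - b) / (sym_factor b * sym_factor (mset ts - b)))"
proof (induction ts arbitrary: G)
  case Nil
  then show ?case by (simp add: sym_factor_def)
next
  case (Cons t ts)
  let ?a = "mset ts" and ?a' = "mset (t # ts)"
  let ?c = "real (Suc (count ?a t))"
  let ?H = "\<lambda>b. G b (?a' - b) / (sym_factor b * sym_factor (?a' - b))"
  have 1: "ev2 (unshuffle ts) (\<lambda>p q. G (add_mset t (mset p)) (mset q)) / sym_factor ?a =
      (\<Sum>b\<in>{b. b \<subseteq># ?a'}. real (count b t) * ?H b)"
  proof -
    have "ev2 (unshuffle ts) (\<lambda>p q. G (add_mset t (mset p)) (mset q)) / sym_factor ?a =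
        (\<Sum>b\<in>{b. b \<subseteq># ?a}. G (add_mset t b) (?a - b) / (sym_factor b * sym_factor (?a - b)))"
      by (rule Cons)
    also have "\<dots> = (\<Sum>b\<in>{b. b \<subseteq># ?a}. real (count (add_mset t b) t) * ?H (add_mset t b))"
      by (intro sum.cong refl) (simp add: sym_factor_add)
    also have "\<dots> = (\<Sum>b\<in>add_mset t ` {b. b \<subseteq># ?a}. real (count b t) * ?H b)"
      by (subst sum.reindex) (simp_all only: comp_def inj_on_def add_mset_add_mset_same_iff, blast)
    \<comment> \<open>The new summands are the \<open>b\<close> without \<open>t\<close>, for which
      the factor \<open>count b t\<close> is zero.\<close>
    also have "\<dots> = (\<Sum>b\<in>{b. b \<subseteq># ?a'}. real (count b t) * ?H b)"
    proof (rule sum.mono_neutral_left[OF finite_submultisets])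
      show "\<forall>b\<in>{b. b \<subseteq># ?a'} - add_mset t ` {b. b \<subseteq># ?a}. real (count b t) * ?H b = 0"
      proof
        fix b assume b: "b \<in> {b. b \<subseteq># ?a'} - add_mset t ` {b. b \<subseteq># ?a}"
        have "t \<notin># b"
        proof
          assume "t \<in># b"
          then obtain b' where "b = add_mset t b'" by (meson multi_member_split)
          with b show False by auto
        qed
        then show "real (count b t) * ?H b = 0" by (simp add: not_in_iff)
      qed
    qed auto
    finally show ?thesis .
  qed
  have 2: "ev2 (unshuffle ts) (\<lambda>p q. G (mset p) (add_mset t (mset q))) / sym_factor ?a =
      (\<Sum>b\<in>{b. b \<subseteq># ?a'}. (?c - real (count b t)) * ?H b)"
  proof -
    have "ev2 (unshuffle ts) (\<lambda>p q. G (mset p) (add_mset t (mset q))) / sym_factor ?a =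
        (\<Sum>b\<in>{b. b \<subseteq># ?a}. G b (add_mset t (?a - b)) / (sym_factor b * sym_factor (?a - b)))"
      by (rule Cons)
    also have "\<dots> = (\<Sum>b\<in>{b. b \<subseteq># ?a}. (?c - real (count b t)) * ?H b)"
    proof (intro sum.cong refl)
      fix b assume "b \<in> {b. b \<subseteq># ?a}"
      then have "?a' - b = add_mset t (?a - b)" "count b t \<le> count ?a t"
        by (auto simp: mset_subset_eq_count add_mset_diff_bothsides subset_mset.add_diff_assoc2
          simp flip: add_mset_add_single) (metis add_mset_add_single subset_mset.add_diff_assoc2)
      note b = this
      define d where "d = ?c - real (count b t)"
      have d: "sym_factor (add_mset t (?a - b)) = d * sym_factor (?a - b)" "d \<noteq> 0"
        using b(2) by (simp_all add: d_def sym_factor_add of_nat_diff algebra_simps)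
      show "G b (add_mset t (?a - b)) / (sym_factor b * sym_factor (?a - b)) =
          (?c - real (count b t)) * ?H b"
        unfolding d_def[symmetric] b(1) d(1) using d(2) by simp
    qed
    \<comment> \<open>A submultiset of \<open>?a'\<close> not contained in \<open>?a\<close> uses
      all copies of \<open>t\<close>, so its factor vanishes.\<close>
    also have "\<dots> = (\<Sum>b\<in>{b. b \<subseteq># ?a'}. (?c - real (count b t)) * ?H b)"
    proof (rule sum.mono_neutral_left[OF finite_submultisets])
      show "{b. b \<subseteq># ?a} \<subseteq> {b. b \<subseteq># ?a'}"
        by (auto intro: subset_mset.order_trans)
      show "\<forall>b\<in>{b. b \<subseteq># ?a'} - {b. b \<subseteq># ?a}. (?c - real (count b t)) * ?H b = 0"
      proof
        fix b assume b: "b \<in> {b. b \<subseteq># ?a'} - {b. b \<subseteq># ?a}"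
        then obtain x where x: "count b x > count ?a x" by (auto simp: subseteq_mset_def not_le)
        have le: "count b x \<le> count ?a' x" for x using b by (auto simp: subseteq_mset_def)
        from x le[of x] have "x = t" by (auto split: if_splits)
        with x le[of t] have "count b t = Suc (count ?a t)" by simp
        then show "(?c - real (count b t)) * ?H b = 0" by simp
      qed
    qed
    finally show ?thesis .
  qed
  have "ev2 (unshuffle (t # ts)) (\<lambda>p q. G (mset p) (mset q)) / sym_factor ?a =
      (\<Sum>b\<in>{b. b \<subseteq># ?a'}. real (count b t) * ?H b) + (\<Sum>b\<in>{b. b \<subseteq># ?a'}. (?c - real
        (count b t)) * ?H b)"
    unfolding 1[symmetric] 2[symmetric] by (simp add: ev_fun_add add_divide_distrib)
  also have "\<dots> = ?c * (\<Sum>b\<in>{b. b \<subseteq># ?a'}. ?H b)"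
    unfolding sum_distrib_left sum.distrib[symmetric] distrib_right[symmetric] by (simp only:
      add.commute[of "real _"] diff_add_cancel)
  finally have *: "ev2 (unshuffle (t # ts)) (\<lambda>p q. G (mset p) (mset q)) / sym_factor ?a =
      ?c * (\<Sum>b\<in>{b. b \<subseteq># ?a'}. ?H b)" .
  have c: "?c \<noteq> 0" by simp
  have m: "sym_factor ?a' = sym_factor ?a * ?c" by (simp add: sym_factor_add)
  show ?case
    by (subst (1) m) (simp only: divide_divide_eq_left[symmetric] * nonzero_mult_div_cancel_left[OF
      c])
qed

section \<open>The cointeraction identity\<close>

lemma formal_lin_lookup: "formal_lin \<phi> (Poly_Mapping.lookup w) c = ev w (\<lambda>b. \<phi> b c)"
  unfolding formal_lin_def ev_def
  by (rule Sum_any.expand_superset) (auto simp: in_keys_iff)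

lemma ev_ins_act: "mset ts = a \<Longrightarrow> ev (ins_act a x) \<phi> = ev (ins_free ts x) \<phi>"
  unfolding ins_act_def ins_free_def[symmetric] by (rule ins_free_mset) (simp add: factors_mset)

lemma ev_ins_act_nr: "mset ts = a \<Longrightarrow> ev (ins_act_nr a x) \<phi> = ev (ins_nonroot ts x) \<phi>"
  unfolding ins_act_nr_def ev_insertions_nonroot by (rule ins_nonroot_mset) (simp add: factors_mset)

lemma pairing_factors: "pairing (factors a) (factors a) = sym_factor a"
  by (simp add: pairing_self factors_mset)

lemma trees0_subset: "x \<in> trees0 \<I> \<Xi> \<Longrightarrow> x \<in> trees \<I> \<Xi>" "x \<in> trees0 \<I> \<Xi> \<Longrightarrow> noise_free x"
  by (auto simp: trees0_def noise_free_def)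

lemma monomials_neg_trees: "a \<in> monomials_neg \<I> \<Xi> rK rX \<Longrightarrow> set (factors a) \<subseteq> trees \<I> \<Xi>"
  by (auto simp: monomials_neg_def trees_neg_def factors_mset simp flip: set_mset_mset)

lemma keys_ins_act:
  assumes "a \<in> monomials_neg \<I> \<Xi> rK rX" "y \<in> trees \<I> \<Xi>"
  shows "Poly_Mapping.keys (ins_act a y) \<subseteq> trees \<I> \<Xi>"
  using keys_ins_free_trees[OF monomials_neg_trees[OF assms(1)] assms(2)] by (simp add: ins_act_def
    ins_free_def)

lemma keys_ins_act_nr:
  assumes "a \<in> monomials_neg \<I> \<Xi> rK rX" "x \<in> trees0 \<I> \<Xi>"
  shows "Poly_Mapping.keys (ins_act_nr a x) \<subseteq> trees0 \<I> \<Xi>"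
proof (rule keys_subsetI)
  fix \<phi> :: "('a, 'b, 'c) tree \<Rightarrow> real"
  assume \<phi>: "\<And>z. z \<in> trees0 \<I> \<Xi> \<Longrightarrow> \<phi> z = 0"
  have "Poly_Mapping.keys (ins_nonroot (factors a) x) \<subseteq> trees0 \<I> \<Xi>"
    using keys_ins_free_trees[OF monomials_neg_trees[OF assms(1)] trees0_subset(1)[OF assms(2)]]
      trees0_subset(2)[OF assms(2)]
    by (auto simp: trees0_iff trees_iff)
  then show "ev (ins_act_nr a x) \<phi> = 0"
    unfolding ev_ins_act_nr[OF factors_mset] by (intro ev_eq_0 \<phi>) auto
qed

text \<open>Passage from lists to monomials: the normalisations of the two coactions are exactly the
  weights in \<open>unshuffle_mset\<close>.\<close>

lemma star_ins_act:
  assumes "noise_free x"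
  shows "ev (x \<star>\<^sub>+ y) (\<lambda>z. ev (ins_act a z) \<phi>) / sym_factor a =
    (\<Sum>b\<in>{b. b \<subseteq># a}. ev (ins_act_nr b x) (\<lambda>x'. ev (ins_act (a - b) y) (\<lambda>y'. ev (x' \<star>\<^sub>+ y') \<phi>)) /
      (sym_factor b * sym_factor (a - b)))"
proof -
  have "ev (x \<star>\<^sub>+ y) (\<lambda>z. ev (ins_act a z) \<phi>) =
      ev2 (unshuffle (factors a)) (\<lambda>p q. ev (ins_nonroot p x) (\<lambda>x'. ev (ins_free q y) (\<lambda>y'.
        ev (x' \<star>\<^sub>+ y') \<phi>)))"
    unfolding ev_ins_act[OF factors_mset] by (rule star_ins_free[OF assms])
  also have "\<dots> = ev2 (unshuffle (factors a)) (\<lambda>p q. ev (ins_act_nr (mset p) x) (\<lambda>x'.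
      ev (ins_act (mset q) y) (\<lambda>y'. ev (x' \<star>\<^sub>+ y') \<phi>)))"
    by (simp only: ev_ins_act[OF refl] ev_ins_act_nr[OF refl])
  finally show ?thesis
    using unshuffle_mset[where ts = "factors a" and G = "\<lambda>p q. ev (ins_act_nr p x) (\<lambda>x'.
        ev (ins_act q y) (\<lambda>y'. ev (x' \<star>\<^sub>+ y') \<phi>))"]
    by (simp only: factors_mset)
qed

text \<open>Only pairs \<open>(a, \<sigma>)\<close> with \<open>\<sigma>\<close> in the support of
  \<open>x \<star>\<^sub>+ y\<close> contribute. These \<open>\<sigma>\<close> lie in the basis, so
  \<open>delta_minus\<close> is not cut off there.\<close>

lemma coaction_left:
  assumes "x \<in> trees0 \<I> \<Xi>" "y \<in> trees \<I> \<Xi>" "a \<in> monomials_neg \<I> \<Xi> rK rX"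
  shows "formal_lin (basis \<otimes>\<^sub>m delta_plus \<I> \<Xi>)
      (formal_lin (delta_minus \<I> \<Xi> rK rX) (Poly_Mapping.lookup \<omega>)) (a, x, y) =
    ev (x \<star>\<^sub>+ y) (\<lambda>\<sigma>. ev (ins_act a \<sigma>) (Poly_Mapping.lookup \<omega>)) / sym_factor a"
proof -
  let ?u = "formal_lin (delta_minus \<I> \<Xi> rK rX) (Poly_Mapping.lookup \<omega>)" and ?K = "Poly_Mapping.keys
      (x \<star>\<^sub>+ y)"
  have "formal_lin (basis \<otimes>\<^sub>m delta_plus \<I> \<Xi>) ?u (a, x, y) =
      (\<Sum>b\<in>Pair a ` ?K. ?u b * (basis \<otimes>\<^sub>m delta_plus \<I> \<Xi>) b (a, x, y))"
    unfolding formal_lin_def[of "basis \<otimes>\<^sub>m _"]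
    by (rule Sum_any.expand_superset)
      (auto simp: tensor_map_def basis_def delta_plus_def in_keys_iff split: if_splits)
  also have "\<dots> = (\<Sum>\<sigma>\<in>?K. ?u (a, \<sigma>) * Poly_Mapping.lookup (x \<star>\<^sub>+ y) \<sigma>)"
    using assms by (subst sum.reindex) (auto simp: inj_on_def tensor_map_def basis_def
      delta_plus_def)
  also have "\<dots> = (\<Sum>\<sigma>\<in>?K. Poly_Mapping.lookup (x \<star>\<^sub>+ y) \<sigma> * (ev (ins_act a \<sigma>)
      (Poly_Mapping.lookup \<omega>) / sym_factor a))"
  proof (rule sum.cong[OF refl])
    fix \<sigma> assume "\<sigma> \<in> ?K"
    then have "\<sigma> \<in> trees \<I> \<Xi>"
      using keys_star_trees[OF assms(1,2)] by auto
    then have "?u (a, \<sigma>) = ev \<omega> (\<lambda>\<tau>. 1 / sym_factor a * Poly_Mapping.lookup (ins_act a \<sigma>) \<tau>)"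
      using assms(3) by (simp add: formal_lin_lookup delta_minus_def pairing_factors)
    then have "?u (a, \<sigma>) = ev (ins_act a \<sigma>) (Poly_Mapping.lookup \<omega>) / sym_factor a"
      unfolding ev_fun_mult by (simp add: ev_lookup_commute)
    then show "?u (a, \<sigma>) * Poly_Mapping.lookup (x \<star>\<^sub>+ y) \<sigma> =
        Poly_Mapping.lookup (x \<star>\<^sub>+ y) \<sigma> * (ev (ins_act a \<sigma>) (Poly_Mapping.lookup \<omega>) / sym_factor a)"
      by simp
  qed
  also have "\<dots> = ev (x \<star>\<^sub>+ y) (\<lambda>\<sigma>. ev (ins_act a \<sigma>) (Poly_Mapping.lookup \<omega>)) / sym_factor a"
    by (simp add: ev_def[of "x \<star>\<^sub>+ y"] sum_divide_distrib)
  finally show ?thesis .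
qed

text \<open>Non-root insertions keep the first factor in T^0 and insertions keep the second in the
  basis, so \<open>delta_plus\<close> is not cut off on the pairs that contribute.\<close>

lemma coaction_right_term:
  assumes "x \<in> trees0 \<I> \<Xi>" "y \<in> trees \<I> \<Xi>" "b \<in> monomials_neg \<I> \<Xi> rK rX" "c \<in> monomials_neg \<I> \<Xi> rK
      rX"
  shows "formal_lin (delta_minus_nr \<I> \<Xi> rK rX \<otimes>\<^sub>m delta_minus \<I> \<Xi> rK rX) (formal_lin
      (delta_plus \<I> \<Xi>) (Poly_Mapping.lookup \<omega>)) ((b, x), (c, y)) =
    ev (ins_act_nr b x) (\<lambda>x'. ev (ins_act c y) (\<lambda>y'.
      ev (x' \<star>\<^sub>+ y') (Poly_Mapping.lookup \<omega>))) / (sym_factor b * sym_factor c)"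
proof -
  let ?u = "formal_lin (delta_plus \<I> \<Xi>) (Poly_Mapping.lookup \<omega>)"
  let ?D = "delta_minus_nr \<I> \<Xi> rK rX \<otimes>\<^sub>m delta_minus \<I> \<Xi> rK rX"
  let ?A = "Poly_Mapping.keys (ins_act_nr b x)" and ?B = "Poly_Mapping.keys (ins_act c y)"
  have "formal_lin ?D ?u ((b, x), (c, y)) = (\<Sum>z\<in>?A \<times> ?B. ?u z * ?D z ((b, x), (c, y)))"
    unfolding formal_lin_def[of ?D]
    by (rule Sum_any.expand_superset)
      (auto simp: tensor_map_def delta_minus_def delta_minus_nr_def in_keys_iff split: if_splits)
  also have "\<dots> = (\<Sum>x'\<in>?A. \<Sum>y'\<in>?B. ?u (x', y') * ?D (x', y') ((b, x), (c, y)))"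
    by (simp add: sum.cartesian_product)
  also have "\<dots> = (\<Sum>x'\<in>?A. \<Sum>y'\<in>?B.
      ev (x' \<star>\<^sub>+ y') (Poly_Mapping.lookup \<omega>) * (Poly_Mapping.lookup
      (ins_act_nr b x) x' / sym_factor b * (Poly_Mapping.lookup (ins_act c y) y' / sym_factor c)))"
  proof (rule sum.cong[OF refl], rule sum.cong[OF refl])
    fix x' y' assume "x' \<in> ?A" "y' \<in> ?B"
    then have "x' \<in> trees0 \<I> \<Xi>" "y' \<in> trees \<I> \<Xi>"
      using keys_ins_act[OF assms(4,2)] keys_ins_act_nr[OF assms(3,1)] by auto
    then have "?u (x', y') = ev (x' \<star>\<^sub>+ y') (Poly_Mapping.lookup \<omega>)"
      by (simp add: formal_lin_lookup delta_plus_def ev_lookup_commute[of \<omega>])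
    then show "?u (x', y') * ?D (x', y') ((b, x), (c, y)) =
        ev (x' \<star>\<^sub>+ y') (Poly_Mapping.lookup \<omega>) * (Poly_Mapping.lookup
        (ins_act_nr b x) x' / sym_factor b * (Poly_Mapping.lookup (ins_act c y) y' / sym_factor c))"
      using assms by (simp add: tensor_map_def delta_minus_def delta_minus_nr_def pairing_factors)
  qed
  also have "\<dots> = ev (ins_act_nr b x) (\<lambda>x'. ev (ins_act c y) (\<lambda>y'.
      ev (x' \<star>\<^sub>+ y') (Poly_Mapping.lookup \<omega>))) / (sym_factor b * sym_factor c)"
    unfolding ev_def[of "ins_act_nr b x"] ev_def[of "ins_act c y"]
    by (simp add: sum_divide_distrib sum_distrib_left mult_ac)
  finally show ?thesis .
qed

text \<open>A factorisation of \<open>a\<close> is determined by its first factor, which leaves a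
  finite sum over submultisets.\<close>

lemma coaction_right:
  "formal_lin m13 u (a, x, y) = (\<Sum>b\<in>{b. b \<subseteq># a}. u ((b, x), (a - b, y)))"
proof -
  have "formal_lin m13 u (a, x, y) =
      (\<Sum>z\<in>(\<lambda>b. ((b, x), (a - b, y))) ` {b. b \<subseteq># a}. u z * m13 z (a, x, y))"
    unfolding formal_lin_def
    by (rule Sum_any.expand_superset)
      (auto simp: m13_def basis_def finite_submultisets image_iff split: if_splits)
  also have "\<dots> = (\<Sum>b\<in>{b. b \<subseteq># a}. u ((b, x), (a - b, y)))"
    by (subst sum.reindex) (auto simp: inj_on_def m13_def basis_def intro!: sum.cong)
  finally show ?thesis .
qed

theorem proposition4p23:
  fixes \<I> :: "'k set" and \<Xi> :: "'x set"
    and rK :: "'k \<Rightarrow> real" and rX :: "'x \<Rightarrow> real"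
    and \<omega> :: "('k, 'x, 'd::finite) tree \<Rightarrow>\<^sub>0 real"
  assumes "finite \<I>" and "finite \<Xi>"
    and "Poly_Mapping.keys \<omega> \<subseteq> trees \<I> \<Xi>"
  shows
    "formal_lin (basis \<otimes>\<^sub>m delta_plus \<I> \<Xi>)
       (formal_lin (delta_minus \<I> \<Xi> rK rX) (Poly_Mapping.lookup \<omega>)) =
     formal_lin m13
       (formal_lin (delta_minus_nr \<I> \<Xi> rK rX \<otimes>\<^sub>m delta_minus \<I> \<Xi> rK rX)
         (formal_lin (delta_plus \<I> \<Xi>) (Poly_Mapping.lookup \<omega>)))"
proof (rule ext)
  fix w :: "('k, 'x, 'd) tree multiset \<times> ('k, 'x, 'd) tree \<times> ('k, 'x, 'd) tree"
  obtain a x y where w: "w = (a, x, y)" by (cases w) auto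
  let ?T = "monomials_neg \<I> \<Xi> rK rX"
  let ?L = "formal_lin (basis \<otimes>\<^sub>m delta_plus \<I> \<Xi>)
       (formal_lin (delta_minus \<I> \<Xi> rK rX) (Poly_Mapping.lookup \<omega>))"
  let ?R = "formal_lin (delta_minus_nr \<I> \<Xi> rK rX \<otimes>\<^sub>m delta_minus \<I> \<Xi> rK rX)
         (formal_lin (delta_plus \<I> \<Xi>) (Poly_Mapping.lookup \<omega>))"
  have mon: "b \<in> ?T" "a - b \<in> ?T" if "a \<in> ?T" "b \<subseteq># a" for b
    using that set_mset_mono[OF that(2)] in_diffD[of _ a b] by (auto simp: monomials_neg_def)
  have mon': "a \<in> ?T" if "b \<in> ?T" "a - b \<in> ?T" "b \<subseteq># a" for b
    using that set_mset_union[of b "a - b"] by (auto simp: monomials_neg_def)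
  have "?L (a, x, y) = formal_lin m13 ?R (a, x, y)"
  proof (cases "x \<in> trees0 \<I> \<Xi> \<and> y \<in> trees \<I> \<Xi> \<and> a \<in> ?T")
    case True
    then have "?L (a, x, y) = ev (x \<star>\<^sub>+ y) (\<lambda>\<sigma>.
        ev (ins_act a \<sigma>) (Poly_Mapping.lookup \<omega>)) / sym_factor a"
      by (intro coaction_left) auto
    also have "\<dots> = (\<Sum>b\<in>{b. b \<subseteq># a}. ?R ((b, x), (a - b, y)))"
      unfolding star_ins_act[OF trees0_subset(2)[OF conjunct1[OF True]]]
      using True mon by (intro sum.cong refl coaction_right_term[symmetric]) auto
    finally show ?thesis by (simp add: coaction_right)
  next
    \<comment> \<open>Outside the domain both sides vanish. If \<open>a\<close> contains a tree that
      is not negative, so does \<open>b\<close> or \<open>a - b\<close>.\<close>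
    case False
    have "?L (a, x, y) = 0"
    proof -
      have zero: "formal_lin (delta_minus \<I> \<Xi> rK rX) (Poly_Mapping.lookup \<omega>) z *
          (basis \<otimes>\<^sub>m delta_plus \<I> \<Xi>) z (a, x, y) = 0" for z
        using False by (cases z) (auto simp: tensor_map_def basis_def delta_plus_def
          formal_lin_lookup delta_minus_def)
      show ?thesis unfolding formal_lin_def[of "basis \<otimes>\<^sub>m _"] zero by simp
    qed
    moreover have "?R ((b, x), (a - b, y)) = 0" if "b \<subseteq># a" for b
    proof -
      have "(delta_minus_nr \<I> \<Xi> rK rX \<otimes>\<^sub>m delta_minus \<I> \<Xi> rK rX) z ((b, x), (a - b, y)) = 0" for z
        using False mon'[OF _ _ that] by (cases z) (auto simp: tensor_map_def delta_minus_def
          delta_minus_nr_def)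
      then show ?thesis by (simp add: formal_lin_def[of "_ \<otimes>\<^sub>m _"])
    qed
    ultimately show ?thesis by (simp add: coaction_right)
  qed
  then show "?L w = formal_lin m13 ?R w" by (simp add: w)
qed

end
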